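(* Let $(G,d)$ be a simply connected, sub-Riemannian, $2$-step nilpotent Lie group and denote by $\mathfrak g$ its associated Lie algebra. Fix a norm $\lvert\cdot\rvert$ on $[\mathfrak g,\mathfrak g]$. Then there exists $C>0$ such that $$d(e,q\cdot\exp(\zeta))^2\le d(e,q)^2+C\lvert\zeta\rvert\quad\text{for every }q\in G\text{ and }\zeta\in[\mathfrak g,\mathfrak g].$$
   Context: Let $G$ be a connected Lie group with identity $e$ and Lie algebra $\mathfrak g=T_eG$. The group is $2$-step nilpotent if its nilpotency step is $2$, i.e. $[\mathfrak g,[\mathfrak g,\mathfrak g]]=0$ and $[\mathfrak g,\mathfrak g]\neq 0$. A sub-Riemannian structure $(\Delta,\rho)$ on $G$ consists of a left-invariant subbundle $\Delta\subseteq TG$ that is bracket-generating (the Lie algebra generated by $\Delta_e$ is $\mathfrak g$) and a left-invariant metric tensor $\rho$ on $\Delta$. The case $\Delta=TG$ (Riemannian) is included. An absolutely continuous curve $\gamma:[0,1]\to G$ is $\Delta$-horizontal if $\dot\gamma(t)\in\Delta_{\gamma(t)}$ for a.e. $t$; its length is $\ell(\gamma)=\int_0^1\sqrt{\rho(\dot\gamma(t),\dot\gamma(t))}\,dt$. The associated (left-invariant) sub-Riemannian metric is $d(p,q)=\inf\{\ell(\gamma): \gamma \text{ is } \Delta\text{-horizontal},\ p,q\in\gamma([0,1])\}$. A sub-Riemannian Lie group is a pair $(G,d)$ of this kind. $\exp:\mathfrak g\to G$ is the exponential map. *)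

theory Defs
  imports "HOL-Analysis.Analysis"
begin

section \<open>Smooth manifolds\<close>

text \<open>On an open set \<open>S\<close> of a finite-dimensional space this is the usual class \<open>C^k\<close>: every
  iterated directional derivative of order at most \<open>k\<close> exists and is continuous.\<close>

primrec Ck_on :: "nat \<Rightarrow> ('a::real_normed_vector \<Rightarrow> 'b::real_normed_vector) \<Rightarrow> 'a set \<Rightarrow> bool" where
  "Ck_on 0 f S \<longleftrightarrow> continuous_on S f"
| "Ck_on (Suc k) f S \<longleftrightarrow>
     (\<forall>x\<in>S. f differentiable (at x)) \<and> (\<forall>v. Ck_on k (\<lambda>x. frechet_derivative f (at x) v) S)"

definition smooth_on :: "('a::real_normed_vector \<Rightarrow> 'b::real_normed_vector) \<Rightarrow> 'a set \<Rightarrow> bool" where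
  "smooth_on f S \<longleftrightarrow> (\<forall>k. Ck_on k f S)"

text \<open>A chart is a pair of its domain and its coordinate map.\<close>

type_synonym ('m, 'e) chart = "'m set \<times> ('m \<Rightarrow> 'e)"

abbreviation chart_inv :: "('m, 'e) chart \<Rightarrow> 'e \<Rightarrow> 'm" where
  "chart_inv c \<equiv> inv_into (fst c) (snd c)"

definition smooth_atlas ::
  "('m::topological_space, 'e::euclidean_space) chart set \<Rightarrow> bool" where
  "smooth_atlas A \<longleftrightarrow>
     (\<Union>c\<in>A. fst c) = UNIV \<and>
     (\<forall>(U, \<phi>)\<in>A. open U \<and> open (\<phi> ` U) \<and> homeomorphism U (\<phi> ` U) \<phi> (inv_into U \<phi>)) \<and>
     (\<forall>(U, \<phi>)\<in>A. \<forall>(V, \<psi>)\<in>A. smooth_on (\<psi> \<circ> inv_into U \<phi>) (\<phi> ` (U \<inter> V)))"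

definition smooth_map ::
  "('m::topological_space, 'e::euclidean_space) chart set \<Rightarrow>
   ('n::topological_space, 'f::euclidean_space) chart set \<Rightarrow> ('m \<Rightarrow> 'n) \<Rightarrow> bool" where
  "smooth_map A B f \<longleftrightarrow> continuous_on UNIV f \<and>
     (\<forall>(U, \<phi>)\<in>A. \<forall>(V, \<psi>)\<in>B. smooth_on (\<psi> \<circ> f \<circ> inv_into U \<phi>) (\<phi> ` (U \<inter> f -` V)))"

definition prod_atlas ::
  "('m, 'e) chart set \<Rightarrow> ('n, 'f) chart set \<Rightarrow> ('m \<times> 'n, 'e \<times> 'f) chart set" where
  "prod_atlas A B = {(U \<times> V, map_prod \<phi> \<psi>) | U V \<phi> \<psi>. (U, \<phi>) \<in> A \<and> (V, \<psi>) \<in> B}"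

definition real_atlas :: "(real, real) chart set" where
  "real_atlas = {(UNIV, \<lambda>x. x)}"

text \<open>A preferred chart is selected at every point.  The tangent space at \<open>p\<close> is identified with
  the model space \<open>'e\<close> through the preferred chart at \<open>p\<close>, so a vector \<open>v :: 'e\<close>, taken at \<open>p\<close>, stands
  for the tangent vector with coordinates \<open>v\<close> in that chart.  Every notion below that involves
  tangent vectors at several points goes through the differential \<open>tangent_map\<close> (or \<open>vf_repr\<close>), which
  accounts for the change of preferred chart.\<close>

definition chart_at :: "('m, 'e) chart set \<Rightarrow> 'm \<Rightarrow> ('m, 'e) chart" where
  "chart_at A p = (SOME c. c \<in> A \<and> p \<in> fst c)"

abbreviation coord_at :: "('m, 'e) chart set \<Rightarrow> 'm \<Rightarrow> 'm \<Rightarrow> 'e" where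
  "coord_at A p \<equiv> snd (chart_at A p)"

abbreviation coord_inv_at :: "('m, 'e) chart set \<Rightarrow> 'm \<Rightarrow> 'e \<Rightarrow> 'm" where
  "coord_inv_at A p \<equiv> chart_inv (chart_at A p)"

definition tangent_map ::
  "('m, 'e::euclidean_space) chart set \<Rightarrow> ('n, 'f::euclidean_space) chart set \<Rightarrow>
   ('m \<Rightarrow> 'n) \<Rightarrow> 'm \<Rightarrow> 'e \<Rightarrow> 'f" where
  "tangent_map A B f p =
     frechet_derivative (coord_at B (f p) \<circ> f \<circ> coord_inv_at A p) (at (coord_at A p p))"

text \<open>The vector field \<open>X\<close>, with \<open>X p\<close> a tangent vector at \<open>p\<close>, written in the coordinates
  of the preferred chart at \<open>q\<close>.\<close>

definition vf_repr ::
  "('m, 'e::euclidean_space) chart set \<Rightarrow> 'm \<Rightarrow> ('m \<Rightarrow> 'e) \<Rightarrow> 'e \<Rightarrow> 'e" where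
  "vf_repr A q X x =
     (let p = coord_inv_at A q x
      in frechet_derivative (coord_at A q \<circ> coord_inv_at A p) (at (coord_at A p p)) (X p))"

text \<open>The coordinate formula for the vector field \<open>[X, Y] = X Y - Y X\<close> at the point \<open>q\<close>.\<close>

definition vf_bracket ::
  "('m, 'e::euclidean_space) chart set \<Rightarrow> ('m \<Rightarrow> 'e) \<Rightarrow> ('m \<Rightarrow> 'e) \<Rightarrow> 'm \<Rightarrow> 'e" where
  "vf_bracket A X Y q =
     (let x = coord_at A q q
      in frechet_derivative (vf_repr A q Y) (at x) (vf_repr A q X x)
       - frechet_derivative (vf_repr A q X) (at x) (vf_repr A q Y x))"

section \<open>Lie groups and their Lie algebras\<close>

class mult_group = monoid_mult + inverse +
  assumes mult_group_left_inverse: "inverse a * a = 1"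

definition lie_group ::
  "('g::{mult_group, t2_space, second_countable_topology}, 'e::euclidean_space) chart set \<Rightarrow> bool" where
  "lie_group A \<longleftrightarrow> smooth_atlas A \<and>
     smooth_map (prod_atlas A A) A (\<lambda>(x, y). x * y) \<and> smooth_map A A inverse"

text \<open>The Lie algebra is the tangent space at the identity, i.e. the type \<open>'e\<close>; its bracket is that
  of the left-invariant extensions.\<close>

definition left_inv_field ::
  "('g::mult_group, 'e::euclidean_space) chart set \<Rightarrow> 'e \<Rightarrow> 'g \<Rightarrow> 'e" where
  "left_inv_field A v p = tangent_map A A (\<lambda>x. p * x) 1 v"

definition lie_bracket ::
  "('g::mult_group, 'e::euclidean_space) chart set \<Rightarrow> 'e \<Rightarrow> 'e \<Rightarrow> 'e" where
  "lie_bracket A v w = vf_bracket A (left_inv_field A v) (left_inv_field A w) 1"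

definition bracket_space ::
  "('g::mult_group, 'e::euclidean_space) chart set \<Rightarrow> 'e set \<Rightarrow> 'e set \<Rightarrow> 'e set" where
  "bracket_space A S T = span {lie_bracket A v w | v w. v \<in> S \<and> w \<in> T}"

abbreviation derived_algebra ::
  "('g::mult_group, 'e::euclidean_space) chart set \<Rightarrow> 'e set" where
  "derived_algebra A \<equiv> bracket_space A UNIV UNIV"

definition two_step_nilpotent ::
  "('g::mult_group, 'e::euclidean_space) chart set \<Rightarrow> bool" where
  "two_step_nilpotent A \<longleftrightarrow>
     bracket_space A UNIV (derived_algebra A) = {0} \<and> derived_algebra A \<noteq> {0}"

definition lie_subalgebra ::
  "('g::mult_group, 'e::euclidean_space) chart set \<Rightarrow> 'e set \<Rightarrow> bool" where
  "lie_subalgebra A S \<longleftrightarrow> subspace S \<and> (\<forall>v\<in>S. \<forall>w\<in>S. lie_bracket A v w \<in> S)"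

definition one_param_subgroup ::
  "('g::{mult_group, topological_space}, 'e::euclidean_space) chart set \<Rightarrow> 'e \<Rightarrow> (real \<Rightarrow> 'g) \<Rightarrow> bool" where
  "one_param_subgroup A v \<gamma> \<longleftrightarrow>
     smooth_map real_atlas A \<gamma> \<and> (\<forall>s t. \<gamma> (s + t) = \<gamma> s * \<gamma> t) \<and>
     ((coord_at A 1 \<circ> \<gamma>) has_vector_derivative v) (at 0)"

definition lie_exp ::
  "('g::{mult_group, topological_space}, 'e::euclidean_space) chart set \<Rightarrow> 'e \<Rightarrow> 'g" where
  "lie_exp A v = (THE \<gamma>. one_param_subgroup A v \<gamma>) 1"

section \<open>Sub-Riemannian structures\<close>

definition inner_product_on :: "'e::real_vector set \<Rightarrow> ('e \<Rightarrow> 'e \<Rightarrow> real) \<Rightarrow> bool" where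
  "inner_product_on S B \<longleftrightarrow>
     (\<forall>u\<in>S. \<forall>v\<in>S. B u v = B v u) \<and>
     (\<forall>u\<in>S. \<forall>v\<in>S. \<forall>w\<in>S. B (u + v) w = B u w + B v w) \<and>
     (\<forall>u\<in>S. \<forall>v\<in>S. \<forall>c. B (c *\<^sub>R u) v = c * B u v) \<and>
     (\<forall>u\<in>S. u \<noteq> 0 \<longrightarrow> B u u > 0)"

definition norm_on :: "'e::real_vector set \<Rightarrow> ('e \<Rightarrow> real) \<Rightarrow> bool" where
  "norm_on S N \<longleftrightarrow>
     (\<forall>u\<in>S. N u \<ge> 0) \<and> (\<forall>u\<in>S. N u = 0 \<longleftrightarrow> u = 0) \<and>
     (\<forall>u\<in>S. \<forall>c. N (c *\<^sub>R u) = \<bar>c\<bar> * N u) \<and>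
     (\<forall>u\<in>S. \<forall>v\<in>S. N (u + v) \<le> N u + N v)"

text \<open>\<open>\<Delta> p\<close> is the fibre at \<open>p\<close> of the subbundle and \<open>\<rho> p\<close> the metric tensor there.  Smoothness
  of both in \<open>p\<close>, and constancy of the rank, follow from left-invariance.\<close>

definition sub_riemannian ::
  "('g::mult_group, 'e::euclidean_space) chart set \<Rightarrow> ('g \<Rightarrow> 'e set) \<Rightarrow>
   ('g \<Rightarrow> 'e \<Rightarrow> 'e \<Rightarrow> real) \<Rightarrow> bool" where
  "sub_riemannian A \<Delta> \<rho> \<longleftrightarrow>
     (\<forall>p. subspace (\<Delta> p)) \<and>
     (\<forall>g p. \<Delta> (g * p) = tangent_map A A (\<lambda>x. g * x) p ` \<Delta> p) \<and>
     (lie_subalgebra A hull \<Delta> 1) = UNIV \<and>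
     (\<forall>p. inner_product_on (\<Delta> p) (\<rho> p)) \<and>
     (\<forall>g p. \<forall>u\<in>\<Delta> p. \<forall>v\<in>\<Delta> p.
        \<rho> (g * p) (tangent_map A A (\<lambda>x. g * x) p u) (tangent_map A A (\<lambda>x. g * x) p v) = \<rho> p u v)"

definition abs_continuous_on :: "real \<Rightarrow> real \<Rightarrow> (real \<Rightarrow> 'e::metric_space) \<Rightarrow> bool" where
  "abs_continuous_on a b f \<longleftrightarrow>
     (\<forall>\<epsilon>>0. \<exists>\<delta>>0. \<forall>n. \<forall>l r :: nat \<Rightarrow> real.
        (\<forall>i<n. a \<le> l i \<and> l i \<le> r i \<and> r i \<le> b) \<and>
        disjoint_family_on (\<lambda>i. {l i<..<r i}) {..<n} \<and> (\<Sum>i<n. r i - l i) < \<delta> \<longrightarrow>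
        (\<Sum>i<n. dist (f (l i)) (f (r i))) < \<epsilon>)"

definition abs_continuous_curve ::
  "('m::topological_space, 'e::euclidean_space) chart set \<Rightarrow> (real \<Rightarrow> 'm) \<Rightarrow> bool" where
  "abs_continuous_curve A \<gamma> \<longleftrightarrow> continuous_on {0..1} \<gamma> \<and>
     (\<forall>(U, \<phi>)\<in>A. \<forall>a b. 0 \<le> a \<and> a \<le> b \<and> b \<le> 1 \<and> \<gamma> ` {a..b} \<subseteq> U \<longrightarrow>
        abs_continuous_on a b (\<phi> \<circ> \<gamma>))"

definition velocity ::
  "('m, 'e::euclidean_space) chart set \<Rightarrow> (real \<Rightarrow> 'm) \<Rightarrow> real \<Rightarrow> 'e" where
  "velocity A \<gamma> t = vector_derivative (coord_at A (\<gamma> t) \<circ> \<gamma>) (at t within {0..1})"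

definition horizontal_curve ::
  "('m::topological_space, 'e::euclidean_space) chart set \<Rightarrow> ('m \<Rightarrow> 'e set) \<Rightarrow> (real \<Rightarrow> 'm) \<Rightarrow> bool" where
  "horizontal_curve A \<Delta> \<gamma> \<longleftrightarrow> abs_continuous_curve A \<gamma> \<and>
     (AE t in lebesgue. t \<in> {0..1} \<longrightarrow>
        (coord_at A (\<gamma> t) \<circ> \<gamma>) differentiable (at t within {0..1}) \<and> velocity A \<gamma> t \<in> \<Delta> (\<gamma> t))"

definition curve_length ::
  "('m, 'e::euclidean_space) chart set \<Rightarrow> ('m \<Rightarrow> 'e \<Rightarrow> 'e \<Rightarrow> real) \<Rightarrow> (real \<Rightarrow> 'm) \<Rightarrow> ennreal" where
  "curve_length A \<rho> \<gamma> =
     (\<integral>\<^sup>+ t\<in>{0..1}. ennreal (sqrt (\<rho> (\<gamma> t) (velocity A \<gamma> t) (velocity A \<gamma> t))) \<partial>lebesgue)"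

text \<open>The values are extended reals so that the infimum of the empty set is \<open>\<infinity>\<close>.\<close>

definition sr_dist ::
  "('m::topological_space, 'e::euclidean_space) chart set \<Rightarrow> ('m \<Rightarrow> 'e set) \<Rightarrow>
   ('m \<Rightarrow> 'e \<Rightarrow> 'e \<Rightarrow> real) \<Rightarrow> 'm \<Rightarrow> 'm \<Rightarrow> ennreal" where
  "sr_dist A \<Delta> \<rho> p q =
     (INF \<gamma>\<in>{\<gamma>. horizontal_curve A \<Delta> \<gamma> \<and> p \<in> \<gamma> ` {0..1} \<and> q \<in> \<gamma> ` {0..1}}. curve_length A \<rho> \<gamma>)"

end

theory Submission
  imports Defs "HOL-Real_Asymp.Real_Asymp"
begin

text \<open>
  Let \<open>\<gamma>\<close> be a horizontal curve of length \<open>l\<close> from \<open>1\<close> to \<open>q\<close> and let \<open>X\<close>, \<open>Y\<close> be horizontal vectors at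
  the identity.  The heart of the proof is to perturb \<open>\<gamma>\<close> so that its endpoint moves to
  \<open>q exp (c [X, Y])\<close>, while the square of its length grows by at most \<open>C c\<close> with a constant \<open>C\<close> that does
  not depend on \<open>\<gamma>\<close> (\<open>displaceable_nonneg_multiple\<close>).

  Left translation to the identity turns the velocity of a curve into a control \<open>u (t) \<in> \<Delta> 1\<close>.  As \<open>\<gg>\<close> is
  nilpotent of step two, \<open>Ad (exp X) = id + [X, -]\<close>, which is the identity for \<open>X\<close> in \<open>[\<gg>, \<gg>]\<close>.
  By the product rule the curve \<open>\<gamma> exp (F X) exp (G Y) exp z\<close>, for functions \<open>F\<close>, \<open>G\<close>
  and a curve \<open>z\<close> in \<open>[\<gg>, \<gg>]\<close>, has the control \<open>u + F' X + G' Y\<close> if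
  \<open>z' = F [X, u] + G [Y, u] + G F' [Y, X]\<close> (\<open>controlled_perturbation\<close>).  If \<open>F\<close> and \<open>G\<close> vanish at both
  ends, the endpoint is displaced by \<open>exp z (1)\<close>.  Take \<open>F = \<surd>c \<phi> (\<sigma>)\<close> and \<open>G = \<surd>c \<Phi> (\<sigma>)\<close> with \<open>\<sigma>\<close>
  the arc length of \<open>\<gamma>\<close> divided by \<open>l\<close> (after adding a small constant to the speed, so that it is
  positive), a sine polynomial \<open>\<phi>\<close> and its primitive \<open>\<Phi>\<close>.  The integral of
  \<open>G F'\<close> is \<open>- c\<close> times the integral of \<open>\<phi>\<^sup>2\<close>, that is, \<open>- c\<close> after normalization.  The perturbation of the
  control has the form \<open>\<bar>u\<bar> k\<close> with \<open>\<bar>k\<bar>\<^sup>2\<close> at most a multiple of \<open>c / l\<^sup>2\<close>, so by the inequality of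
  arithmetic and geometric means the new squared length is at most \<open>l\<^sup>2 + C c\<close> plus a multiple of the
  integral of the inner product of \<open>u\<close> and \<open>k\<close>.  It remains to make this integral and those of \<open>F [X, u]\<close>
  and \<open>G [Y, u]\<close> vanish.  These are linear conditions on the coefficients of \<open>\<phi>\<close>, and their number is
  bounded in terms of the dimension of \<open>\<gg>\<close>; one frequency more than that suffices for every \<open>\<gamma>\<close>.
  Following \<open>\<gamma>\<close> by arc length is what makes the estimate independent of its speed.

  Since \<open>\<Delta> 1\<close> generates \<open>\<gg>\<close>, it spans \<open>\<gg>\<close> modulo the central ideal \<open>[\<gg>, \<gg>]\<close>, so the brackets of
  horizontal vectors span \<open>[\<gg>, \<gg>]\<close> (\<open>derived_algebra_horizontal\<close>).  In a basis consisting of such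
  brackets a general displacement \<open>exp \<zeta>\<close> is a product of the displacements treated above, and the sum
  of the costs is a linear function of the absolute values of the coordinates of \<open>\<zeta>\<close>
  (\<open>sr_dist_derived_displacement\<close>).

  The preparations connect the definitions through atlases and absolutely continuous curves with this
  calculus of controls.  They include Lebesgue's theorem on the differentiation of integrals, the
  existence and uniqueness of one-parameter subgroups by Picard's theorem, and the formula for the derivative of
  \<open>Ad (exp (t X))\<close>, which rests on the symmetry of the second derivatives of the multiplication.
\<close>

section \<open>Functions of class \<open>C^k\<close>\<close>

lemma Ck_on_subset: "Ck_on k f S \<Longrightarrow> T \<subseteq> S \<Longrightarrow> Ck_on k f T"
proof (induction k arbitrary: f)
  case 0
  then show ?case by (auto intro: continuous_on_subset)
next
  case (Suc k)
  then show ?case by (auto simp: subset_iff)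
qed

lemma Ck_on_Suc_imp_Ck_on: "Ck_on (Suc k) f S \<Longrightarrow> Ck_on k f S"
proof (induction k arbitrary: f)
  case 0
  then show ?case
    by (auto intro!: continuous_at_imp_continuous_on differentiable_imp_continuous_within)
next
  case (Suc k)
  have "f differentiable (at x)" if "x \<in> S" for x
    using Suc.prems that by simp
  moreover have "Ck_on k (\<lambda>x. frechet_derivative f (at x) v) S" for v
  proof (rule Suc.IH)
    show "Ck_on (Suc k) (\<lambda>x. frechet_derivative f (at x) v) S"
      using Suc.prems Ck_on.simps(2)[of "Suc k" f S] by blast
  qed
  ultimately show ?case by simp
qed

lemma Ck_on_cong:
  assumes "open S" "\<And>x. x \<in> S \<Longrightarrow> f x = g x" "Ck_on k f S"
  shows "Ck_on k g S"
  using assms(2,3)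
proof (induction k arbitrary: f g)
  case 0
  then show ?case using continuous_on_cong[of S S f g] by simp
next
  case (Suc k)
  have d: "(g has_derivative frechet_derivative f (at x)) (at x)" if "x \<in> S" for x
    using Suc.prems that assms(1)
    by (metis Ck_on.simps(2) frechet_derivative_works has_derivative_transform_within_open)
  then have "frechet_derivative f (at x) = frechet_derivative g (at x)" if "x \<in> S" for x
    using frechet_derivative_at that by blast
  moreover have "Ck_on k (\<lambda>x. frechet_derivative f (at x) v) S" for v
    using Suc.prems by simp
  ultimately have "Ck_on k (\<lambda>x. frechet_derivative g (at x) v) S" for v
    using Suc.IH[of "\<lambda>x. frechet_derivative f (at x) v" "\<lambda>x. frechet_derivative g (at x) v"] by simp
  with d show ?case by (auto simp: differentiable_def)
qed

lemma Ck_on_local: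
  assumes "\<And>x. x \<in> S \<Longrightarrow> \<exists>T. open T \<and> x \<in> T \<and> Ck_on k f (S \<inter> T)"
  shows "Ck_on k f S"
  using assms
proof (induction k arbitrary: f)
  case 0
  show ?case
    unfolding Ck_on.simps continuous_on_eq_continuous_within
  proof
    fix x assume "x \<in> S"
    with 0 obtain T where T: "open T" "x \<in> T" "continuous_on (S \<inter> T) f" by auto
    then have "at x within S = at x within (S \<inter> T)"
      by (intro at_within_nhd[of x T]) auto
    then show "continuous (at x within S) f"
      using T \<open>x \<in> S\<close> by (auto simp: continuous_on_eq_continuous_within)
  qed
next
  case (Suc k)
  have "Ck_on k (\<lambda>x. frechet_derivative f (at x) v) S" for v
  proof (rule Suc.IH)
    fix x assume "x \<in> S"
    with Suc.prems obtain T where "open T" "x \<in> T" "Ck_on (Suc k) f (S \<inter> T)" by blast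
    then show "\<exists>T. open T \<and> x \<in> T \<and> Ck_on k (\<lambda>x. frechet_derivative f (at x) v) (S \<inter> T)"
      by (intro exI[of _ T]) simp
  qed
  moreover have "f differentiable (at x)" if "x \<in> S" for x
    using Suc.prems[OF that] that by fastforce
  ultimately show ?case by simp
qed

lemma Ck_on_const: "Ck_on k (\<lambda>x. c) S"
  by (induction k arbitrary: c) simp_all

lemma Ck_on_bounded_linear_compose:
  assumes "bounded_linear L" "open S" "Ck_on k f S"
  shows "Ck_on k (\<lambda>x. L (f x)) S"
  using assms(3)
proof (induction k arbitrary: f)
  case 0
  then show ?case using bounded_linear.continuous_on[OF assms(1)] by simp
next
  case (Suc k)
  have d: "((\<lambda>x. L (f x)) has_derivative (\<lambda>v. L (frechet_derivative f (at x) v))) (at x)"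
    if "x \<in> S" for x
    using Suc.prems that bounded_linear.has_derivative[OF assms(1)]
    by (auto simp: frechet_derivative_works)
  have "frechet_derivative (\<lambda>x. L (f x)) (at x) = (\<lambda>v. L (frechet_derivative f (at x) v))"
    if "x \<in> S" for x
    by (rule frechet_derivative_at[OF d[OF that], symmetric])
  then have "Ck_on k (\<lambda>x. frechet_derivative (\<lambda>x. L (f x)) (at x) v) S" for v
    using Ck_on_cong[OF assms(2) _ Suc.IH[of "\<lambda>x. frechet_derivative f (at x) v"]] Suc.prems by simp
  with d show ?case by (auto simp: differentiable_def)
qed

lemma Ck_on_bounded_linear:
  assumes "bounded_linear L"
  shows "Ck_on k L S"
proof (cases k)
  case 0
  then show ?thesis using assms by (simp add: linear_continuous_on)
next
  case (Suc m)
  have "(L has_derivative L) (at x)" for x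
    using assms by (rule bounded_linear_imp_has_derivative)
  then have "L differentiable (at x)" "frechet_derivative L (at x) = L" for x
    by (auto simp: differentiable_def frechet_derivative_at[symmetric])
  then show ?thesis using Suc by (simp add: Ck_on_const)
qed

lemma Ck_on_add:
  assumes "open S" "Ck_on k f S" "Ck_on k g S"
  shows "Ck_on k (\<lambda>x. f x + g x) S"
  using assms(2,3)
proof (induction k arbitrary: f g)
  case 0
  then show ?case by (simp add: continuous_on_add)
next
  case (Suc k)
  have d: "((\<lambda>x. f x + g x) has_derivative
      (\<lambda>v. frechet_derivative f (at x) v + frechet_derivative g (at x) v)) (at x)"
    if "x \<in> S" for x
    using Suc.prems that by (auto simp: frechet_derivative_works intro!: has_derivative_add)
  have "frechet_derivative (\<lambda>x. f x + g x) (at x) =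
      (\<lambda>v. frechet_derivative f (at x) v + frechet_derivative g (at x) v)" if "x \<in> S" for x
    by (rule frechet_derivative_at[OF d[OF that], symmetric])
  then have "Ck_on k (\<lambda>x. frechet_derivative (\<lambda>x. f x + g x) (at x) v) S" for v
    using Ck_on_cong[OF assms(1) _ Suc.IH[of "\<lambda>x. frechet_derivative f (at x) v"
        "\<lambda>x. frechet_derivative g (at x) v"]] Suc.prems by simp
  with d show ?case by (auto simp: differentiable_def)
qed

lemma Ck_on_sum:
  assumes "open S" "\<And>i. i \<in> I \<Longrightarrow> Ck_on k (f i) S"
  shows "Ck_on k (\<lambda>x. \<Sum>i\<in>I. f i x) S"
  using assms(2)
  by (induction I rule: infinite_finite_induct) (auto intro!: Ck_on_const Ck_on_add assms(1))

lemma Ck_on_scaleR: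
  fixes f :: "_ \<Rightarrow> real"
  assumes "open S" "Ck_on k f S" "Ck_on k g S"
  shows "Ck_on k (\<lambda>x. f x *\<^sub>R g x) S"
  using assms(2,3)
proof (induction k arbitrary: f g)
  case 0
  then show ?case by (simp add: continuous_on_scaleR)
next
  case (Suc k)
  have d: "((\<lambda>x. f x *\<^sub>R g x) has_derivative
      (\<lambda>v. f x *\<^sub>R frechet_derivative g (at x) v + frechet_derivative f (at x) v *\<^sub>R g x)) (at x)"
    if "x \<in> S" for x
    using Suc.prems that by (auto simp: frechet_derivative_works intro!: has_derivative_scaleR)
  have *: "frechet_derivative (\<lambda>x. f x *\<^sub>R g x) (at x) =
      (\<lambda>v. f x *\<^sub>R frechet_derivative g (at x) v + frechet_derivative f (at x) v *\<^sub>R g x)" if "x \<in> S" for x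
    by (rule frechet_derivative_at[OF d[OF that], symmetric])
  have "Ck_on k (\<lambda>x. f x *\<^sub>R frechet_derivative g (at x) v + frechet_derivative f (at x) v *\<^sub>R g x) S" for v
    using Suc.prems by (intro Ck_on_add assms(1) Suc.IH) (auto intro: Ck_on_Suc_imp_Ck_on)
  then have "Ck_on k (\<lambda>x. frechet_derivative (\<lambda>x. f x *\<^sub>R g x) (at x) v) S" for v
    by (rule Ck_on_cong[OF assms(1), rotated]) (simp add: *)
  with d show ?case by (auto simp: differentiable_def)
qed

text \<open>The derivative of \<open>f \<circ> g\<close> in a fixed direction pairs the derivative of \<open>f\<close> with a direction
  that moves with the point; expanding that direction in a basis leaves only derivatives in fixed
  directions, to which the induction hypothesis applies.\<close>

lemma Ck_on_compose:
  fixes g :: "'a::real_normed_vector \<Rightarrow> 'b::euclidean_space" and f :: "'b \<Rightarrow> 'c::real_normed_vector"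
  assumes "open S" "Ck_on k f T" "Ck_on k g S" "g ` S \<subseteq> T"
  shows "Ck_on k (\<lambda>x. f (g x)) S"
  using assms(2,3)
proof (induction k arbitrary: f)
  case 0
  then show ?case using assms(4) by (auto intro: continuous_on_compose2)
next
  case (Suc k)
  have df: "(f has_derivative frechet_derivative f (at (g x))) (at (g x))" if "x \<in> S" for x
    using Suc.prems that assms(4) by (auto simp: frechet_derivative_works)
  have dg: "(g has_derivative frechet_derivative g (at x)) (at x)" if "x \<in> S" for x
    using Suc.prems that by (auto simp: frechet_derivative_works)
  have d: "((\<lambda>x. f (g x)) has_derivative
      (\<lambda>v. frechet_derivative f (at (g x)) (frechet_derivative g (at x) v))) (at x)"
    if "x \<in> S" for x
    using has_derivative_compose[OF dg[OF that] df[OF that]] .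
  have *: "frechet_derivative (\<lambda>x. f (g x)) (at x) v =
      (\<Sum>b\<in>Basis. (frechet_derivative g (at x) v \<bullet> b) *\<^sub>R frechet_derivative f (at (g x)) b)"
    if "x \<in> S" for x v
  proof -
    have "frechet_derivative (\<lambda>x. f (g x)) (at x) v
        = frechet_derivative f (at (g x)) (frechet_derivative g (at x) v)"
      by (simp add: frechet_derivative_at[OF d[OF that], symmetric])
    also have "\<dots> = frechet_derivative f (at (g x))
        (\<Sum>b\<in>Basis. (frechet_derivative g (at x) v \<bullet> b) *\<^sub>R b)"
      by (simp add: euclidean_representation)
    also have "\<dots> = (\<Sum>b\<in>Basis. (frechet_derivative g (at x) v \<bullet> b) *\<^sub>R frechet_derivative f (at (g x)) b)"
      using has_derivative_linear[OF df[OF that]] by (simp add: linear_sum linear_cmul)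
    finally show ?thesis .
  qed
  have gk: "Ck_on k g S"
    using Suc.prems(2) by (rule Ck_on_Suc_imp_Ck_on)
  have "Ck_on k (\<lambda>x. \<Sum>b\<in>Basis. (frechet_derivative g (at x) v \<bullet> b) *\<^sub>R frechet_derivative f (at (g x)) b) S" for v
  proof (intro Ck_on_sum Ck_on_scaleR assms(1))
    fix b :: 'b
    show "Ck_on k (\<lambda>x. frechet_derivative g (at x) v \<bullet> b) S"
      using Suc.prems(2)
      by (intro Ck_on_bounded_linear_compose[OF bounded_linear_inner_left assms(1)]) simp
    show "Ck_on k (\<lambda>x. frechet_derivative f (at (g x)) b) S"
      using Suc.IH[of "\<lambda>x. frechet_derivative f (at x) b"] Suc.prems(1) gk by simp
  qed
  then have "Ck_on k (\<lambda>x. frechet_derivative (\<lambda>x. f (g x)) (at x) v) S" for v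
    by (rule Ck_on_cong[OF assms(1), rotated]) (simp add: *)
  with d show ?case by (auto simp: differentiable_def)
qed

lemma smooth_on_imp_Ck_on: "smooth_on f S \<Longrightarrow> Ck_on k f S"
  by (simp add: smooth_on_def)

lemma smooth_onI: "(\<And>k. Ck_on k f S) \<Longrightarrow> smooth_on f S"
  by (simp add: smooth_on_def)

lemma smooth_on_subset: "smooth_on f S \<Longrightarrow> T \<subseteq> S \<Longrightarrow> smooth_on f T"
  by (rule smooth_onI, rule Ck_on_subset[OF smooth_on_imp_Ck_on])

lemma smooth_on_cong:
  "smooth_on f S \<Longrightarrow> open S \<Longrightarrow> (\<And>x. x \<in> S \<Longrightarrow> f x = g x) \<Longrightarrow> smooth_on g S"
  by (rule smooth_onI, rule Ck_on_cong[OF _ _ smooth_on_imp_Ck_on])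

lemma smooth_on_local:
  assumes "\<And>x. x \<in> S \<Longrightarrow> \<exists>T. open T \<and> x \<in> T \<and> smooth_on f (S \<inter> T)"
  shows "smooth_on f S"
proof (rule smooth_onI, rule Ck_on_local)
  fix k x assume "x \<in> S"
  then obtain T where "open T" "x \<in> T" "smooth_on f (S \<inter> T)" using assms by blast
  then show "\<exists>T. open T \<and> x \<in> T \<and> Ck_on k f (S \<inter> T)"
    using smooth_on_imp_Ck_on by blast
qed

lemma smooth_on_bounded_linear: "bounded_linear f \<Longrightarrow> smooth_on f S"
  by (rule smooth_onI, rule Ck_on_bounded_linear)

lemma smooth_on_const: "smooth_on (\<lambda>x. c) S"
  by (rule smooth_onI, rule Ck_on_const)

lemma smooth_on_ident: "smooth_on (\<lambda>x. x) S"
  by (rule smooth_on_bounded_linear[OF bounded_linear_ident])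

lemma smooth_on_add: "open S \<Longrightarrow> smooth_on f S \<Longrightarrow> smooth_on g S \<Longrightarrow> smooth_on (\<lambda>x. f x + g x) S"
  by (rule smooth_onI, rule Ck_on_add[OF _ smooth_on_imp_Ck_on smooth_on_imp_Ck_on])

lemma smooth_on_compose:
  fixes g :: "'a::real_normed_vector \<Rightarrow> 'b::euclidean_space"
  shows "open S \<Longrightarrow> smooth_on f T \<Longrightarrow> smooth_on g S \<Longrightarrow> g ` S \<subseteq> T \<Longrightarrow> smooth_on (\<lambda>x. f (g x)) S"
  by (rule smooth_onI, rule Ck_on_compose[OF _ smooth_on_imp_Ck_on smooth_on_imp_Ck_on])

lemma smooth_on_bounded_linear_compose:
  "bounded_linear L \<Longrightarrow> open S \<Longrightarrow> smooth_on f S \<Longrightarrow> smooth_on (\<lambda>x. L (f x)) S"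
  by (rule smooth_onI, rule Ck_on_bounded_linear_compose[OF _ _ smooth_on_imp_Ck_on])

lemma smooth_on_Pair:
  assumes "open S" "smooth_on f S" "smooth_on g S"
  shows "smooth_on (\<lambda>x. (f x, g x)) S"
proof -
  have "smooth_on (\<lambda>x. (f x, 0)) S" "smooth_on (\<lambda>x. (0, g x)) S"
    by (intro smooth_on_bounded_linear_compose[of "\<lambda>x. (x, 0)"] smooth_on_bounded_linear_compose[of "\<lambda>x. (0, x)"]
        assms bounded_linear_Pair bounded_linear_ident bounded_linear_zero)+
  from smooth_on_add[OF assms(1) this] show ?thesis by simp
qed

lemma smooth_on_imp_continuous_on: "smooth_on f S \<Longrightarrow> continuous_on S f"
  using smooth_on_imp_Ck_on[of f S 0] by simp

lemma smooth_on_has_derivative: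
  assumes "smooth_on f S" "x \<in> S"
  shows "(f has_derivative frechet_derivative f (at x)) (at x)"
  using smooth_on_imp_Ck_on[OF assms(1), of "Suc 0"] assms(2) frechet_derivative_works by auto

lemma smooth_on_frechet_derivative:
  "smooth_on f S \<Longrightarrow> smooth_on (\<lambda>x. frechet_derivative f (at x) v) S"
  by (rule smooth_onI) (use smooth_on_imp_Ck_on[of f S "Suc _"] in simp)

text \<open>On a compact ball the derivatives in the finitely many basis directions are bounded.\<close>

lemma smooth_on_locally_lipschitz:
  fixes f :: "'a::euclidean_space \<Rightarrow> 'b::real_normed_vector"
  assumes "smooth_on f S" "open S" "x0 \<in> S"
  obtains r L where "r > 0" "L > 0" "cball x0 r \<subseteq> S"
    "\<And>x y. x \<in> cball x0 r \<Longrightarrow> y \<in> cball x0 r \<Longrightarrow> dist (f x) (f y) \<le> L * dist x y"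
proof -
  obtain r where r: "r > 0" "cball x0 r \<subseteq> S"
    using assms open_contains_cball by blast
  have "\<exists>K. \<forall>x\<in>cball x0 r. norm (frechet_derivative f (at x) b) \<le> K" for b
  proof -
    have "continuous_on (cball x0 r) (\<lambda>x. frechet_derivative f (at x) b)"
      using smooth_on_frechet_derivative[OF assms(1)] r(2)
      by (meson continuous_on_subset smooth_on_imp_continuous_on)
    then have "bounded ((\<lambda>x. frechet_derivative f (at x) b) ` cball x0 r)"
      by (intro compact_imp_bounded compact_continuous_image) auto
    then show ?thesis by (auto simp: bounded_iff)
  qed
  then obtain K where K: "\<And>b x. x \<in> cball x0 r \<Longrightarrow> norm (frechet_derivative f (at x) b) \<le> K b"
    by metis
  define L where "L = 1 + (\<Sum>b\<in>(Basis::'a set). \<bar>K b\<bar>)"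
  have "L > 0" unfolding L_def by (simp add: add_pos_nonneg sum_nonneg)
  moreover have "dist (f x) (f y) \<le> L * dist x y" if "x \<in> cball x0 r" "y \<in> cball x0 r" for x y
    unfolding dist_norm
  proof (rule differentiable_bound[OF convex_cball _ _ that])
    fix z assume z: "z \<in> cball x0 r"
    have d: "(f has_derivative frechet_derivative f (at z)) (at z)"
      using smooth_on_has_derivative[OF assms(1)] z r(2) by auto
    then show "(f has_derivative frechet_derivative f (at z)) (at z within cball x0 r)"
      by (rule has_derivative_at_withinI)
    show "onorm (frechet_derivative f (at z)) \<le> L"
    proof (rule onorm_bound)
      show "0 \<le> L" using \<open>L > 0\<close> by simp
      fix v
      have "frechet_derivative f (at z) v = frechet_derivative f (at z) (\<Sum>b\<in>Basis. (v \<bullet> b) *\<^sub>R b)"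
        by (simp add: euclidean_representation)
      also have "\<dots> = (\<Sum>b\<in>Basis. (v \<bullet> b) *\<^sub>R frechet_derivative f (at z) b)"
        using has_derivative_linear[OF d] by (simp add: linear_sum linear_cmul)
      finally have "norm (frechet_derivative f (at z) v) \<le> (\<Sum>b\<in>Basis. \<bar>v \<bullet> b\<bar> * norm (frechet_derivative f (at z) b))"
        using norm_sum[of "\<lambda>b. (v \<bullet> b) *\<^sub>R frechet_derivative f (at z) b" Basis] by simp
      also have "\<dots> \<le> (\<Sum>b\<in>(Basis::'a set). norm v * \<bar>K b\<bar>)"
        using K[OF z] by (intro sum_mono mult_mono) (auto simp: Basis_le_norm intro: order_trans[OF _ abs_ge_self])
      also have "\<dots> \<le> L * norm v"
        by (simp add: L_def sum_distrib_left[symmetric] algebra_simps)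
      finally show "norm (frechet_derivative f (at z) v) \<le> L * norm v" .
    qed
  qed
  ultimately show ?thesis using that r by blast
qed

text \<open>The second difference is a difference in the direction \<open>v\<close> of differences in the direction \<open>w\<close>;
  the mean value theorem is applied to each of the two.\<close>

lemma second_difference_mean_value:
  fixes f :: "'a::real_normed_vector \<Rightarrow> real"
  assumes f: "smooth_on f (ball x d)" and h: "h > 0" and small: "h * (norm v + norm w) < d"
  shows "\<exists>p. dist x p \<le> h * (norm v + norm w) \<and>
    f (x + h *\<^sub>R v + h *\<^sub>R w) - f (x + h *\<^sub>R v) - f (x + h *\<^sub>R w) + f x =
      h\<^sup>2 * frechet_derivative (\<lambda>y. frechet_derivative f (at y) v) (at p) w"
proof -
  have inb: "dist x (x + s *\<^sub>R v + t *\<^sub>R w) \<le> h * (norm v + norm w)"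
    if "0 \<le> s" "s \<le> h" "0 \<le> t" "t \<le> h" for s t
  proof -
    have "dist x (x + s *\<^sub>R v + t *\<^sub>R w) = norm (s *\<^sub>R v + t *\<^sub>R w)"
      by (metis add.assoc add_diff_cancel_left' dist_commute dist_norm)
    also have "\<dots> \<le> s * norm v + t * norm w"
      using that norm_triangle_ineq[of "s *\<^sub>R v" "t *\<^sub>R w"] by simp
    also have "\<dots> \<le> h * (norm v + norm w)"
      using that by (simp add: distrib_left add_mono mult_right_mono)
    finally show ?thesis .
  qed
  have inball: "x + s *\<^sub>R v + t *\<^sub>R w \<in> ball x d" if "0 \<le> s" "s \<le> h" "0 \<le> t" "t \<le> h" for s t
    using inb[OF that] small by simp
  define g where "g s = f (x + s *\<^sub>R v + h *\<^sub>R w) - f (x + s *\<^sub>R v)" for s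
  define D where "D y = frechet_derivative f (at y)" for y
  have Df: "(f has_derivative D y) (at y)" if "y \<in> ball x d" for y
    unfolding D_def by (rule smooth_on_has_derivative[OF f that])
  have dg: "(g has_real_derivative D (x + s *\<^sub>R v + h *\<^sub>R w) v - D (x + s *\<^sub>R v) v) (at s)"
    if s: "0 \<le> s" "s \<le> h" for s
  proof -
    have 1: "((\<lambda>s. x + s *\<^sub>R v + h *\<^sub>R w) has_derivative (\<lambda>s. s *\<^sub>R v)) (at s)"
      "((\<lambda>s. x + s *\<^sub>R v) has_derivative (\<lambda>s. s *\<^sub>R v)) (at s)"
      by (auto intro!: derivative_eq_intros)
    have i1: "x + s *\<^sub>R v + h *\<^sub>R w \<in> ball x d" and i2: "x + s *\<^sub>R v \<in> ball x d"
      using inball[of s h] inball[of s 0] s h by simp_all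
    have "(g has_derivative (\<lambda>s'. D (x + s *\<^sub>R v + h *\<^sub>R w) (s' *\<^sub>R v) - D (x + s *\<^sub>R v) (s' *\<^sub>R v))) (at s)"
      unfolding g_def
      by (intro has_derivative_diff has_derivative_compose[OF 1(1) Df[OF i1]] has_derivative_compose[OF 1(2) Df[OF i2]])
    moreover have "linear (D (x + s *\<^sub>R v + h *\<^sub>R w))" "linear (D (x + s *\<^sub>R v))"
      using Df[OF i1] Df[OF i2] has_derivative_linear by auto
    moreover have "(\<lambda>s'. D (x + s *\<^sub>R v + h *\<^sub>R w) (s' *\<^sub>R v) - D (x + s *\<^sub>R v) (s' *\<^sub>R v)) =
        (*) (D (x + s *\<^sub>R v + h *\<^sub>R w) v - D (x + s *\<^sub>R v) v)" if "linear (D (x + s *\<^sub>R v + h *\<^sub>R w))" "linear (D (x + s *\<^sub>R v))"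
      using that by (auto simp: linear_cmul algebra_simps)
    ultimately show ?thesis
      unfolding has_field_derivative_def by simp
  qed
  obtain s where s: "0 < s" "s < h" "g h - g 0 = (h - 0) * (D (x + s *\<^sub>R v + h *\<^sub>R w) v - D (x + s *\<^sub>R v) v)"
    using MVT2[OF h, of g "\<lambda>s. D (x + s *\<^sub>R v + h *\<^sub>R w) v - D (x + s *\<^sub>R v) v", OF dg] by auto
  define k where "k t = D (x + s *\<^sub>R v + t *\<^sub>R w) v" for t
  have dk: "(k has_real_derivative frechet_derivative (\<lambda>y. D y v) (at (x + s *\<^sub>R v + t *\<^sub>R w)) w) (at t)"
    if t: "0 \<le> t" "t \<le> h" for t
  proof -
    have 1: "((\<lambda>t. x + s *\<^sub>R v + t *\<^sub>R w) has_derivative (\<lambda>t. t *\<^sub>R w)) (at t)"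
      by (auto intro!: derivative_eq_intros)
    have 2: "((\<lambda>y. D y v) has_derivative frechet_derivative (\<lambda>y. D y v) (at (x + s *\<^sub>R v + t *\<^sub>R w)))
        (at (x + s *\<^sub>R v + t *\<^sub>R w))"
      unfolding D_def
      by (rule smooth_on_has_derivative[OF smooth_on_frechet_derivative[OF f]]) (use inball s t in auto)
    have "(\<lambda>t'. frechet_derivative (\<lambda>y. D y v) (at (x + s *\<^sub>R v + t *\<^sub>R w)) (t' *\<^sub>R w)) =
        (*) (frechet_derivative (\<lambda>y. D y v) (at (x + s *\<^sub>R v + t *\<^sub>R w)) w)"
      using has_derivative_linear[OF 2] by (auto simp: linear_cmul algebra_simps)
    with has_derivative_compose[OF 1 2] show ?thesis
      by (simp add: k_def[abs_def] has_field_derivative_def)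
  qed
  obtain t where t: "0 < t" "t < h"
    "k h - k 0 = (h - 0) * frechet_derivative (\<lambda>y. D y v) (at (x + s *\<^sub>R v + t *\<^sub>R w)) w"
    using MVT2[OF h, of k "\<lambda>t. frechet_derivative (\<lambda>y. D y v) (at (x + s *\<^sub>R v + t *\<^sub>R w)) w", OF dk]
    by auto
  have "g h - g 0 = h\<^sup>2 * frechet_derivative (\<lambda>y. D y v) (at (x + s *\<^sub>R v + t *\<^sub>R w)) w"
    using s(3) t(3) by (simp add: k_def power2_eq_square)
  then show ?thesis
    using inb[of s t] s t by (intro exI[of _ "x + s *\<^sub>R v + t *\<^sub>R w"]) (auto simp: g_def D_def)
qed

text \<open>Both iterated derivatives are limits of the same second difference quotient, which is
  symmetric in the two directions.\<close>

lemma smooth_on_second_derivative_symmetric_real: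
  fixes f :: "'a::real_normed_vector \<Rightarrow> real"
  assumes f: "smooth_on f S" and "open S" "x \<in> S"
  shows "frechet_derivative (\<lambda>y. frechet_derivative f (at y) v) (at x) w =
         frechet_derivative (\<lambda>y. frechet_derivative f (at y) w) (at x) v"
proof (rule ccontr)
  define P where "P p = frechet_derivative (\<lambda>y. frechet_derivative f (at y) v) (at p) w" for p
  define Q where "Q p = frechet_derivative (\<lambda>y. frechet_derivative f (at y) w) (at p) v" for p
  assume "\<not> ?thesis"
  then have e: "\<bar>P x - Q x\<bar> / 2 > 0" unfolding P_def Q_def by simp
  obtain d0 where d0: "d0 > 0" "ball x d0 \<subseteq> S" using assms openE by blast
  have "isCont P x" "isCont Q x"
    unfolding P_def Q_def
    by (rule continuous_on_interior[OF smooth_on_imp_continuous_on[OF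
          smooth_on_frechet_derivative[OF smooth_on_frechet_derivative[OF f]]]],
        simp add: interior_open assms)+
  then have "\<exists>d>0. \<forall>p. dist p x < d \<longrightarrow> dist (P p) (P x) < \<bar>P x - Q x\<bar> / 2"
    "\<exists>d>0. \<forall>p. dist p x < d \<longrightarrow> dist (Q p) (Q x) < \<bar>P x - Q x\<bar> / 2"
    unfolding continuous_at_eps_delta by (simp_all only: e)
  then obtain d1 d2 where d1: "d1 > 0" "\<And>p. dist p x < d1 \<Longrightarrow> dist (P p) (P x) < \<bar>P x - Q x\<bar> / 2"
    and d2: "d2 > 0" "\<And>p. dist p x < d2 \<Longrightarrow> dist (Q p) (Q x) < \<bar>P x - Q x\<bar> / 2"
    by blast
  define d where "d = min d0 (min d1 d2)"
  have d: "d > 0" using d0 d1 d2 by (simp add: d_def)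
  define h where "h = d / (2 * (norm v + norm w + 1))"
  have n: "norm v + norm w + 1 > 0" by (simp add: add_nonneg_pos)
  have h: "h > 0" using d n by (simp add: h_def)
  have "h * (norm v + norm w) \<le> h * (norm v + norm w + 1)" using h by simp
  also have "\<dots> = d / 2" using n by (simp add: h_def divide_simps)
  finally have small: "h * (norm v + norm w) < d" using d by simp
  have fd: "smooth_on f (ball x d)"
    by (rule smooth_on_subset[OF f]) (use d0(2) in \<open>auto simp: d_def\<close>)
  obtain p where p: "dist x p \<le> h * (norm v + norm w)"
    "f (x + h *\<^sub>R v + h *\<^sub>R w) - f (x + h *\<^sub>R v) - f (x + h *\<^sub>R w) + f x = h\<^sup>2 * P p"
    using second_difference_mean_value[OF fd h small] P_def by auto
  have small': "h * (norm w + norm v) < d" using small by (simp add: add.commute)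
  obtain q where q: "dist x q \<le> h * (norm w + norm v)"
    "f (x + h *\<^sub>R w + h *\<^sub>R v) - f (x + h *\<^sub>R w) - f (x + h *\<^sub>R v) + f x = h\<^sup>2 * Q q"
    using second_difference_mean_value[OF fd h small'] Q_def by auto
  have sw: "x + h *\<^sub>R w + h *\<^sub>R v = x + h *\<^sub>R v + h *\<^sub>R w" by simp
  have "h\<^sup>2 * P p = h\<^sup>2 * Q q" using p(2) q(2) unfolding sw by linarith
  then have "P p = Q q" using h by simp
  moreover have "dist p x < d1" "dist q x < d2" "dist p x < d2"
    using p(1) q(1) small by (simp_all add: d_def dist_commute add.commute)
  ultimately show False
    using d1(2)[of p] d2(2)[of q] by (simp add: dist_real_def abs_if split: if_splits)
qed

lemma smooth_on_second_derivative_symmetric: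
  fixes f :: "'a::real_normed_vector \<Rightarrow> 'b::euclidean_space"
  assumes f: "smooth_on f S" and "open S" "x \<in> S"
  shows "frechet_derivative (\<lambda>y. frechet_derivative f (at y) v) (at x) w =
         frechet_derivative (\<lambda>y. frechet_derivative f (at y) w) (at x) v"
proof (rule euclidean_eqI)
  fix b :: 'b
  define g where "g y = f y \<bullet> b" for y
  have g: "smooth_on g S"
    unfolding g_def by (rule smooth_on_bounded_linear_compose[OF bounded_linear_inner_left assms(2) f])
  have 1: "frechet_derivative g (at y) u = frechet_derivative f (at y) u \<bullet> b" if "y \<in> S" for y u
    unfolding g_def
    using fun_cong[OF frechet_derivative_at[OF has_derivative_inner_left[OF smooth_on_has_derivative[OF f that], of b]], of u]
    by simp
  have 2: "frechet_derivative (\<lambda>y. frechet_derivative g (at y) u) (at x) u' =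
      frechet_derivative (\<lambda>y. frechet_derivative f (at y) u) (at x) u' \<bullet> b" for u u'
  proof -
    have "((\<lambda>y. frechet_derivative f (at y) u \<bullet> b) has_derivative
        (\<lambda>u'. frechet_derivative (\<lambda>y. frechet_derivative f (at y) u) (at x) u' \<bullet> b)) (at x)"
      by (intro has_derivative_inner_left smooth_on_has_derivative[OF smooth_on_frechet_derivative[OF f]] assms)
    then have "((\<lambda>y. frechet_derivative g (at y) u) has_derivative
        (\<lambda>u'. frechet_derivative (\<lambda>y. frechet_derivative f (at y) u) (at x) u' \<bullet> b)) (at x)"
      by (rule has_derivative_transform_within_open[OF _ assms(2,3)]) (simp add: 1)
    from fun_cong[OF frechet_derivative_at[OF this], of u'] show ?thesis by simp
  qed
  show "frechet_derivative (\<lambda>y. frechet_derivative f (at y) v) (at x) w \<bullet> b =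
        frechet_derivative (\<lambda>y. frechet_derivative f (at y) w) (at x) v \<bullet> b"
    using smooth_on_second_derivative_symmetric_real[OF g assms(2,3), of v w] by (simp add: 2)
qed

section \<open>Differentiation of indefinite integrals\<close>

lemma absolutely_integrable_on_sets:
  fixes f :: "real \<Rightarrow> real"
  assumes "f absolutely_integrable_on S" "T \<subseteq> S" "T \<in> sets lebesgue"
  shows "f absolutely_integrable_on T"
  using set_integrable_subset[OF assms(1,3,2)] .

text \<open>Truncating \<open>\<bar>f\<bar>\<close> at a high level \<open>n\<close> costs little in \<open>L\<^sup>1\<close>, and the truncation contributes
  at most \<open>n\<close> times the measure of the set.\<close>

lemma integral_abs_small_on_small_sets:
  fixes f :: "real \<Rightarrow> real"
  assumes f: "f absolutely_integrable_on {0..1}" and "e > 0"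
  obtains d where "d > 0"
    "\<And>T. T \<subseteq> {0..1} \<Longrightarrow> T \<in> sets lebesgue \<Longrightarrow> measure lebesgue T < d \<Longrightarrow> integral T (\<lambda>t. \<bar>f t\<bar>) < e"
proof -
  have fa: "(\<lambda>t. \<bar>f t\<bar>) absolutely_integrable_on {0..1}"
    using absolutely_integrable_norm[OF f] by (simp add: o_def)
  have gm: "(\<lambda>t. min \<bar>f t\<bar> (real n)) absolutely_integrable_on {0..1}" for n
    by (rule absolutely_integrable_min_1[OF fa]) (simp add: absolutely_integrable_on_const)
  have gi: "(\<lambda>t. min \<bar>f t\<bar> (real n)) integrable_on {0..1}" for n
    using gm set_lebesgue_integral_eq_integral(1) by blast
  have fi: "(\<lambda>t. \<bar>f t\<bar>) integrable_on {0..1}"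
    using fa set_lebesgue_integral_eq_integral(1) by blast
  have "(\<lambda>n. integral {0..1} (\<lambda>t. min \<bar>f t\<bar> (real n))) \<longlonglongrightarrow> integral {0..1} (\<lambda>t. \<bar>f t\<bar>)"
  proof (rule dominated_convergence(2)[OF gi fi])
    show "norm (min \<bar>f t\<bar> (real n)) \<le> \<bar>f t\<bar>" for n t by simp
    show "(\<lambda>n. min \<bar>f t\<bar> (real n)) \<longlonglongrightarrow> \<bar>f t\<bar>" for t
    proof (rule tendsto_eventually)
      obtain N where "\<bar>f t\<bar> \<le> real N" using real_arch_simple by blast
      then show "\<forall>\<^sub>F n in sequentially. min \<bar>f t\<bar> (real n) = \<bar>f t\<bar>"
        by (auto simp: eventually_sequentially intro!: exI[of _ N])
    qed
  qed
  then obtain n where "dist (integral {0..1} (\<lambda>t. min \<bar>f t\<bar> (real n))) (integral {0..1} (\<lambda>t. \<bar>f t\<bar>)) < e / 2"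
    using \<open>e > 0\<close> unfolding lim_sequentially by (meson half_gt_zero order_refl)
  then have n: "integral {0..1} (\<lambda>t. \<bar>f t\<bar>) - integral {0..1} (\<lambda>t. min \<bar>f t\<bar> (real n)) < e / 2"
    unfolding dist_real_def by linarith
  define d where "d = e / (2 * (real n + 1))"
  have "d > 0" using \<open>e > 0\<close> by (simp add: d_def)
  moreover have "integral T (\<lambda>t. \<bar>f t\<bar>) < e"
    if T: "T \<subseteq> {0..1}" "T \<in> sets lebesgue" "measure lebesgue T < d" for T
  proof -
    have fT: "(\<lambda>t. \<bar>f t\<bar>) integrable_on T" and gT: "(\<lambda>t. min \<bar>f t\<bar> (real n)) integrable_on T"
      using absolutely_integrable_on_sets[OF fa T(1,2)] absolutely_integrable_on_sets[OF gm T(1,2)]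
        set_lebesgue_integral_eq_integral(1) by blast+
    have "{0..1::real} \<in> lmeasurable" by simp
    then have Tm: "T \<in> lmeasurable" using T fmeasurableI2 by blast
    have "integral T (\<lambda>t. \<bar>f t\<bar>) - integral T (\<lambda>t. min \<bar>f t\<bar> (real n)) = integral T (\<lambda>t. \<bar>f t\<bar> - min \<bar>f t\<bar> (real n))"
      using integral_diff[OF fT gT] by simp
    also have "\<dots> \<le> integral {0..1} (\<lambda>t. \<bar>f t\<bar> - min \<bar>f t\<bar> (real n))"
      by (intro integral_subset_le integrable_diff fT gT fi gi T) auto
    also have "\<dots> < e / 2"
      using n integral_diff[OF fi gi[of n]] by simp
    finally have 1: "integral T (\<lambda>t. \<bar>f t\<bar>) - integral T (\<lambda>t. min \<bar>f t\<bar> (real n)) < e / 2" .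
    have "integral T (\<lambda>t. min \<bar>f t\<bar> (real n)) \<le> integral T (\<lambda>t. real n)"
      using Tm by (intro integral_le gT integrable_on_const) auto
    also have "\<dots> = real n * measure lebesgue T"
      using lmeasure_integral[OF Tm] integral_mult_right[of T "real n" "\<lambda>_. 1"] by simp
    also have "\<dots> \<le> real n * d"
      using T(3) by (intro mult_left_mono) auto
    also have "\<dots> \<le> (real n + 1) * d" using \<open>d > 0\<close> by simp
    also have "\<dots> = e / 2" by (simp add: d_def divide_simps)
    finally show ?thesis using 1 by linarith
  qed
  ultimately show ?thesis using that by blast
qed

text \<open>By Vitali's theorem almost all of \<open>E\<close> is covered by disjoint intervals on which \<open>g\<close> has
  nonnegative integral and which lie in an open set barely larger than \<open>E\<close>.  Over their union the
  integral of \<open>g\<close> is thus nonnegative, yet it is at most \<open>- c\<close> times the measure of \<open>E\<close> up to an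
  arbitrarily small error.\<close>

lemma negligible_if_covered_by_nonneg_integrals:
  fixes g :: "real \<Rightarrow> real"
  assumes g: "g absolutely_integrable_on {0..1}" and "c > 0"
    and E: "E \<in> sets lebesgue" "E \<subseteq> {0..1}" "\<And>t. t \<in> E \<Longrightarrow> g t \<le> - c"
    and cover: "\<And>t d. t \<in> E \<Longrightarrow> d > 0 \<Longrightarrow>
      \<exists>a b. a \<le> t \<and> t \<le> b \<and> a < b \<and> b - a < d \<and> 0 \<le> a \<and> b \<le> 1 \<and> integral {a..b} g \<ge> 0"
  shows "negligible E"
proof -
  have I: "{0..1::real} \<in> lmeasurable" by simp
  have Em: "E \<in> lmeasurable" using I E fmeasurableI2 by blast
  have small: "c * measure lebesgue E \<le> e" if "e > 0" for e
  proof -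
    obtain d where d: "d > 0"
      "\<And>T. T \<subseteq> {0..1} \<Longrightarrow> T \<in> sets lebesgue \<Longrightarrow> measure lebesgue T < d \<Longrightarrow> integral T (\<lambda>t. \<bar>g t\<bar>) < e"
      using integral_abs_small_on_small_sets[OF g \<open>e > 0\<close>] by metis
    obtain O' where O: "open O'" "E \<subseteq> O'" "(O' - E) \<in> lmeasurable" "emeasure lebesgue (O' - E) < ennreal d"
      using sets_lebesgue_outer_open[OF E(1) d(1)] by metis
    define K where "K = {(a, b). 0 \<le> a \<and> a < b \<and> b \<le> (1::real) \<and> {a..b} \<subseteq> O' \<and> integral {a..b} g \<ge> 0}"
    define m where "m = (\<lambda>(a::real, b). (a + b) / 2)"
    define r where "r = (\<lambda>(a::real, b). (b - a) / 2)"
    have cb: "cball (m p) (r p) = {fst p..snd p}" for p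
      by (cases p) (simp add: m_def r_def cball_eq_atLeastAtMost field_simps)
    have Kr: "0 < r p" if "p \<in> K" for p
      using that by (auto simp: K_def r_def)
    have KS: "\<exists>p. p \<in> K \<and> t \<in> cball (m p) (r p) \<and> r p < \<delta>" if t: "t \<in> E" "0 < \<delta>" for t \<delta>
    proof -
      obtain \<eta> where \<eta>: "\<eta> > 0" "ball t \<eta> \<subseteq> O'" using O t openE by blast
      obtain a b where ab: "a \<le> t" "t \<le> b" "a < b" "b - a < min \<delta> \<eta>" "0 \<le> a" "b \<le> 1" "integral {a..b} g \<ge> 0"
        using cover[OF t(1), of "min \<delta> \<eta>"] t \<eta> by auto
      have "{a..b} \<subseteq> ball t \<eta>" using ab by (auto simp: dist_real_def)
      then have "(a, b) \<in> K" using ab \<eta> by (auto simp: K_def)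
      moreover have "r (a, b) < \<delta>" using ab t by (simp add: r_def)
      ultimately show ?thesis using ab cb[of "(a, b)"] by (intro exI[of _ "(a, b)"]) auto
    qed
    obtain C where C: "countable C" "C \<subseteq> K"
      "pairwise (\<lambda>i j. disjnt (cball (m i) (r i)) (cball (m j) (r j))) C"
      "negligible (E - (\<Union>i\<in>C. cball (m i) (r i)))"
      by (rule Vitali_covering_theorem_cballs[of K r E m, OF Kr KS])
    define A where "A n = {x. \<exists>p\<in>C. to_nat_on C p = n \<and> x \<in> cball (m p) (r p)}" for n
    define U where "U = (\<Union>n. A n)"
    have UC: "U = (\<Union>i\<in>C. cball (m i) (r i))" unfolding U_def A_def by blast
    have A_cases: "A n = {} \<or> (\<exists>p\<in>C. A n = {fst p..snd p})" for n
    proof (cases "\<exists>p\<in>C. to_nat_on C p = n")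
      case True
      then obtain p where p: "p \<in> C" "to_nat_on C p = n" by blast
      then have "p' = p" if "p' \<in> C" "to_nat_on C p' = n" for p'
        using that p to_nat_on_inj[OF C(1)] by metis
      then have "A n = cball (m p) (r p)" using p unfolding A_def by blast
      then show ?thesis using p cb by auto
    qed (auto simp: A_def)
    have A_sets: "A n \<in> sets lebesgue" for n using A_cases[of n] by auto
    have U_sets: "U \<in> sets lebesgue" unfolding U_def using A_sets by blast
    have "cball (m p) (r p) \<subseteq> {0..1} \<inter> O'" if "p \<in> C" for p
    proof -
      have "p \<in> K" using C(2) that by blast
      then show ?thesis unfolding cb K_def by auto
    qed
    then have U_sub: "U \<subseteq> {0..1}" "U \<subseteq> O'" unfolding UC by blast+
    have A_disj: "A i \<inter> A j = {}" if "i \<noteq> j" for i j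
    proof -
      have "x \<noteq> y" if xy: "x \<in> A i" "y \<in> A j" for x y
      proof -
        obtain p p' where p: "p \<in> C" "to_nat_on C p = i" "x \<in> cball (m p) (r p)"
          "p' \<in> C" "to_nat_on C p' = j" "y \<in> cball (m p') (r p')"
          using xy unfolding A_def by blast
        then have "disjnt (cball (m p) (r p)) (cball (m p') (r p'))"
          using C(3) \<open>i \<noteq> j\<close> pairwiseD[OF C(3), of p p'] by blast
        then show ?thesis using p unfolding disjnt_def by blast
      qed
      then show ?thesis by blast
    qed
    have gU: "g absolutely_integrable_on U" using absolutely_integrable_on_sets[OF g U_sub(1) U_sets] .
    have "0 \<le> set_lebesgue_integral lebesgue (A n) g" for n
      using A_cases[of n]
    proof
      assume "A n = {}"
      then show ?thesis by (simp add: set_lebesgue_integral_def)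
    next
      assume "\<exists>p\<in>C. A n = {fst p..snd p}"
      then obtain p where p: "p \<in> C" "A n = {fst p..snd p}" ..
      then have "p \<in> K" using C(2) by (rule_tac subsetD)
      then have "0 \<le> integral {fst p..snd p} g" by (auto simp: K_def)
      moreover have "g absolutely_integrable_on A n"
        by (rule absolutely_integrable_on_sets[OF gU _ A_sets[of n]]) (auto simp: U_def)
      ultimately show ?thesis
        using p(2) set_lebesgue_integral_eq_integral(2)[of "A n" g] by simp
    qed
    moreover have "set_lebesgue_integral lebesgue (\<Union>i<n. A i) g = (\<Sum>i<n. set_lebesgue_integral lebesgue (A i) g)" for n
    proof (rule set_integral_finite_Union)
      show "disjoint_family_on A {..<n}" using A_disj by (simp add: disjoint_family_on_def)
      show "set_integrable lebesgue (A i) g" for i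
        using absolutely_integrable_on_sets[OF gU _ A_sets[of i]] by (auto simp: U_def)
    qed (use A_sets in auto)
    ultimately have "0 \<le> set_lebesgue_integral lebesgue (\<Union>i<n. A i) g" for n
      by (simp add: sum_nonneg)
    moreover have "(\<Union>n. \<Union>i<n. A i) = U" unfolding U_def by auto
    moreover have "(\<lambda>n. set_lebesgue_integral lebesgue (\<Union>i<n. A i) g) \<longlonglongrightarrow>
        set_lebesgue_integral lebesgue (\<Union>n. \<Union>i<n. A i) g"
    proof (rule set_integral_cont_up)
      show "incseq (\<lambda>n. \<Union>i<n. A i)" unfolding incseq_def by (auto; force)
      show "g absolutely_integrable_on (\<Union>n. \<Union>i<n. A i)" using gU calculation(2) by simp
    qed (use A_sets in auto)
    ultimately have "0 \<le> set_lebesgue_integral lebesgue U g"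
      by (intro LIMSEQ_le_const) auto
    then have nonneg: "0 \<le> integral U g"
      using set_lebesgue_integral_eq_integral(2)[OF gU] by simp
    have UE: "U \<inter> E \<in> sets lebesgue" "U - E \<in> sets lebesgue" using U_sets E by auto
    have gUE: "g absolutely_integrable_on (U \<inter> E)" "g absolutely_integrable_on (U - E)"
      using absolutely_integrable_on_sets[OF gU] UE by auto
    have "integral U g = integral (U \<inter> E \<union> (U - E)) g"
      by (rule arg_cong2[where f=integral]) auto
    also have "\<dots> = integral (U \<inter> E) g + integral (U - E) g"
    proof (rule integral_Un)
      have "U \<inter> E \<inter> (U - E) = {}" by auto
      then show "negligible (U \<inter> E \<inter> (U - E))" by simp
    qed (use gUE[THEN set_lebesgue_integral_eq_integral(1)] in auto)
    finally have split: "integral U g = integral (U \<inter> E) g + integral (U - E) g" .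
    have UEm: "U \<inter> E \<in> lmeasurable" using UE Em fmeasurableI2 by blast
    have "integral (U \<inter> E) g \<le> integral (U \<inter> E) (\<lambda>_. - c)"
      using E(3) UEm by (intro integral_le integrable_on_const gUE[THEN set_lebesgue_integral_eq_integral(1)]) auto
    also have "\<dots> = - c * measure lebesgue (U \<inter> E)"
      using lmeasure_integral[OF UEm] integral_mult_right[of "U \<inter> E" "- c" "\<lambda>_. 1"] by simp
    also have "measure lebesgue (U \<inter> E) = measure lebesgue E"
      by (rule measure_negligible_symdiff[OF Em])
        (use C(4) in \<open>auto simp: UC elim!: negligible_subset\<close>)
    finally have 1: "integral (U \<inter> E) g \<le> - c * measure lebesgue E" .
    have "measure lebesgue (U - E) \<le> measure lebesgue (O' - E)"
      using U_sub by (intro measure_mono_fmeasurable UE O) auto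
    also have "\<dots> < d"
      using O(3,4) d(1) by (simp add: emeasure_eq_measure2 ennreal_less_iff)
    finally have "integral (U - E) (\<lambda>t. \<bar>g t\<bar>) < e"
      using d(2)[OF _ UE(2)] U_sub by auto
    moreover have "integral (U - E) g \<le> integral (U - E) (\<lambda>t. \<bar>g t\<bar>)"
      using gUE(2) absolutely_integrable_norm[OF gUE(2)]
      by (intro integral_le) (auto simp: o_def dest: set_lebesgue_integral_eq_integral(1))
    ultimately show "c * measure lebesgue E \<le> e" using 1 split nonneg by linarith
  qed
  have "c * measure lebesgue E \<le> 0" by (rule field_le_epsilon) (use small in auto)
  then have "measure lebesgue E = 0"
    using \<open>c > 0\<close> measure_nonneg[of lebesgue E] by (simp add: mult_le_0_iff)
  then show ?thesis using Em by (simp add: negligible_iff_measure)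
qed

lemma continuous_on_indefinite_integral:
  fixes f :: "real \<Rightarrow> real"
  assumes "f absolutely_integrable_on {0..1}"
  shows "continuous_on {0..1} (\<lambda>t. integral {0..t} f)"
  using assms by (intro indefinite_integral_continuous_1) (rule set_lebesgue_integral_eq_integral(1))

lemma indefinite_integral_diff:
  fixes f :: "real \<Rightarrow> real"
  assumes "f absolutely_integrable_on {0..1}" "0 \<le> a" "a \<le> b" "b \<le> 1"
  shows "integral {0..b} f - integral {0..a} f = integral {a..b} f"
proof -
  have "f absolutely_integrable_on {0..b}"
    using assms by (auto intro: absolutely_integrable_on_subinterval)
  then have "f integrable_on {0..b}" by (rule set_lebesgue_integral_eq_integral(1))
  from Henstock_Kurzweil_Integration.integral_combine[OF assms(2,3) this] show ?thesis by simp
qed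

text \<open>\<open>D\<close> consists of the points that lie in arbitrarily short intervals over which \<open>f\<close> has an average
  above \<open>q\<close>.  On such an interval \<open>f - q\<close> has a nonnegative integral, while \<open>f - q \<le> r - q < 0\<close> at the
  points in question, so the covering argument applies to \<open>f - q\<close>.\<close>

lemma negligible_large_averages:
  fixes f :: "real \<Rightarrow> real"
  assumes f: "f absolutely_integrable_on {0..1}" and "r < q"
  defines "D \<equiv> \<Inter>n::nat. \<Union>(a, b) \<in> {(a, b). b - a < 1 / (real n + 1) \<and> 0 \<le> a \<and> b \<le> 1 \<and>
      integral {a..b} f > q * (b - a)}. {a<..<b}"
  shows "negligible {t \<in> D. f t \<le> r}"
proof (rule negligible_if_covered_by_nonneg_integrals)
  have D: "\<exists>a b. a < t \<and> t < b \<and> b - a < 1 / (real n + 1) \<and> 0 \<le> a \<and> b \<le> 1 \<and>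
      integral {a..b} f > q * (b - a)" if "t \<in> D" for t and n :: nat
    using that unfolding D_def by (auto dest!: spec[of _ n])
  have "open (\<Union>(a, b) \<in> {(a, b). b - a < 1 / (real n + 1) \<and> 0 \<le> a \<and> b \<le> 1 \<and>
      integral {a..b} f > q * (b - a)}. {a<..<b})" for n :: nat
    by (intro open_UN) auto
  then have Ds: "D \<in> sets lebesgue" unfolding D_def by (intro sets.countable_INT) auto
  have D01: "D \<subseteq> {0..1}"
  proof
    fix t assume "t \<in> D"
    from D[OF this, of 0] show "t \<in> {0..1}" by auto
  qed
  have "f \<in> borel_measurable (lebesgue_on {0..1})"
    using absolutely_integrable_imp_borel_measurable[OF f] by simp
  from measurable_sets[OF this, of "{..r}"] have "f -` {..r} \<inter> {0..1} \<in> sets lebesgue"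
    by (simp add: sets_restrict_space_iff)
  moreover have "{t \<in> {0..1}. f t \<le> r} = f -` {..r} \<inter> {0..1}" by auto
  ultimately have "{t \<in> {0..1}. f t \<le> r} \<in> sets lebesgue" by simp
  moreover have "{t \<in> D. f t \<le> r} = D \<inter> {t \<in> {0..1}. f t \<le> r}" using D01 by auto
  ultimately show "{t \<in> D. f t \<le> r} \<in> sets lebesgue" using Ds by auto
  show "{t \<in> D. f t \<le> r} \<subseteq> {0..1}" using D01 by auto
  show "(\<lambda>t. f t - q) absolutely_integrable_on {0..1}"
    by (intro set_integral_diff f) (simp add: absolutely_integrable_on_const)
  show "0 < q - r" using assms by simp
  show "f t - q \<le> - (q - r)" if "t \<in> {t \<in> D. f t \<le> r}" for t using that by auto
  fix t d assume t: "t \<in> {t \<in> D. f t \<le> r}" and d: "(0::real) < d"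
  obtain n where "1 / real (Suc n) < d" using nat_approx_posE[OF d] by blast
  then have "1 / (real n + 1) < d" by (simp add: add.commute)
  moreover obtain a b where ab: "a < t" "t < b" "b - a < 1 / (real n + 1)" "0 \<le> a" "b \<le> 1"
    "integral {a..b} f > q * (b - a)" using t D[of t n] by blast
  moreover have "integral {a..b} (\<lambda>t. f t - q) = integral {a..b} f - q * (b - a)"
  proof -
    have "f integrable_on {a..b}"
      using absolutely_integrable_on_subinterval[OF f] ab by (auto intro: set_lebesgue_integral_eq_integral(1))
    then show ?thesis using ab by (subst integral_diff) (auto simp: integrable_const_ivl)
  qed
  ultimately show "\<exists>a b. a \<le> t \<and> t \<le> b \<and> a < b \<and> b - a < d \<and> 0 \<le> a \<and> b \<le> 1 \<and> 0 \<le> integral {a..b} (\<lambda>t. f t - q)"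
    by (intro exI[of _ a] exI[of _ b]) (auto simp: algebra_simps)
qed

text \<open>A point where the bound fails for some \<open>e\<close> belongs to an exceptional set for two rational numbers
  \<open>r < q\<close> between \<open>f t\<close> and \<open>f t + e\<close>, and there are only countably many such pairs.\<close>

lemma AE_upper_derivate_le:
  fixes f :: "real \<Rightarrow> real"
  assumes f: "f absolutely_integrable_on {0..1}"
  shows "AE t in lebesgue. t \<in> {0<..<1} \<longrightarrow> (\<forall>e>0. \<exists>d>0. \<forall>a b. a \<le> t \<and> t \<le> b \<and> b - a < d \<and> 0 \<le> a \<and> b \<le> 1 \<longrightarrow>
      integral {a..b} f \<le> (f t + e) * (b - a))"
proof -
  define D where "D q = (\<Inter>n::nat. \<Union>(a, b) \<in> {(a, b). b - a < 1 / (real n + 1) \<and> 0 \<le> a \<and> b \<le> 1 \<and>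
      integral {a..b} f > q * (b - a)}. {a<..<b})" for q :: real
  define P where "P = {(r::real, q::real). r \<in> \<rat> \<and> q \<in> \<rat> \<and> r < q}"
  have "countable P"
    by (rule countable_subset[of _ "\<rat> \<times> \<rat>"]) (auto simp: P_def countable_rat)
  moreover have "negligible {t \<in> D q. f t \<le> r}" if "(r, q) \<in> P" for r q
    using negligible_large_averages[OF f, of r q] that by (simp add: P_def D_def)
  ultimately have "negligible (\<Union>((\<lambda>(r, q). {t \<in> D q. f t \<le> r}) ` P))"
    by (intro negligible_countable_Union) auto
  then have null: "(\<Union>(r, q)\<in>P. {t \<in> D q. f t \<le> r}) \<in> null_sets lebesgue"
    by (simp add: negligible_iff_null_sets case_prod_unfold)
  have cont: "continuous_on {0..1} (\<lambda>t. integral {0..t} f)"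
    by (rule continuous_on_indefinite_integral[OF f])
  have "\<exists>d>0. \<forall>a b. a \<le> t \<and> t \<le> b \<and> b - a < d \<and> 0 \<le> a \<and> b \<le> 1 \<longrightarrow>
      integral {a..b} f \<le> (f t + e) * (b - a)"
    if t: "t \<in> {0<..<1}" "t \<notin> (\<Union>(r, q)\<in>P. {t \<in> D q. f t \<le> r})" and e: "e > 0" for t e
  proof -
    obtain r q where rq: "r \<in> \<rat>" "q \<in> \<rat>" "f t < r" "r < q" "q < f t + e"
      using Rats_dense_in_real[of "f t" "f t + e"] Rats_dense_in_real[of _ "f t + e"] e
      by (metis less_add_same_cancel1)
    then have "(r, q) \<in> P" by (simp add: P_def)
    then have "t \<notin> D q" using t(2) rq(3) by fastforce
    then obtain n :: nat where n: "\<And>a b. a < t \<Longrightarrow> t < b \<Longrightarrow> b - a < 1 / (real n + 1) \<Longrightarrow> 0 \<le> a \<Longrightarrow> b \<le> 1 \<Longrightarrow>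
        integral {a..b} f \<le> q * (b - a)"
      unfolding D_def by (auto simp: not_less) (metis not_less)
    define d where "d = min (1 / (real n + 1)) (min t (1 - t))"
    have d: "d > 0" using t by (simp add: d_def)
    \<comment> \<open>The bound passes from intervals with \<open>t\<close> in the interior to those with \<open>t\<close> at an end by continuity.\<close>
    have "integral {a..b} f \<le> (f t + e) * (b - a)"
      if ab: "a \<le> t" "t \<le> b" "b - a < d" for a b
    proof -
      define F where "F t = integral {0..t} f" for t
      have F: "F b - F a \<le> q * (b - a)" if "a < t" "t < b" "b - a < d" for a b
      proof -
        have "0 \<le> a" "b \<le> 1" "b - a < 1 / (real n + 1)" using that by (auto simp: d_def)
        then show ?thesis
          using n[of a b] that indefinite_integral_diff[OF f, of a b] by (simp add: F_def)
      qed
      define h where "h k = (d - (b - a)) / (2 * (real k + 2))" for k :: nat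
      have h: "h k > 0" "b - a + 2 * h k < d" for k
      proof -
        have "h k \<le> (d - (b - a)) / 4"
          unfolding h_def using ab by (intro divide_left_mono) auto
        then show "b - a + 2 * h k < d" using ab by (simp add: field_simps)
      qed (use ab in \<open>simp add: h_def\<close>)
      have h0: "h \<longlonglongrightarrow> 0" unfolding h_def by real_asymp
      have mem: "a \<in> {0..1}" "b \<in> {0..1}" "a - h k \<in> {0..1}" "b + h k \<in> {0..1}" for k
        using ab t h[of k] by (auto simp: d_def)
      have "(\<lambda>k. F (b + h k) - F (a - h k)) \<longlonglongrightarrow> F b - F a"
        using cont unfolding continuous_on_sequentially F_def[symmetric]
      proof (intro tendsto_diff)
        assume *: "\<forall>x. \<forall>a\<in>{0..1}. (\<forall>n. x n \<in> {0..1}) \<and> x \<longlonglongrightarrow> a \<longrightarrow> (F \<circ> x) \<longlonglongrightarrow> F a"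
        have "(\<lambda>k. b + h k) \<longlonglongrightarrow> b" "(\<lambda>k. a - h k) \<longlonglongrightarrow> a"
          using tendsto_add[OF tendsto_const h0, of b] tendsto_diff[OF tendsto_const h0, of a] by simp_all
        then show "(\<lambda>k. F (b + h k)) \<longlonglongrightarrow> F b" "(\<lambda>k. F (a - h k)) \<longlonglongrightarrow> F a"
          using * mem by (auto simp: o_def)
      qed
      moreover have "(\<lambda>k. q * (b - a + 2 * h k)) \<longlonglongrightarrow> q * (b - a + 2 * 0)"
        by (intro tendsto_intros h0)
      moreover have "F (b + h k) - F (a - h k) \<le> q * (b - a + 2 * h k)" for k
        using F[of "a - h k" "b + h k"] h[of k] ab by (simp add: algebra_simps)
      ultimately have "F b - F a \<le> q * (b - a + 2 * 0)"
        by (intro LIMSEQ_le) auto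
      also have "\<dots> \<le> (f t + e) * (b - a)" using rq ab by (simp add: mult_right_mono)
      finally show ?thesis
        using indefinite_integral_diff[OF f, of a b] ab mem(1,2) by (simp add: F_def)
    qed
    then show ?thesis using d by blast
  qed
  then show ?thesis
    by (intro AE_I'[OF null]) blast
qed

text \<open>Lebesgue's differentiation theorem on an interval.  The lower bound for the difference quotients is
  the upper bound for \<open>- f\<close>.\<close>

theorem AE_indefinite_integral_has_derivative:
  fixes f :: "real \<Rightarrow> real"
  assumes f: "f absolutely_integrable_on {0..1}"
  shows "AE t in lebesgue. t \<in> {0<..<1} \<longrightarrow>
    ((\<lambda>t. integral {0..t} f) has_real_derivative f t) (at t)"
proof -
  have mf: "(\<lambda>t. - f t) absolutely_integrable_on {0..1}"
    using set_integrable_mult_right[of "-1" lebesgue "{0..1}" f] f by simp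
  have *: "((\<lambda>t. integral {0..t} f) has_real_derivative f t) (at t)"
    if t: "t \<in> {0<..<1}"
      and up: "\<forall>e>0. \<exists>d>0. \<forall>a b. a \<le> t \<and> t \<le> b \<and> b - a < d \<and> 0 \<le> a \<and> b \<le> 1 \<longrightarrow>
        integral {a..b} f \<le> (f t + e) * (b - a)"
      and lo: "\<forall>e>0. \<exists>d>0. \<forall>a b. a \<le> t \<and> t \<le> b \<and> b - a < d \<and> 0 \<le> a \<and> b \<le> 1 \<longrightarrow>
        integral {a..b} (\<lambda>t. - f t) \<le> (- f t + e) * (b - a)" for t
    unfolding has_field_derivative_def has_derivative_at_alt
  proof (intro conjI allI impI)
    show "bounded_linear ((*) (f t))" by (rule bounded_linear_mult_right)
    fix e :: real assume "e > 0"
    then obtain d1 where d1: "d1 > 0" "\<And>a b. a \<le> t \<and> t \<le> b \<and> b - a < d1 \<and> 0 \<le> a \<and> b \<le> 1 \<Longrightarrow>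
        integral {a..b} f \<le> (f t + e) * (b - a)" using up by blast
    obtain d2 where d2: "d2 > 0" "\<And>a b. a \<le> t \<and> t \<le> b \<and> b - a < d2 \<and> 0 \<le> a \<and> b \<le> 1 \<Longrightarrow>
        integral {a..b} (\<lambda>t. - f t) \<le> (- f t + e) * (b - a)" using lo \<open>e > 0\<close> by blast
    define d where "d = min (min d1 d2) (min t (1 - t))"
    have bound: "\<bar>integral {0..b} f - integral {0..a} f - f t * (b - a)\<bar> \<le> e * (b - a)"
      if ab: "a \<le> t" "t \<le> b" "b - a < d" for a b
    proof -
      have "0 \<le> a" "b \<le> 1" "b - a < d1" "b - a < d2" using ab by (auto simp: d_def)
      then have "integral {a..b} f \<le> (f t + e) * (b - a)" "integral {a..b} (\<lambda>t. - f t) \<le> (- f t + e) * (b - a)"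
        "integral {0..b} f - integral {0..a} f = integral {a..b} f"
        using d1(2)[of a b] d2(2)[of a b] ab indefinite_integral_diff[OF f, of a b] by auto
      then show ?thesis by (simp add: algebra_simps abs_le_iff)
    qed
    have "d > 0" using d1 d2 t by (simp add: d_def)
    moreover have "norm (integral {0..y} f - integral {0..t} f - f t * (y - t)) \<le> e * norm (y - t)"
      if "norm (y - t) < d" for y
    proof (cases "t \<le> y")
      case True
      then show ?thesis using bound[of t y] that by simp
    next
      case False
      then show ?thesis using bound[of y t] that
        by (simp add: algebra_simps abs_le_iff)
    qed
    ultimately show "\<exists>d>0. \<forall>y. norm (y - t) < d \<longrightarrow>
        norm (integral {0..y} f - integral {0..t} f - f t * (y - t)) \<le> e * norm (y - t)" by blast
  qed
  then show ?thesis
    using AE_upper_derivate_le[OF f] AE_upper_derivate_le[OF mf]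
  proof eventually_elim
    case (elim t)
    then show ?case using *[of t] by blast
  qed
qed

lemma AE_lebesgue_not_equal: "AE t in lebesgue. t \<noteq> (r::real)"
  by (auto intro!: AE_I'[of "{r}"] simp: negligible_iff_null_sets[symmetric])

corollary AE_indefinite_integral_has_derivative_within:
  fixes f :: "real \<Rightarrow> real"
  assumes "f absolutely_integrable_on {0..1}"
  shows "AE t in lebesgue. t \<in> {0..1} \<longrightarrow>
    ((\<lambda>t. integral {0..t} f) has_real_derivative f t) (at t within {0..1})"
  using AE_indefinite_integral_has_derivative[OF assms] AE_lebesgue_not_equal[of 0] AE_lebesgue_not_equal[of 1]
  by eventually_elim (auto intro: has_field_derivative_at_within)

section \<open>Absolutely continuous curves in metric spaces\<close>

definition disjoint_intervals :: "real \<Rightarrow> real \<Rightarrow> nat \<Rightarrow> (nat \<Rightarrow> real) \<Rightarrow> (nat \<Rightarrow> real) \<Rightarrow> bool" where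
  "disjoint_intervals a b n l r \<longleftrightarrow> (\<forall>i<n. a \<le> l i \<and> l i \<le> r i \<and> r i \<le> b) \<and>
     disjoint_family_on (\<lambda>i. {l i<..<r i}) {..<n}"

lemma abs_continuous_on_iff:
  "abs_continuous_on a b f \<longleftrightarrow> (\<forall>\<epsilon>>0. \<exists>\<delta>>0. \<forall>n l r. disjoint_intervals a b n l r \<longrightarrow> (\<Sum>i<n. r i - l i) < \<delta> \<longrightarrow>
     (\<Sum>i<n. dist (f (l i)) (f (r i))) < \<epsilon>)"
  unfolding abs_continuous_on_def disjoint_intervals_def by (simp only: imp_conjL conj_assoc)

lemma abs_continuous_onD:
  assumes "abs_continuous_on a b f" "\<epsilon> > 0"
  shows "\<exists>\<delta>>0. \<forall>n l r. disjoint_intervals a b n l r \<longrightarrow> (\<Sum>i<n. r i - l i) < \<delta> \<longrightarrow>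
     (\<Sum>i<n. dist (f (l i)) (f (r i))) < \<epsilon>"
  using assms by (simp add: abs_continuous_on_iff)

lemma abs_continuous_onI:
  assumes "\<And>\<epsilon>. \<epsilon> > 0 \<Longrightarrow> \<exists>\<delta>>0. \<forall>n l r. disjoint_intervals a b n l r \<longrightarrow> (\<Sum>i<n. r i - l i) < \<delta> \<longrightarrow>
     (\<Sum>i<n. dist (f (l i)) (f (r i))) < \<epsilon>"
  shows "abs_continuous_on a b f"
  using assms by (simp add: abs_continuous_on_iff)

lemma disjoint_intervals_bounds:
  "disjoint_intervals a b n l r \<Longrightarrow> i < n \<Longrightarrow> a \<le> l i \<and> l i \<le> r i \<and> r i \<le> b"
  by (simp add: disjoint_intervals_def)

text \<open>For maps \<open>h\<close> such as \<open>min m\<close> and \<open>max m\<close>, which move points monotonically and open intervals into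
  themselves.\<close>

lemma disjoint_intervals_monotone_image:
  assumes d: "disjoint_intervals a b n l r"
    and mono: "\<And>x y. x \<le> y \<Longrightarrow> h x \<le> h y"
    and sub: "\<And>x y. {h x<..<h y} \<subseteq> {x<..<y}"
    and lr: "\<And>i. i < n \<Longrightarrow> a' \<le> h (l i) \<and> h (r i) \<le> b'"
  shows "disjoint_intervals a' b' n (\<lambda>i. h (l i)) (\<lambda>i. h (r i))"
  unfolding disjoint_intervals_def
proof
  show "\<forall>i<n. a' \<le> h (l i) \<and> h (l i) \<le> h (r i) \<and> h (r i) \<le> b'"
    using lr mono disjoint_intervals_bounds[OF d] by blast
  show "disjoint_family_on (\<lambda>i. {h (l i)<..<h (r i)}) {..<n}"
    unfolding disjoint_family_on_def
  proof (intro ballI impI)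
    fix i j assume "i \<in> {..<n}" "j \<in> {..<n}" "i \<noteq> j"
    then have "{l i<..<r i} \<inter> {l j<..<r j} = {}"
      using d by (simp add: disjoint_intervals_def disjoint_family_on_def)
    then show "{h (l i)<..<h (r i)} \<inter> {h (l j)<..<h (r j)} = {}"
      using sub[of "l i" "r i"] sub[of "l j" "r j"] by blast
  qed
qed

lemma abs_continuous_on_dist_le:
  assumes g: "abs_continuous_on a b g" and "L > 0"
    and le: "\<And>x y. x \<in> {a..b} \<Longrightarrow> y \<in> {a..b} \<Longrightarrow> dist (f x) (f y) \<le> L * dist (g x) (g y)"
  shows "abs_continuous_on a b f"
proof (rule abs_continuous_onI)
  fix \<epsilon> :: real assume "\<epsilon> > 0"
  then have "\<epsilon> / L > 0" using \<open>L > 0\<close> by simp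
  from abs_continuous_onD[OF g this] obtain \<delta> where \<delta>: "\<delta> > 0"
    "\<forall>n l r. disjoint_intervals a b n l r \<longrightarrow> (\<Sum>i<n. r i - l i) < \<delta> \<longrightarrow> (\<Sum>i<n. dist (g (l i)) (g (r i))) < \<epsilon> / L"
    by (elim exE conjE)
  have "(\<Sum>i<n. dist (f (l i)) (f (r i))) < \<epsilon>"
    if d: "disjoint_intervals a b n l r" and s: "(\<Sum>i<n. r i - l i) < \<delta>" for n l r
  proof -
    have "(\<Sum>i<n. dist (f (l i)) (f (r i))) \<le> (\<Sum>i<n. L * dist (g (l i)) (g (r i)))"
    proof (intro sum_mono le)
      fix i assume "i \<in> {..<n}"
      then show "l i \<in> {a..b}" "r i \<in> {a..b}" using disjoint_intervals_bounds[OF d, of i] by auto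
    qed
    also have "\<dots> = L * (\<Sum>i<n. dist (g (l i)) (g (r i)))" by (simp add: sum_distrib_left)
    also have "\<dots> < L * (\<epsilon> / L)" using \<delta>(2) d s \<open>L > 0\<close> by (intro mult_strict_left_mono) auto
    finally show ?thesis using \<open>L > 0\<close> by simp
  qed
  then show "\<exists>\<delta>>0. \<forall>n l r. disjoint_intervals a b n l r \<longrightarrow> (\<Sum>i<n. r i - l i) < \<delta> \<longrightarrow>
      (\<Sum>i<n. dist (f (l i)) (f (r i))) < \<epsilon>"
    by (intro exI[of _ \<delta>] conjI allI impI \<delta>(1))
qed

lemma abs_continuous_on_compose_lipschitz:
  assumes "abs_continuous_on a b g" "g ` {a..b} \<subseteq> S" "L > 0"
    "\<And>x y. x \<in> S \<Longrightarrow> y \<in> S \<Longrightarrow> dist (M x) (M y) \<le> L * dist x y"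
  shows "abs_continuous_on a b (\<lambda>t. M (g t))"
  by (rule abs_continuous_on_dist_le[OF assms(1,3)]) (use assms(2,4) in blast)

lemma abs_continuous_on_cong:
  assumes "abs_continuous_on a b g" "\<And>t. t \<in> {a..b} \<Longrightarrow> f t = g t"
  shows "abs_continuous_on a b f"
  by (rule abs_continuous_on_dist_le[OF assms(1), of 1]) (simp_all add: assms(2))

lemma abs_continuous_on_subinterval:
  assumes f: "abs_continuous_on a b f" and "a \<le> a'" "b' \<le> b"
  shows "abs_continuous_on a' b' f"
proof (rule abs_continuous_onI)
  fix \<epsilon> :: real assume "\<epsilon> > 0"
  from abs_continuous_onD[OF f this] obtain \<delta> where \<delta>: "\<delta> > 0"
    "\<forall>n l r. disjoint_intervals a b n l r \<longrightarrow> (\<Sum>i<n. r i - l i) < \<delta> \<longrightarrow> (\<Sum>i<n. dist (f (l i)) (f (r i))) < \<epsilon>"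
    by (elim exE conjE)
  have "disjoint_intervals a b n l r" if "disjoint_intervals a' b' n l r" for n l r
    using that assms(2,3) unfolding disjoint_intervals_def by force
  then show "\<exists>\<delta>>0. \<forall>n l r. disjoint_intervals a' b' n l r \<longrightarrow> (\<Sum>i<n. r i - l i) < \<delta> \<longrightarrow>
      (\<Sum>i<n. dist (f (l i)) (f (r i))) < \<epsilon>"
    using \<delta> by (intro exI[of _ \<delta>]) simp
qed

lemma abs_continuous_on_continuous:
  assumes "abs_continuous_on a b f"
  shows "continuous_on {a..b} f"
  unfolding continuous_on_iff
proof (intro ballI allI impI)
  fix x and \<epsilon> :: real assume x: "x \<in> {a..b}" and "\<epsilon> > 0"
  from abs_continuous_onD[OF assms \<open>\<epsilon> > 0\<close>] obtain \<delta> where \<delta>: "\<delta> > 0"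
    "\<forall>n l r. disjoint_intervals a b n l r \<longrightarrow> (\<Sum>i<n. r i - l i) < \<delta> \<longrightarrow> (\<Sum>i<n. dist (f (l i)) (f (r i))) < \<epsilon>"
    by (elim exE conjE)
  have *: "dist (f y) (f z) < \<epsilon>" if "a \<le> y" "y \<le> z" "z \<le> b" "z - y < \<delta>" for y z
    using \<delta>(2)[rule_format, of 1 "\<lambda>_. y" "\<lambda>_. z"] that
    by (simp add: disjoint_intervals_def disjoint_family_on_def)
  have "dist (f y) (f x) < \<epsilon>" if "y \<in> {a..b}" "dist y x < \<delta>" for y
    using *[of y x] *[of x y] that x by (cases "y \<le> x") (auto simp: dist_real_def dist_commute)
  then show "\<exists>d>0. \<forall>y\<in>{a..b}. dist y x < d \<longrightarrow> dist (f y) (f x) < \<epsilon>"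
    by (intro exI[of _ \<delta>] conjI ballI impI \<delta>(1))
qed

lemma abs_continuous_on_Pair:
  assumes f: "abs_continuous_on a b f" and g: "abs_continuous_on a b g"
  shows "abs_continuous_on a b (\<lambda>t. (f t, g t))"
proof (rule abs_continuous_onI)
  fix \<epsilon> :: real assume "\<epsilon> > 0"
  then have e2: "\<epsilon> / 2 > 0" by simp
  from abs_continuous_onD[OF f e2] obtain \<delta>1 where \<delta>1: "\<delta>1 > 0"
    "\<forall>n l r. disjoint_intervals a b n l r \<longrightarrow> (\<Sum>i<n. r i - l i) < \<delta>1 \<longrightarrow> (\<Sum>i<n. dist (f (l i)) (f (r i))) < \<epsilon> / 2"
    by (elim exE conjE)
  from abs_continuous_onD[OF g e2] obtain \<delta>2 where \<delta>2: "\<delta>2 > 0"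
    "\<forall>n l r. disjoint_intervals a b n l r \<longrightarrow> (\<Sum>i<n. r i - l i) < \<delta>2 \<longrightarrow> (\<Sum>i<n. dist (g (l i)) (g (r i))) < \<epsilon> / 2"
    by (elim exE conjE)
  have "(\<Sum>i<n. dist (f (l i), g (l i)) (f (r i), g (r i))) < \<epsilon>"
    if d: "disjoint_intervals a b n l r" and s: "(\<Sum>i<n. r i - l i) < min \<delta>1 \<delta>2" for n l r
  proof -
    have "(\<Sum>i<n. dist (f (l i), g (l i)) (f (r i), g (r i))) \<le>
        (\<Sum>i<n. dist (f (l i)) (f (r i)) + dist (g (l i)) (g (r i)))"
      unfolding dist_Pair_Pair by (intro sum_mono sqrt_sum_squares_le_sum) auto
    also have "\<dots> < \<epsilon> / 2 + \<epsilon> / 2"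
      unfolding sum.distrib using \<delta>1(2) \<delta>2(2) d s by (intro add_strict_mono) auto
    finally show ?thesis by simp
  qed
  then show "\<exists>\<delta>>0. \<forall>n l r. disjoint_intervals a b n l r \<longrightarrow> (\<Sum>i<n. r i - l i) < \<delta> \<longrightarrow>
      (\<Sum>i<n. dist (f (l i), g (l i)) (f (r i), g (r i))) < \<epsilon>"
    using \<delta>1(1) \<delta>2(1) by (intro exI[of _ "min \<delta>1 \<delta>2"]) simp
qed

lemma abs_continuous_on_combine:
  assumes f: "abs_continuous_on a m f" "abs_continuous_on m b f" and m: "a \<le> m" "m \<le> b"
  shows "abs_continuous_on a b f"
proof (rule abs_continuous_onI)
  fix \<epsilon> :: real assume "\<epsilon> > 0"
  then have e2: "\<epsilon> / 2 > 0" by simp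
  from abs_continuous_onD[OF f(1) e2] obtain \<delta>1 where \<delta>1: "\<delta>1 > 0"
    "\<forall>n l r. disjoint_intervals a m n l r \<longrightarrow> (\<Sum>i<n. r i - l i) < \<delta>1 \<longrightarrow> (\<Sum>i<n. dist (f (l i)) (f (r i))) < \<epsilon> / 2"
    by (elim exE conjE)
  from abs_continuous_onD[OF f(2) e2] obtain \<delta>2 where \<delta>2: "\<delta>2 > 0"
    "\<forall>n l r. disjoint_intervals m b n l r \<longrightarrow> (\<Sum>i<n. r i - l i) < \<delta>2 \<longrightarrow> (\<Sum>i<n. dist (f (l i)) (f (r i))) < \<epsilon> / 2"
    by (elim exE conjE)
  have "(\<Sum>i<n. dist (f (l i)) (f (r i))) < \<epsilon>"
    if d: "disjoint_intervals a b n l r" and s: "(\<Sum>i<n. r i - l i) < min \<delta>1 \<delta>2" for n l r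
  proof -
    note lr = disjoint_intervals_bounds[OF d]
    \<comment> \<open>Cut every interval at \<open>m\<close>; a piece on the wrong side degenerates to a point.\<close>
    have "(\<Sum>i<n. min m (r i) - min m (l i)) \<le> (\<Sum>i<n. r i - l i)"
      "(\<Sum>i<n. max m (r i) - max m (l i)) \<le> (\<Sum>i<n. r i - l i)"
      using lr by (intro sum_mono; force simp: min_def max_def)+
    moreover have "disjoint_intervals a m n (\<lambda>i. min m (l i)) (\<lambda>i. min m (r i))"
      using lr m by (intro disjoint_intervals_monotone_image[OF d]) (auto simp: min_le_iff_disj min_def)
    moreover have "disjoint_intervals m b n (\<lambda>i. max m (l i)) (\<lambda>i. max m (r i))"
      using lr m by (intro disjoint_intervals_monotone_image[OF d]) (auto simp: max_def)
    ultimately have 1: "(\<Sum>i<n. dist (f (min m (l i))) (f (min m (r i)))) < \<epsilon> / 2"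
      and 2: "(\<Sum>i<n. dist (f (max m (l i))) (f (max m (r i)))) < \<epsilon> / 2"
      using s \<delta>1(2) \<delta>2(2) by auto
    have "dist (f (l i)) (f (r i)) \<le> dist (f (min m (l i))) (f (min m (r i))) + dist (f (max m (l i))) (f (max m (r i)))"
      if "i < n" for i
      using lr[OF that] dist_triangle[of "f (l i)" "f (r i)" "f m"]
      by (auto simp: min_def max_def)
    then have "(\<Sum>i<n. dist (f (l i)) (f (r i))) \<le>
        (\<Sum>i<n. dist (f (min m (l i))) (f (min m (r i))) + dist (f (max m (l i))) (f (max m (r i))))"
      by (intro sum_mono) auto
    with 1 2 show ?thesis by (simp add: sum.distrib)
  qed
  then show "\<exists>\<delta>>0. \<forall>n l r. disjoint_intervals a b n l r \<longrightarrow> (\<Sum>i<n. r i - l i) < \<delta> \<longrightarrow>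
      (\<Sum>i<n. dist (f (l i)) (f (r i))) < \<epsilon>"
    using \<delta>1(1) \<delta>2(1) by (intro exI[of _ "min \<delta>1 \<delta>2"]) simp
qed

text \<open>Absolute continuity on two adjacent intervals gives absolute continuity on their union, so bisection
  applies.\<close>

lemma abs_continuous_on_local:
  assumes "a \<le> b"
    and loc: "\<And>t. t \<in> {a..b} \<Longrightarrow> \<exists>d>0. \<forall>a' b'. a \<le> a' \<and> a' \<le> t \<and> t \<le> b' \<and> b' \<le> b \<and> b' - a' < d \<longrightarrow> abs_continuous_on a' b' f"
  shows "abs_continuous_on a b f"
proof -
  have "a \<le> a \<and> b \<le> b \<longrightarrow> abs_continuous_on a b f"
  proof (rule Bolzano[OF assms(1), of "\<lambda>x y. a \<le> x \<and> y \<le> b \<longrightarrow> abs_continuous_on x y f"])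
    fix x y z :: real
    assume "a \<le> x \<and> y \<le> b \<longrightarrow> abs_continuous_on x y f" "a \<le> y \<and> z \<le> b \<longrightarrow> abs_continuous_on y z f" "x \<le> y" "y \<le> z"
    then show "a \<le> x \<and> z \<le> b \<longrightarrow> abs_continuous_on x z f"
      using abs_continuous_on_combine[of x y f z] by auto
  next
    fix x assume "a \<le> x" "x \<le> b"
    then obtain d where "d > 0" "\<forall>a' b'. a \<le> a' \<and> a' \<le> x \<and> x \<le> b' \<and> b' \<le> b \<and> b' - a' < d \<longrightarrow> abs_continuous_on a' b' f"
      using loc[of x] by auto
    then show "\<exists>d>0. \<forall>a' b'. a' \<le> x \<and> x \<le> b' \<and> b' - a' < d \<longrightarrow> (a \<le> a' \<and> b' \<le> b \<longrightarrow> abs_continuous_on a' b' f)"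
      by blast
  qed
  then show ?thesis by simp
qed

lemma abs_continuous_on_clamp:
  assumes f: "abs_continuous_on (max p (min q a)) (max p (min q b)) f" and "p \<le> q"
  shows "abs_continuous_on a b (\<lambda>t. f (max p (min q t)))"
proof (rule abs_continuous_onI)
  fix \<epsilon> :: real assume "\<epsilon> > 0"
  from abs_continuous_onD[OF f this] obtain \<delta> where \<delta>: "\<delta> > 0"
    "\<forall>n l r. disjoint_intervals (max p (min q a)) (max p (min q b)) n l r \<longrightarrow> (\<Sum>i<n. r i - l i) < \<delta> \<longrightarrow>
      (\<Sum>i<n. dist (f (l i)) (f (r i))) < \<epsilon>"
    by (elim exE conjE)
  have "(\<Sum>i<n. dist (f (max p (min q (l i)))) (f (max p (min q (r i))))) < \<epsilon>"
    if d: "disjoint_intervals a b n l r" and s: "(\<Sum>i<n. r i - l i) < \<delta>" for n l r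
  proof -
    note lr = disjoint_intervals_bounds[OF d]
    have mono: "max p (min q x) \<le> max p (min q y)" if "x \<le> y" for x y
      using that by (auto simp: min_def max_def)
    have sub: "{max p (min q x)<..<max p (min q y)} \<subseteq> {x<..<y}" for x y
      by (auto simp: min_def max_def split: if_splits)
    have "disjoint_intervals (max p (min q a)) (max p (min q b)) n
        (\<lambda>i. max p (min q (l i))) (\<lambda>i. max p (min q (r i)))"
      by (rule disjoint_intervals_monotone_image[OF d mono sub]) (use lr mono in auto)
    moreover have "(\<Sum>i<n. max p (min q (r i)) - max p (min q (l i))) \<le> (\<Sum>i<n. r i - l i)"
    proof (rule sum_mono)
      fix i assume "i \<in> {..<n}"
      then show "max p (min q (r i)) - max p (min q (l i)) \<le> r i - l i"
        using lr[of i] \<open>p \<le> q\<close> by (auto simp: min_def max_def)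
    qed
    ultimately show ?thesis using \<delta>(2) s by simp
  qed
  then show "\<exists>\<delta>>0. \<forall>n l r. disjoint_intervals a b n l r \<longrightarrow> (\<Sum>i<n. r i - l i) < \<delta> \<longrightarrow>
      (\<Sum>i<n. dist (f (max p (min q (l i)))) (f (max p (min q (r i))))) < \<epsilon>"
    by (intro exI[of _ \<delta>] conjI allI impI \<delta>(1))
qed

lemma abs_continuous_on_indefinite_integral:
  fixes f :: "real \<Rightarrow> real"
  assumes f: "f absolutely_integrable_on {0..1}"
  shows "abs_continuous_on 0 1 (\<lambda>t. integral {0..t} f)"
proof (rule abs_continuous_onI)
  fix \<epsilon> :: real assume "\<epsilon> > 0"
  with f obtain \<delta> where \<delta>: "\<delta> > 0"
    "\<And>T. T \<subseteq> {0..1} \<Longrightarrow> T \<in> sets lebesgue \<Longrightarrow> measure lebesgue T < \<delta> \<Longrightarrow> integral T (\<lambda>t. \<bar>f t\<bar>) < \<epsilon>"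
    by (rule integral_abs_small_on_small_sets) blast
  have "(\<Sum>i<n. dist (integral {0..l i} f) (integral {0..r i} f)) < \<epsilon>"
    if di: "disjoint_intervals 0 1 n l r" and s: "(\<Sum>i<n. r i - l i) < \<delta>" for n l r
  proof -
    note lr = disjoint_intervals_bounds[OF di]
    define T where "T = (\<Union>i<n. {l i<..<r i})"
    have fa: "(\<lambda>t. \<bar>f t\<bar>) absolutely_integrable_on {0..1}"
      using absolutely_integrable_norm[OF f] by (simp add: o_def)
    have disj: "pairwise (\<lambda>i i'. negligible ({l i<..<r i} \<inter> {l i'<..<r i'})) {..<n}"
      using di unfolding disjoint_intervals_def disjoint_family_on_def pairwise_def by auto
    have hi: "((\<lambda>t. \<bar>f t\<bar>) has_integral integral {l i..r i} (\<lambda>t. \<bar>f t\<bar>)) {l i<..<r i}" if "i < n" for i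
    proof -
      have "(\<lambda>t. \<bar>f t\<bar>) integrable_on {l i..r i}"
        using lr[OF that] by (intro set_lebesgue_integral_eq_integral(1) absolutely_integrable_on_subinterval[OF fa]) auto
      then have "((\<lambda>t. \<bar>f t\<bar>) has_integral integral {l i..r i} (\<lambda>t. \<bar>f t\<bar>)) {l i..r i}"
        by (rule integrable_integral)
      then show ?thesis by (simp add: has_integral_Icc_iff_Ioo)
    qed
    have 1: "integral T (\<lambda>t. \<bar>f t\<bar>) = (\<Sum>i<n. integral {l i..r i} (\<lambda>t. \<bar>f t\<bar>))"
      unfolding T_def by (rule integral_unique, rule has_integral_UN[OF _ hi disj]) auto
    have "((\<lambda>t. 1) has_integral (r i - l i)) {l i<..<r i}" if "i < n" for i
      using has_integral_const_real[of "1::real" "l i" "r i"] lr[OF that] by (simp add: has_integral_Icc_iff_Ioo)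
    then have T1: "((\<lambda>t. 1) has_integral (\<Sum>i<n. r i - l i)) T"
      unfolding T_def by (intro has_integral_UN[OF _ _ disj]) auto
    then have Tm: "T \<in> lmeasurable"
      using lmeasurable_iff_integrable_on[of T] by blast
    have Tm2: "measure lebesgue T = (\<Sum>i<n. r i - l i)"
      using lmeasure_integral[OF Tm] integral_unique[OF T1] by simp
    have "T \<subseteq> {0..1}"
    proof
      fix x assume "x \<in> T"
      then obtain i where "i < n" "l i < x" "x < r i" by (auto simp: T_def)
      then show "x \<in> {0..1}" using lr[of i] by auto
    qed
    then have "integral T (\<lambda>t. \<bar>f t\<bar>) < \<epsilon>"
      by (rule \<delta>(2)) (use Tm Tm2 s in \<open>auto dest: fmeasurableD\<close>)
    moreover have "dist (integral {0..l i} f) (integral {0..r i} f) \<le> integral {l i..r i} (\<lambda>t. \<bar>f t\<bar>)" if "i < n" for i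
    proof -
      have fi: "f absolutely_integrable_on {l i..r i}"
        using lr[OF that] by (intro absolutely_integrable_on_subinterval[OF f]) auto
      have "dist (integral {0..l i} f) (integral {0..r i} f) = norm (integral {l i..r i} f)"
        using indefinite_integral_diff[OF f, of "l i" "r i"] lr[OF that] by (simp add: dist_real_def abs_minus_commute)
      also have "\<dots> \<le> integral {l i..r i} (\<lambda>t. norm (f t))"
        using set_lebesgue_integral_eq_integral(1)[OF fi]
          set_lebesgue_integral_eq_integral(1)[OF absolutely_integrable_norm[OF fi]]
        by (intro integral_norm_bound_integral) (auto simp: o_def)
      finally show ?thesis by simp
    qed
    ultimately show ?thesis
      using 1 sum_mono[of "{..<n}" "\<lambda>i. dist (integral {0..l i} f) (integral {0..r i} f)" "\<lambda>i. integral {l i..r i} (\<lambda>t. \<bar>f t\<bar>)"]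
      by simp
  qed
  then show "\<exists>\<delta>>0. \<forall>n l r. disjoint_intervals 0 1 n l r \<longrightarrow> (\<Sum>i<n. r i - l i) < \<delta> \<longrightarrow>
      (\<Sum>i<n. dist (integral {0..l i} f) (integral {0..r i} f)) < \<epsilon>"
    by (intro exI[of _ \<delta>] conjI allI impI \<delta>(1))
qed

text \<open>Substitution with a \<open>\<sigma>\<close> that is differentiable only almost everywhere.  Both sides, as functions of
  the upper limit, change over a short interval \<open>[a, b]\<close> by nearly \<open>\<psi> (\<sigma> a) (\<sigma> b - \<sigma> a)\<close>, with errors
  that add up to an arbitrarily small multiple of \<open>\<sigma> 1\<close>.\<close>

lemma integral_substitution_indefinite_integral:
  fixes s \<psi> :: "real \<Rightarrow> real"
  assumes s: "s absolutely_integrable_on {0..1}" and nonneg: "\<And>t. t \<in> {0..1} \<Longrightarrow> s t \<ge> 0"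
  defines "\<sigma> \<equiv> \<lambda>t. integral {0..t} s"
  assumes \<psi>: "continuous_on {0..\<sigma> 1} \<psi>"
  shows "integral {0..1} (\<lambda>t. s t * \<psi> (\<sigma> t)) = integral {0..\<sigma> 1} \<psi>"
    and "(\<lambda>t. s t * \<psi> (\<sigma> t)) absolutely_integrable_on {0..1}"
proof -
  have \<sigma>_cont: "continuous_on {0..1} \<sigma>"
    unfolding \<sigma>_def by (rule continuous_on_indefinite_integral[OF s])
  have \<sigma>_diff: "\<sigma> b - \<sigma> a = integral {a..b} s" if "0 \<le> a" "a \<le> b" "b \<le> 1" for a b
    unfolding \<sigma>_def by (rule indefinite_integral_diff[OF s that])
  have \<sigma>_mono: "\<sigma> a \<le> \<sigma> b" if "0 \<le> a" "a \<le> b" "b \<le> 1" for a b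
  proof -
    have "0 \<le> integral {a..b} s"
      using that by (intro Henstock_Kurzweil_Integration.integral_nonneg set_lebesgue_integral_eq_integral(1) absolutely_integrable_on_subinterval[OF s] nonneg) auto
    then show ?thesis using \<sigma>_diff[OF that] by simp
  qed
  have \<sigma>0: "\<sigma> 0 = 0" by (simp add: \<sigma>_def)
  have \<sigma>_in: "\<sigma> t \<in> {0..\<sigma> 1}" if "t \<in> {0..1}" for t
    using \<sigma>_mono[of 0 t] \<sigma>_mono[of t 1] that \<sigma>0 by auto
  have \<psi>\<sigma>: "continuous_on {0..1} (\<lambda>t. \<psi> (\<sigma> t))"
    by (rule continuous_on_compose2[OF \<psi> \<sigma>_cont]) (use \<sigma>_in in auto)
  have "(\<lambda>t. \<psi> (\<sigma> t)) \<in> borel_measurable (lebesgue_on {0..1})"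
    by (rule continuous_imp_measurable_on_sets_lebesgue[OF \<psi>\<sigma>]) auto
  moreover have "bounded ((\<lambda>t. \<psi> (\<sigma> t)) ` {0..1})"
    by (intro compact_imp_bounded compact_continuous_image \<psi>\<sigma>) auto
  ultimately have "(\<lambda>t. \<psi> (\<sigma> t) * s t) absolutely_integrable_on {0..1}"
    by (intro absolutely_integrable_bounded_measurable_product_real s) auto
  then show int: "(\<lambda>t. s t * \<psi> (\<sigma> t)) absolutely_integrable_on {0..1}"
    by (simp add: mult.commute)
  define H where "H t = integral {0..t} (\<lambda>t. s t * \<psi> (\<sigma> t)) - integral {0..\<sigma> t} \<psi>" for t
  have bound: "\<bar>H 1 - H 0\<bar> \<le> 2 * e * (\<sigma> 1 - \<sigma> 0)" if "e > 0" for e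
  proof -
    have "0 \<le> (0::real) \<and> (1::real) \<le> 1 \<longrightarrow> \<bar>H 1 - H 0\<bar> \<le> 2 * e * (\<sigma> 1 - \<sigma> 0)"
    proof (rule Bolzano[of 0 1 "\<lambda>a b. 0 \<le> a \<and> b \<le> 1 \<longrightarrow> \<bar>H b - H a\<bar> \<le> 2 * e * (\<sigma> b - \<sigma> a)"])
      fix a b c :: real
      assume "0 \<le> a \<and> b \<le> 1 \<longrightarrow> \<bar>H b - H a\<bar> \<le> 2 * e * (\<sigma> b - \<sigma> a)"
        "0 \<le> b \<and> c \<le> 1 \<longrightarrow> \<bar>H c - H b\<bar> \<le> 2 * e * (\<sigma> c - \<sigma> b)" "a \<le> b" "b \<le> c"
      then show "0 \<le> a \<and> c \<le> 1 \<longrightarrow> \<bar>H c - H a\<bar> \<le> 2 * e * (\<sigma> c - \<sigma> a)"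
        by (auto simp: algebra_simps)
    next
      fix x :: real assume x: "0 \<le> x" "x \<le> 1"
      then obtain d where d: "d > 0" "\<And>t. t \<in> {0..1} \<Longrightarrow> dist t x < d \<Longrightarrow> dist (\<psi> (\<sigma> t)) (\<psi> (\<sigma> x)) < e"
        using \<psi>\<sigma> \<open>e > 0\<close> unfolding continuous_on_iff by (metis atLeastAtMost_iff)
      have "\<bar>H b - H a\<bar> \<le> 2 * e * (\<sigma> b - \<sigma> a)" if ab: "a \<le> x" "x \<le> b" "b - a < d" "0 \<le> a" "b \<le> 1" for a b
      proof -
        define c where "c = \<psi> (\<sigma> x)"
        have osc: "\<bar>\<psi> (\<sigma> t) - c\<bar> \<le> e" if "t \<in> {a..b}" for t
          using d(2)[of t] that ab by (force simp: dist_real_def c_def)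
        have osc': "\<bar>\<psi> y - c\<bar> \<le> e" if y: "y \<in> {\<sigma> a..\<sigma> b}" for y
        proof -
          have "continuous_on {a..b} \<sigma>" using \<sigma>_cont ab by (auto intro: continuous_on_subset)
          then obtain t where "a \<le> t" "t \<le> b" "\<sigma> t = y"
            using IVT'[of \<sigma> a y b] y ab by auto
          then show ?thesis using osc[of t] by auto
        qed
        have i1: "s integrable_on {a..b}" "(\<lambda>t. s t * \<psi> (\<sigma> t)) integrable_on {a..b}"
          using ab by (auto intro!: set_lebesgue_integral_eq_integral(1) absolutely_integrable_on_subinterval[OF s] absolutely_integrable_on_subinterval[OF int])
        have i3: "(\<lambda>t. k * s t) integrable_on {a..b}" for k
          using integrable_cmul[OF i1(1), of k] by simp
        have \<sigma>ab: "\<sigma> a \<le> \<sigma> b" "0 \<le> \<sigma> a" "\<sigma> b \<le> \<sigma> 1"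
          using \<sigma>_mono[of a b] \<sigma>_in[of a] \<sigma>_in[of b] ab by auto
        have i2: "\<psi> integrable_on {0..\<sigma> b}" "\<psi> integrable_on {\<sigma> a..\<sigma> b}"
          using \<sigma>ab by (auto intro!: integrable_continuous_real continuous_on_subset[OF \<psi>])
        have "integral {a..b} (\<lambda>t. s t * \<psi> (\<sigma> t)) - c * (\<sigma> b - \<sigma> a) = integral {a..b} (\<lambda>t. s t * \<psi> (\<sigma> t) - c * s t)"
          using i1 i3 ab \<sigma>_diff[of a b] by (subst integral_diff) auto
        also have "norm \<dots> \<le> integral {a..b} (\<lambda>t. e * s t)"
        proof (rule integral_norm_bound_integral)
          fix t assume t: "t \<in> {a..b}"
          then have "s t \<ge> 0" using nonneg ab by auto
          then have "\<bar>\<psi> (\<sigma> t) - c\<bar> * s t \<le> e * s t" using osc[OF t] by (rule mult_right_mono[rotated])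
          then show "norm (s t * \<psi> (\<sigma> t) - c * s t) \<le> e * s t"
            using \<open>s t \<ge> 0\<close> by (simp add: abs_mult[symmetric, of _ "s t"] abs_mult algebra_simps)
              (metis (no_types, lifting) abs_mult abs_of_nonneg left_diff_distrib mult.commute)
        qed (use i1 i3 in \<open>auto intro!: integrable_diff\<close>)
        also have "\<dots> = e * (\<sigma> b - \<sigma> a)" using \<sigma>_diff[of a b] ab by simp
        finally have 1: "\<bar>integral {a..b} (\<lambda>t. s t * \<psi> (\<sigma> t)) - c * (\<sigma> b - \<sigma> a)\<bar> \<le> e * (\<sigma> b - \<sigma> a)" by simp
        have "integral {\<sigma> a..\<sigma> b} \<psi> - c * (\<sigma> b - \<sigma> a) = integral {\<sigma> a..\<sigma> b} (\<lambda>y. \<psi> y - c)"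
          using i2 \<sigma>ab by (subst integral_diff) auto
        also have "norm \<dots> \<le> integral {\<sigma> a..\<sigma> b} (\<lambda>y. e)"
          using osc' i2 by (intro integral_norm_bound_integral) (auto intro!: integrable_diff)
        also have "\<dots> = e * (\<sigma> b - \<sigma> a)" using \<sigma>ab by simp
        finally have 2: "\<bar>integral {\<sigma> a..\<sigma> b} \<psi> - c * (\<sigma> b - \<sigma> a)\<bar> \<le> e * (\<sigma> b - \<sigma> a)" by simp
        have "H b - H a = integral {a..b} (\<lambda>t. s t * \<psi> (\<sigma> t)) - integral {\<sigma> a..\<sigma> b} \<psi>"
          using indefinite_integral_diff[OF int, of a b] ab
            Henstock_Kurzweil_Integration.integral_combine[OF \<sigma>ab(2,1) i2(1)] by (simp add: H_def)
        then show ?thesis using 1 2 by (simp add: abs_le_iff)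
      qed
      then show "\<exists>d>0. \<forall>a b. a \<le> x \<and> x \<le> b \<and> b - a < d \<longrightarrow> (0 \<le> a \<and> b \<le> 1 \<longrightarrow> \<bar>H b - H a\<bar> \<le> 2 * e * (\<sigma> b - \<sigma> a))"
        using d(1) by blast
    qed simp
    then show ?thesis by simp
  qed
  have "\<bar>H 1 - H 0\<bar> \<le> 0"
  proof (rule field_le_epsilon)
    fix e :: real assume "e > 0"
    define k where "k = e / (2 * (\<sigma> 1 + 1))"
    have p: "\<sigma> 1 \<ge> 0" using \<sigma>_in[of 1] by simp
    then have "k > 0" using \<open>e > 0\<close> by (simp add: k_def)
    have "2 * k * \<sigma> 1 \<le> 2 * k * (\<sigma> 1 + 1)" using \<open>k > 0\<close> by simp
    also have "\<dots> = e" using p by (simp add: k_def field_simps)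
    finally show "\<bar>H 1 - H 0\<bar> \<le> 0 + e" using bound[OF \<open>k > 0\<close>] \<sigma>0 by simp
  qed
  moreover have "H 0 = 0" by (simp add: H_def \<sigma>0)
  ultimately show "integral {0..1} (\<lambda>t. s t * \<psi> (\<sigma> t)) = integral {0..\<sigma> 1} \<psi>"
    by (simp add: H_def)
qed

section \<open>Differentiable curves and ordinary differential equations\<close>

lemma has_vector_derivative_chain:
  assumes k: "(k has_vector_derivative k') (at t within S)" and M: "(M has_derivative M') (at (k t))"
  shows "((\<lambda>s. M (k s)) has_vector_derivative M' k') (at t within S)"
  using vector_derivative_diff_chain_within[OF k has_derivative_at_withinI[OF M]] by (simp add: o_def)

lemma has_vector_derivative_eventually_cong:
  assumes "(f has_vector_derivative f') (at t within S)" "\<forall>\<^sub>F s in at t within S. f s = g s" "f t = g t"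
  shows "(g has_vector_derivative f') (at t within S)"
proof -
  have "\<forall>\<^sub>F s in nhds t. s \<in> S \<longrightarrow> f s = g s"
    using assms(2) unfolding eventually_at_filter by eventually_elim (use assms(3) in blast)
  from has_vector_derivative_cong_ev[OF this assms(3)] assms(1) show ?thesis by simp
qed

lemma continuous_within_small_interval:
  fixes k :: "real \<Rightarrow> 'a::metric_space"
  assumes c: "continuous (at t within {0..1}) k" and r: "r > 0"
  obtains d where "d > 0"
    "\<And>a b. 0 \<le> a \<Longrightarrow> a \<le> t \<Longrightarrow> t \<le> b \<Longrightarrow> b \<le> 1 \<Longrightarrow> b - a < d \<Longrightarrow> k ` {a..b} \<subseteq> cball (k t) r"
proof -
  obtain d where d: "d > 0" "\<forall>x'\<in>{0..1}. dist x' t < d \<longrightarrow> dist (k x') (k t) < r"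
    using c r unfolding continuous_within_eps_delta by blast
  show ?thesis
  proof (rule that[OF d(1)], rule image_subsetI)
    fix a b s assume *: "0 \<le> a" "a \<le> t" "t \<le> b" "b \<le> 1" "b - a < d" "s \<in> {a..b}"
    then have "s \<in> {0..1}" "dist s t < d" by (auto simp: dist_real_def)
    then show "k s \<in> cball (k t) r" using d(2) by (simp add: dist_commute less_imp_le)
  qed
qed

lemma norm_integral_from_0_le:
  fixes g :: "real \<Rightarrow> 'e::euclidean_space"
  assumes g: "continuous_on {-a..a} g" and "t \<in> {-a..a}" "a \<ge> 0"
    and B: "\<And>s. s \<in> {-a..a} \<Longrightarrow> norm (g s) \<le> B"
  shows "norm (integral {-a..t} g - integral {-a..0} g) \<le> B * \<bar>t\<bar>"
proof (cases "0 \<le> t")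
  case True
  have "continuous_on {-a..t} g" using g assms(2) by (auto intro: continuous_on_subset)
  then have "g integrable_on {-a..t}" by (rule integrable_continuous_real)
  from Henstock_Kurzweil_Integration.integral_combine[OF _ True this]
  have "integral {-a..t} g - integral {-a..0} g = integral {0..t} g" using \<open>a \<ge> 0\<close> by (simp add: algebra_simps)
  moreover have "norm (integral {0..t} g) \<le> B * (t - 0)"
    using assms True by (intro integral_bound) (auto intro: continuous_on_subset)
  ultimately show ?thesis using True by simp
next
  case False
  have "continuous_on {-a..0} g" using g assms(2,3) by (auto intro: continuous_on_subset)
  then have "g integrable_on {-a..0}" by (rule integrable_continuous_real)
  from Henstock_Kurzweil_Integration.integral_combine[OF _ _ this, of t]
  have "integral {-a..t} g - integral {-a..0} g = - integral {t..0} g"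
    using assms(2) False by (simp add: algebra_simps)
  moreover have "norm (integral {t..0} g) \<le> B * (0 - t)"
    using assms False by (intro integral_bound) (auto intro: continuous_on_subset)
  ultimately show ?thesis using False by simp
qed

text \<open>The solution is the fixed point of the integral operator on the bounded continuous functions
  with values in the ball; time is clamped to \<open>[-a, a]\<close> so that these functions are defined on all
  of \<open>\<real>\<close>.\<close>

lemma picard_local_solution:
  fixes f :: "'e::euclidean_space \<Rightarrow> 'e"
  assumes "r > 0" "L > 0"
    and lip: "\<And>x y. x \<in> cball x0 r \<Longrightarrow> y \<in> cball x0 r \<Longrightarrow> dist (f x) (f y) \<le> L * dist x y"
  obtains a x where "a > 0" "x 0 = x0"
    "\<And>t. t \<in> {-a..a} \<Longrightarrow> x t \<in> cball x0 r"
    "\<And>t. t \<in> {-a..a} \<Longrightarrow> (x has_vector_derivative f (x t)) (at t within {-a..a})"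
proof -
  define M where "M = norm (f x0) + L * r + 1"
  have "M > 0" using assms by (simp add: M_def add_nonneg_pos)
  have M: "norm (f y) \<le> M" if "y \<in> cball x0 r" for y
  proof -
    have "norm (f y) \<le> norm (f x0) + dist (f y) (f x0)"
      using norm_triangle_ineq2[of "f y" "f x0"] by (simp add: dist_norm)
    also have "dist (f y) (f x0) \<le> L * dist y x0" using that \<open>r > 0\<close> by (intro lip) auto
    also have "\<dots> \<le> L * r" using that \<open>L > 0\<close> by (simp add: dist_commute)
    finally show ?thesis by (simp add: M_def)
  qed
  have fc: "continuous_on (cball x0 r) f"
    using lip by (intro lipschitz_on_continuous_on[of L] lipschitz_onI) (use \<open>L > 0\<close> in auto)
  define a where "a = min (r / M) (1 / (2 * L))"
  have a: "a > 0" "M * a \<le> r" "L * a \<le> 1 / 2"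
    using \<open>M > 0\<close> assms(1,2) by (auto simp: a_def min_def field_simps)
  define c where "c t = max (-a) (min a t)" for t
  have c: "c t \<in> {-a..a}" for t using a by (auto simp: c_def)
  have c_id: "c t = t" if "t \<in> {-a..a}" for t using that by (auto simp: c_def)
  have cc: "continuous_on UNIV c" unfolding c_def by (intro continuous_intros)
  define J where "J g t = integral {-a..t} g - integral {-a..0} g" for g :: "real \<Rightarrow> 'e" and t
  have J: "(J g has_vector_derivative g t) (at t within {-a..a})"
    if "continuous_on {-a..a} g" "t \<in> {-a..a}" for g t
    using integral_has_vector_derivative[OF that] unfolding J_def
    by (auto intro!: derivative_eq_intros)
  define S where "S = PiC UNIV (\<lambda>_::real. cball x0 r)"
  have S: "y \<in> S \<longleftrightarrow> (\<forall>t. apply_bcontfun y t \<in> cball x0 r)" for y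
    by (auto simp: S_def mem_PiC_iff)
  have fy: "continuous_on {-a..a} (\<lambda>t. f (apply_bcontfun y t))" if "y \<in> S" for y
    by (rule continuous_on_compose2[OF fc]) (use that S in auto)
  define T where "T y = Bcontfun (\<lambda>t. x0 + J (\<lambda>t. f (apply_bcontfun y t)) (c t))" for y
  have Jbound: "norm (J g t) \<le> B * \<bar>t\<bar>"
    if "continuous_on {-a..a} g" "t \<in> {-a..a}" "\<And>s. s \<in> {-a..a} \<Longrightarrow> norm (g s) \<le> B" for g t B
    unfolding J_def using norm_integral_from_0_le[OF that(1,2) _ that(3)] a(1) by simp
  have Jr: "norm (J (\<lambda>t. f (apply_bcontfun y t)) (c t)) \<le> r" if y: "y \<in> S" for y t
  proof -
    have "norm (J (\<lambda>t. f (apply_bcontfun y t)) (c t)) \<le> M * \<bar>c t\<bar>"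
      by (rule Jbound[OF fy[OF y] c]) (use y S M in blast)
    also have "\<dots> \<le> M * a" using c[of t] \<open>M > 0\<close> by (intro mult_left_mono) auto
    finally show ?thesis using a by simp
  qed
  have T: "apply_bcontfun (T y) t = x0 + J (\<lambda>t. f (apply_bcontfun y t)) (c t)" if y: "y \<in> S" for y t
  proof -
    have "continuous_on {-a..a} (J (\<lambda>t. f (apply_bcontfun y t)))"
      by (rule continuous_on_vector_derivative[OF J[OF fy[OF y]]])
    then have "continuous_on UNIV (\<lambda>t. J (\<lambda>t. f (apply_bcontfun y t)) (c t))"
      by (rule continuous_on_compose2[OF _ cc]) (use c in auto)
    then have "(\<lambda>t. x0 + J (\<lambda>t. f (apply_bcontfun y t)) (c t)) \<in> bcontfun"
    proof (intro bcontfun_normI continuous_intros)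
      show "norm (x0 + J (\<lambda>t. f (apply_bcontfun y t)) (c t)) \<le> norm x0 + r" for t
        using norm_triangle_ineq[of x0] Jr[OF y, of t] by (meson add_left_mono order_trans)
    qed
    then show ?thesis by (simp add: T_def Bcontfun_inverse)
  qed
  have "\<exists>!y\<in>S. T y = y"
  proof (rule Banach_fix[of S "1 / 2" T])
    have "closed S" unfolding S_def by (rule closed_PiC) simp
    then show "complete S" by (simp add: complete_eq_closed)
    have "const_bcontfun x0 \<in> S" using \<open>r > 0\<close> by (simp add: S)
    then show "S \<noteq> {}" by blast
    show "T ` S \<subseteq> S"
    proof
      fix z assume "z \<in> T ` S"
      then obtain y where y: "y \<in> S" "z = T y" by blast
      then show "z \<in> S" using Jr[OF y(1)] T[OF y(1)] by (simp add: S dist_norm)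
    qed
    show "dist (T y) (T z) \<le> 1 / 2 * dist y z" if y: "y \<in> S" and z: "z \<in> S" for y z
    proof (rule dist_bound)
      fix t
      have i: "(\<lambda>t. f (apply_bcontfun y t)) integrable_on {-a..s}" "(\<lambda>t. f (apply_bcontfun z t)) integrable_on {-a..s}"
        if "s \<le> a" for s
        using that by (auto intro!: integrable_continuous_real continuous_on_subset[OF fy[OF y]] continuous_on_subset[OF fy[OF z]])
      have "dist (apply_bcontfun (T y) t) (apply_bcontfun (T z) t) =
          norm (J (\<lambda>t. f (apply_bcontfun y t) - f (apply_bcontfun z t)) (c t))"
        using i[of "c t"] i[of 0] c[of t] a(1)
        by (simp add: T[OF y] T[OF z] dist_norm J_def integral_diff algebra_simps)
      also have "\<dots> \<le> (L * dist y z) * \<bar>c t\<bar>"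
      proof (rule Jbound[OF _ c])
        show "continuous_on {-a..a} (\<lambda>t. f (apply_bcontfun y t) - f (apply_bcontfun z t))"
          by (intro continuous_intros fy y z)
        fix s
        have "dist (f (apply_bcontfun y s)) (f (apply_bcontfun z s)) \<le> L * dist (apply_bcontfun y s) (apply_bcontfun z s)"
          using y z S by (intro lip) auto
        also have "\<dots> \<le> L * dist y z" using \<open>L > 0\<close> by (intro mult_left_mono dist_bounded) auto
        finally show "norm (f (apply_bcontfun y s) - f (apply_bcontfun z s)) \<le> L * dist y z" by (simp add: dist_norm)
      qed
      also have "\<dots> \<le> (L * dist y z) * a" using c[of t] \<open>L > 0\<close> by (intro mult_left_mono) auto
      also have "\<dots> = (L * a) * dist y z" by simp
      also have "\<dots> \<le> 1 / 2 * dist y z" using a(3) by (intro mult_right_mono) auto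
      finally show "dist (apply_bcontfun (T y) t) (apply_bcontfun (T z) t) \<le> 1 / 2 * dist y z" .
    qed
  qed auto
  then obtain y where y: "y \<in> S" "T y = y" by blast
  define x where "x = apply_bcontfun y"
  have x: "x t = x0 + J (\<lambda>t. f (x t)) (c t)" for t
    using T[OF y(1), of t] y(2) by (simp add: x_def)
  show ?thesis
  proof (rule that[of a x])
    show "x 0 = x0" using x[of 0] a(1) by (simp add: c_id J_def)
    show "x t \<in> cball x0 r" for t using y(1) S by (simp add: x_def)
    fix t assume t: "t \<in> {-a..a}"
    have "((\<lambda>t. x0 + J (\<lambda>t. f (x t)) t) has_vector_derivative f (x t)) (at t within {-a..a})"
      using J[OF fy[OF y(1)] t] unfolding x_def by (auto intro!: derivative_eq_intros)
    then show "(x has_vector_derivative f (x t)) (at t within {-a..a})"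
    proof (rule has_vector_derivative_transform[OF t, rotated])
      show "x s = x0 + J (\<lambda>t. f (x t)) s" if "s \<in> {-a..a}" for s
        using x[of s] by (simp only: c_id[OF that])
    qed
  qed (rule a)
qed

section \<open>Smooth maps into a Lie group\<close>

context mult_group
begin

sublocale mult_group: group times one inverse
  by unfold_locales (simp_all add: mult_group_left_inverse)

lemma mult_inverse_cancel_left [simp]: "a * (inverse a * b) = b" "inverse a * (a * b) = b"
  by (simp_all add: mult.assoc[symmetric])

end

text \<open>Smoothness of a map defined on an open subset of a vector space, tested in the charts of the target.\<close>

definition smooth_into ::
  "('m::topological_space, 'e::euclidean_space) chart set \<Rightarrow> ('a::real_normed_vector \<Rightarrow> 'm) \<Rightarrow> 'a set \<Rightarrow> bool" where
  "smooth_into A h S \<longleftrightarrow> open S \<and> continuous_on S h \<and>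
     (\<forall>(V, \<psi>)\<in>A. smooth_on (\<lambda>x. \<psi> (h x)) (S \<inter> h -` V))"

locale lie_group_atlas =
  fixes A :: "('g::{mult_group, t2_space, second_countable_topology}, 'e::euclidean_space) chart set"
  assumes lie_group: "lie_group A"
begin

lemma chart_open: "(V, \<psi>) \<in> A \<Longrightarrow> open V" "(V, \<psi>) \<in> A \<Longrightarrow> open (\<psi> ` V)"
  using lie_group unfolding lie_group_def smooth_atlas_def by auto

lemma chart_homeomorphism: "(V, \<psi>) \<in> A \<Longrightarrow> homeomorphism V (\<psi> ` V) \<psi> (inv_into V \<psi>)"
  using lie_group unfolding lie_group_def smooth_atlas_def by auto

lemma chart_continuous:
  "(V, \<psi>) \<in> A \<Longrightarrow> continuous_on V \<psi>" "(V, \<psi>) \<in> A \<Longrightarrow> continuous_on (\<psi> ` V) (inv_into V \<psi>)"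
  using chart_homeomorphism[of V \<psi>] by (auto simp: homeomorphism_def)

lemma chart_inverse:
  "(V, \<psi>) \<in> A \<Longrightarrow> p \<in> V \<Longrightarrow> inv_into V \<psi> (\<psi> p) = p"
  using chart_homeomorphism[of V \<psi>] by (auto simp: homeomorphism_def)

lemma chart_inverse_mem:
  "x \<in> \<psi> ` V \<Longrightarrow> inv_into V \<psi> x \<in> V" "x \<in> \<psi> ` V \<Longrightarrow> \<psi> (inv_into V \<psi> x) = x"
  by (auto simp: inv_into_into f_inv_into_f)

lemma chart_at_mem: "chart_at A p \<in> A" "p \<in> fst (chart_at A p)"
proof -
  have "\<exists>c. c \<in> A \<and> p \<in> fst c"
    using lie_group unfolding lie_group_def smooth_atlas_def by blast
  from someI_ex[OF this] show "chart_at A p \<in> A" "p \<in> fst (chart_at A p)"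
    unfolding chart_at_def by blast+
qed

lemma chart_at_pair: "(fst (chart_at A p), coord_at A p) \<in> A"
  using chart_at_mem(1) by simp

lemma continuous_on_group_mult:
  assumes "continuous_on S h" "continuous_on S k"
  shows "continuous_on S (\<lambda>x. h x * k x :: 'g)"
proof -
  have "continuous_on UNIV (\<lambda>(x, y). x * y :: 'g)"
    using lie_group unfolding lie_group_def smooth_map_def by blast
  from continuous_on_compose2[OF this continuous_on_Pair[OF assms]] show ?thesis by simp
qed

lemma continuous_on_group_inverse:
  assumes "continuous_on S h"
  shows "continuous_on S (\<lambda>x. inverse (h x) :: 'g)"
proof -
  have "continuous_on UNIV (inverse :: 'g \<Rightarrow> 'g)"
    using lie_group unfolding lie_group_def smooth_map_def by blast
  from continuous_on_compose2[OF this assms] show ?thesis by simp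
qed

lemma tendsto_group_mult:
  assumes "(h \<longlongrightarrow> a) F" "(k \<longlongrightarrow> b) F"
  shows "((\<lambda>x. h x * k x :: 'g) \<longlongrightarrow> a * b) F"
proof -
  have "isCont (\<lambda>(x, y). x * y :: 'g) (a, b)"
    using lie_group unfolding lie_group_def smooth_map_def by (simp add: continuous_on_eq_continuous_at)
  from isCont_tendsto_compose[OF this tendsto_Pair[OF assms]] show ?thesis by simp
qed

lemma smooth_into_open: "smooth_into A h S \<Longrightarrow> open S"
  by (simp add: smooth_into_def)

lemma smooth_into_continuous: "smooth_into A h S \<Longrightarrow> continuous_on S h"
  by (simp add: smooth_into_def)

lemma smooth_into_preimage_open: "smooth_into A h S \<Longrightarrow> open V \<Longrightarrow> open (S \<inter> h -` V)"
  unfolding smooth_into_def using continuous_open_preimage by blast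

lemma smooth_into_coordinates:
  assumes "smooth_into A h S" "(V, \<psi>) \<in> A"
  shows "smooth_on (\<lambda>x. \<psi> (h x)) (S \<inter> h -` V)"
  using assms unfolding smooth_into_def by blast

lemma smooth_intoI:
  assumes "open S" "continuous_on S h"
    and "\<And>V \<psi>. (V, \<psi>) \<in> A \<Longrightarrow> smooth_on (\<lambda>x. \<psi> (h x)) (S \<inter> h -` V)"
  shows "smooth_into A h S"
  using assms unfolding smooth_into_def by blast

lemma smooth_into_const: "open S \<Longrightarrow> smooth_into A (\<lambda>_. g) S"
  by (rule smooth_intoI) (auto intro: smooth_on_const)

lemma smooth_into_compose:
  fixes k :: "'a::real_normed_vector \<Rightarrow> 'b::euclidean_space"
  assumes h: "smooth_into A h S" and k: "smooth_on k T" "open T" "k ` T \<subseteq> S"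
  shows "smooth_into A (\<lambda>x. h (k x)) T"
proof (rule smooth_intoI)
  have kc: "continuous_on T k" using k(1) by (rule smooth_on_imp_continuous_on)
  show c: "continuous_on T (\<lambda>x. h (k x))"
    by (rule continuous_on_compose2[OF smooth_into_continuous[OF h] kc k(3)])
  fix V \<psi> assume V: "(V, \<psi>) \<in> A"
  show "smooth_on (\<lambda>x. \<psi> (h (k x))) (T \<inter> (\<lambda>x. h (k x)) -` V)"
  proof (rule smooth_on_compose[OF _ smooth_into_coordinates[OF h V]])
    show "open (T \<inter> (\<lambda>x. h (k x)) -` V)"
      using continuous_open_preimage[OF c k(2) chart_open(1)[OF V]] .
    show "smooth_on k (T \<inter> (\<lambda>x. h (k x)) -` V)" by (rule smooth_on_subset[OF k(1)]) auto
  qed (use k(3) in auto)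
qed fact

lemma smooth_into_chart_inverse:
  assumes V: "(V, \<psi>) \<in> A"
  shows "smooth_into A (inv_into V \<psi>) (\<psi> ` V)"
proof (rule smooth_intoI)
  fix W \<xi> assume W: "(W, \<xi>) \<in> A"
  have "smooth_on (\<xi> \<circ> inv_into V \<psi>) (\<psi> ` (V \<inter> W))"
    using lie_group V W unfolding lie_group_def smooth_atlas_def by blast
  then show "smooth_on (\<lambda>x. \<xi> (inv_into V \<psi> x)) (\<psi> ` V \<inter> inv_into V \<psi> -` W)"
    unfolding o_def by (rule smooth_on_subset) (auto simp: chart_inverse[OF V])
qed (use chart_open chart_continuous V in auto)

lemma smooth_into_mult:
  fixes h k :: "'a::euclidean_space \<Rightarrow> 'g"
  assumes h: "smooth_into A h S" and k: "smooth_into A k S"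
  shows "smooth_into A (\<lambda>x. h x * k x) S"
proof (rule smooth_intoI)
  show "open S" using h by (rule smooth_into_open)
  show c: "continuous_on S (\<lambda>x. h x * k x)"
    by (intro continuous_on_group_mult smooth_into_continuous h k)
  fix W \<xi> assume W: "(W, \<xi>) \<in> A"
  show "smooth_on (\<lambda>x. \<xi> (h x * k x)) (S \<inter> (\<lambda>x. h x * k x) -` W)"
  proof (rule smooth_on_local)
    fix x assume x: "x \<in> S \<inter> (\<lambda>x. h x * k x) -` W"
    obtain V1 \<psi>1 where V1: "(V1, \<psi>1) \<in> A" "h x \<in> V1"
      using chart_at_pair chart_at_mem(2) by blast
    obtain V2 \<psi>2 where V2: "(V2, \<psi>2) \<in> A" "k x \<in> V2"
      using chart_at_pair chart_at_mem(2) by blast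
    define T where "T = (S \<inter> h -` V1) \<inter> (S \<inter> k -` V2) \<inter> (S \<inter> (\<lambda>x. h x * k x) -` W)"
    have T: "open T" unfolding T_def
      by (intro open_Int smooth_into_preimage_open[OF h] smooth_into_preimage_open[OF k]
          continuous_open_preimage[OF c] \<open>open S\<close> chart_open(1)[OF V1(1)] chart_open(1)[OF V2(1)] chart_open(1)[OF W])
    define m where "m = (\<xi> \<circ> (\<lambda>(x, y). x * y) \<circ> inv_into (V1 \<times> V2) (map_prod \<psi>1 \<psi>2))"
    have m: "smooth_on m (map_prod \<psi>1 \<psi>2 ` (V1 \<times> V2 \<inter> (\<lambda>(x, y). x * y) -` W))"
    proof -
      have "(V1 \<times> V2, map_prod \<psi>1 \<psi>2) \<in> prod_atlas A A" unfolding prod_atlas_def using V1 V2 by blast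
      then show ?thesis
        using lie_group W unfolding lie_group_def smooth_map_def m_def by blast
    qed
    have inj: "inj_on (map_prod \<psi>1 \<psi>2) (V1 \<times> V2)"
      by (intro map_prod_inj_on inj_on_inverseI[of _ "inv_into V1 \<psi>1"] inj_on_inverseI[of _ "inv_into V2 \<psi>2"])
        (simp_all add: chart_inverse[OF V1(1)] chart_inverse[OF V2(1)])
    have "smooth_on (\<lambda>x. m (\<psi>1 (h x), \<psi>2 (k x))) T"
    proof (rule smooth_on_compose[OF T m])
      show "smooth_on (\<lambda>x. (\<psi>1 (h x), \<psi>2 (k x))) T"
        by (intro smooth_on_Pair T smooth_on_subset[OF smooth_into_coordinates[OF h V1(1)]]
            smooth_on_subset[OF smooth_into_coordinates[OF k V2(1)]]) (auto simp: T_def)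
      show "(\<lambda>x. (\<psi>1 (h x), \<psi>2 (k x))) ` T \<subseteq> map_prod \<psi>1 \<psi>2 ` (V1 \<times> V2 \<inter> (\<lambda>(x, y). x * y) -` W)"
      proof
        fix z assume "z \<in> (\<lambda>x. (\<psi>1 (h x), \<psi>2 (k x))) ` T"
        then obtain y where y: "y \<in> T" "z = map_prod \<psi>1 \<psi>2 (h y, k y)" by auto
        have "(h y, k y) \<in> V1 \<times> V2 \<inter> (\<lambda>(x, y). x * y) -` W" using y(1) by (simp add: T_def)
        then show "z \<in> map_prod \<psi>1 \<psi>2 ` (V1 \<times> V2 \<inter> (\<lambda>(x, y). x * y) -` W)"
          unfolding y(2) by (rule imageI)
      qed
    qed
    then have "smooth_on (\<lambda>x. \<xi> (h x * k x)) T"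
    proof (rule smooth_on_cong[OF _ T])
      fix y assume "y \<in> T"
      then have "inv_into (V1 \<times> V2) (map_prod \<psi>1 \<psi>2) (map_prod \<psi>1 \<psi>2 (h y, k y)) = (h y, k y)"
        by (intro inv_into_f_f[OF inj]) (auto simp: T_def)
      then show "m (\<psi>1 (h y), \<psi>2 (k y)) = \<xi> (h y * k y)" by (simp add: m_def)
    qed
    then have "smooth_on (\<lambda>x. \<xi> (h x * k x)) (S \<inter> (\<lambda>x. h x * k x) -` W \<inter> T)"
      by (rule smooth_on_subset) simp
    moreover have "x \<in> T" using x V1 V2 by (auto simp: T_def)
    ultimately show "\<exists>T. open T \<and> x \<in> T \<and>
        smooth_on (\<lambda>x. \<xi> (h x * k x)) (S \<inter> (\<lambda>x. h x * k x) -` W \<inter> T)"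
      by (intro exI[of _ T] conjI T)
  qed
qed

lemma smooth_into_inverse:
  fixes h :: "'a::euclidean_space \<Rightarrow> 'g"
  assumes h: "smooth_into A h S"
  shows "smooth_into A (\<lambda>x. inverse (h x)) S"
proof (rule smooth_intoI)
  show "open S" using h by (rule smooth_into_open)
  show c: "continuous_on S (\<lambda>x. inverse (h x))"
    by (intro continuous_on_group_inverse smooth_into_continuous h)
  fix W \<xi> assume W: "(W, \<xi>) \<in> A"
  show "smooth_on (\<lambda>x. \<xi> (inverse (h x))) (S \<inter> (\<lambda>x. inverse (h x)) -` W)"
  proof (rule smooth_on_local)
    fix x assume x: "x \<in> S \<inter> (\<lambda>x. inverse (h x)) -` W"
    obtain V \<psi> where V: "(V, \<psi>) \<in> A" "h x \<in> V"
      using chart_at_pair chart_at_mem(2) by blast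
    define T where "T = (S \<inter> h -` V) \<inter> (S \<inter> (\<lambda>x. inverse (h x)) -` W)"
    have T: "open T" unfolding T_def
      by (intro open_Int smooth_into_preimage_open[OF h]
          continuous_open_preimage[OF c] \<open>open S\<close> chart_open(1)[OF V(1)] chart_open(1)[OF W])
    have m: "smooth_on (\<xi> \<circ> inverse \<circ> inv_into V \<psi>) (\<psi> ` (V \<inter> inverse -` W))"
      using lie_group W V(1) unfolding lie_group_def smooth_map_def by blast
    have "smooth_on (\<lambda>x. (\<xi> \<circ> inverse \<circ> inv_into V \<psi>) (\<psi> (h x))) T"
      by (rule smooth_on_compose[OF T m])
        (auto intro!: smooth_on_subset[OF smooth_into_coordinates[OF h V(1)]] simp: T_def)
    then have "smooth_on (\<lambda>x. \<xi> (inverse (h x))) T"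
      by (rule smooth_on_cong[OF _ T]) (simp add: T_def chart_inverse[OF V(1)])
    then have "smooth_on (\<lambda>x. \<xi> (inverse (h x))) (S \<inter> (\<lambda>x. inverse (h x)) -` W \<inter> T)"
      by (rule smooth_on_subset) simp
    moreover have "x \<in> T" using x V by (auto simp: T_def)
    ultimately show "\<exists>T. open T \<and> x \<in> T \<and>
        smooth_on (\<lambda>x. \<xi> (inverse (h x))) (S \<inter> (\<lambda>x. inverse (h x)) -` W \<inter> T)"
      by (intro exI[of _ T] conjI T)
  qed
qed

section \<open>Left logarithmic derivatives\<close>

text \<open>The preferred chart at the identity: \<open>co\<close> sends \<open>dom1\<close> to the model space, where \<open>e1\<close> represents the
  identity and the Lie algebra is the tangent space.\<close>

definition dom1 :: "'g set" where "dom1 = fst (chart_at A 1)"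
definition co :: "'g \<Rightarrow> 'e" where "co = coord_at A 1"
definition coi :: "'e \<Rightarrow> 'g" where "coi = coord_inv_at A 1"
definition e1 :: 'e where "e1 = co 1"

lemma dom1_chart: "(dom1, co) \<in> A"
  unfolding dom1_def co_def by (rule chart_at_pair)

lemma one_mem_dom1 [simp]: "1 \<in> dom1"
  unfolding dom1_def by (rule chart_at_mem)

lemma open_dom1 [simp]: "open dom1" and open_co_dom1 [simp]: "open (co ` dom1)"
  using chart_open[OF dom1_chart] by auto

lemma coi_eq: "coi = inv_into dom1 co"
  by (simp add: coi_def dom1_def co_def)

lemma coi_co [simp]: "p \<in> dom1 \<Longrightarrow> coi (co p) = p"
  unfolding coi_eq by (rule chart_inverse[OF dom1_chart])

lemma coi_mem [simp]: "x \<in> co ` dom1 \<Longrightarrow> coi x \<in> dom1" and co_coi [simp]: "x \<in> co ` dom1 \<Longrightarrow> co (coi x) = x"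
  unfolding coi_eq by (auto intro: chart_inverse_mem)

lemma e1_mem [simp]: "e1 \<in> co ` dom1"
  by (simp add: e1_def)

lemma coi_e1 [simp]: "coi e1 = 1" and co_one: "co 1 = e1"
  by (simp_all add: e1_def)

lemma smooth_into_coi: "smooth_into A coi (co ` dom1)"
  unfolding coi_eq by (rule smooth_into_chart_inverse[OF dom1_chart])

lemma smooth_into_coi_compose:
  fixes k :: "'a::real_normed_vector \<Rightarrow> 'e"
  shows "smooth_on k T \<Longrightarrow> open T \<Longrightarrow> k ` T \<subseteq> co ` dom1 \<Longrightarrow> smooth_into A (\<lambda>x. coi (k x)) T"
  by (rule smooth_into_compose[OF smooth_into_coi])

lemma continuous_within_co:
  assumes "continuous (at t within S) \<gamma>" "\<gamma> t \<in> dom1"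
  shows "continuous (at t within S) (\<lambda>s. co (\<gamma> s))"
proof -
  have "isCont co (\<gamma> t)"
    using chart_continuous(1)[OF dom1_chart] assms(2) continuous_on_eq_continuous_at[OF open_dom1] by blast
  then show ?thesis using assms(1) by (rule continuous_within_compose3)
qed

lemma eventually_left_translate_mem:
  fixes \<gamma> :: "'a::t2_space \<Rightarrow> 'g"
  assumes "continuous (at t within S) \<gamma>" "open V" "g * \<gamma> t \<in> V"
  shows "\<forall>\<^sub>F s in at t within S. g * \<gamma> s \<in> V"
proof -
  have "((\<lambda>s. g * \<gamma> s) \<longlongrightarrow> g * \<gamma> t) (at t within S)"
    using tendsto_group_mult[OF tendsto_const, of \<gamma> "\<gamma> t" "at t within S" g] assms(1)
    by (simp add: continuous_within)
  then show ?thesis using assms(2,3) by (rule topological_tendstoD)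
qed

text \<open>The tangent vector of a curve, translated back to the identity.  Continuity is a separate condition
  because the values of \<open>co\<close> outside \<open>dom1\<close> carry no meaning.\<close>

definition has_left_derivative :: "(real \<Rightarrow> 'g) \<Rightarrow> 'e \<Rightarrow> real \<Rightarrow> real set \<Rightarrow> bool" where
  "has_left_derivative \<gamma> u t S \<longleftrightarrow> continuous (at t within S) \<gamma> \<and>
     ((\<lambda>s. co (inverse (\<gamma> t) * \<gamma> s)) has_vector_derivative u) (at t within S)"

text \<open>The adjoint representation.\<close>

definition Ad :: "'g \<Rightarrow> 'e \<Rightarrow> 'e" where
  "Ad g = frechet_derivative (\<lambda>x. co (g * coi x * inverse g)) (at e1)"

lemma has_left_derivative_subset:
  "has_left_derivative \<gamma> u t S \<Longrightarrow> T \<subseteq> S \<Longrightarrow> has_left_derivative \<gamma> u t T"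
  unfolding has_left_derivative_def
  by (auto intro: continuous_within_subset has_vector_derivative_within_subset)

lemma smooth_into_coord_has_derivative:
  fixes h :: "'a::euclidean_space \<Rightarrow> 'g"
  assumes h: "smooth_into A h S" and x: "x \<in> S" and V: "(V, \<psi>) \<in> A" "h x \<in> V"
  shows "((\<lambda>y. \<psi> (h y)) has_derivative frechet_derivative (\<lambda>y. \<psi> (h y)) (at x)) (at x)"
  by (rule smooth_on_has_derivative[OF smooth_into_coordinates[OF h V(1)]]) (use x V in auto)

text \<open>Near \<open>t\<close> a curve \<open>\<gamma>\<close> is \<open>\<gamma> t * coi x\<close> with \<open>x\<close> a differentiable curve in the model space, so
  a smooth function of the point can be differentiated along \<open>\<gamma>\<close> by the chain rule.\<close>

lemma has_left_derivative_local_coordinates: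
  assumes "has_left_derivative \<gamma> u t S"
  shows "\<forall>\<^sub>F s in at t within S. inverse (\<gamma> t) * \<gamma> s \<in> dom1 \<and> \<gamma> s = \<gamma> t * coi (co (inverse (\<gamma> t) * \<gamma> s))"
proof -
  have "\<forall>\<^sub>F s in at t within S. inverse (\<gamma> t) * \<gamma> s \<in> dom1"
    using assms by (intro eventually_left_translate_mem) (auto simp: has_left_derivative_def)
  then show ?thesis by eventually_elim simp
qed

lemma has_left_derivative_chart:
  assumes \<gamma>: "has_left_derivative \<gamma> u t S" and V: "(V, \<psi>) \<in> A" "g * \<gamma> t \<in> V"
  shows "((\<lambda>s. \<psi> (g * \<gamma> s)) has_vector_derivative
    frechet_derivative (\<lambda>x. \<psi> (g * \<gamma> t * coi x)) (at e1) u) (at t within S)"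
proof -
  define k where "k s = co (inverse (\<gamma> t) * \<gamma> s)" for s
  have kt: "k t = e1" by (simp add: k_def co_one)
  have "smooth_into A (\<lambda>x. g * \<gamma> t * coi x) (co ` dom1)"
    by (intro smooth_into_mult smooth_into_const smooth_into_coi) auto
  from smooth_into_coord_has_derivative[OF this e1_mem V(1)] V(2)
  have "((\<lambda>x. \<psi> (g * \<gamma> t * coi x)) has_derivative
      frechet_derivative (\<lambda>x. \<psi> (g * \<gamma> t * coi x)) (at e1)) (at (k t))" by (simp add: kt)
  moreover have "(k has_vector_derivative u) (at t within S)"
    using \<gamma> unfolding has_left_derivative_def k_def[abs_def] by simp
  ultimately have "((\<lambda>s. \<psi> (g * \<gamma> t * coi (k s))) has_vector_derivative
      frechet_derivative (\<lambda>x. \<psi> (g * \<gamma> t * coi x)) (at e1) u) (at t within S)"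
    by (rule has_vector_derivative_chain[rotated])
  then show ?thesis
  proof (rule has_vector_derivative_eventually_cong)
    show "\<forall>\<^sub>F s in at t within S. \<psi> (g * \<gamma> t * coi (k s)) = \<psi> (g * \<gamma> s)"
      using has_left_derivative_local_coordinates[OF \<gamma>]
      by eventually_elim (simp add: k_def mult.assoc)
  qed (simp add: kt)
qed

lemma has_left_derivative_of_chart:
  assumes c: "continuous (at t within S) \<gamma>" and V: "(V, \<psi>) \<in> A" "\<gamma> t \<in> V"
    and w: "((\<lambda>s. \<psi> (\<gamma> s)) has_vector_derivative w) (at t within S)"
  shows "has_left_derivative \<gamma> (frechet_derivative (\<lambda>x. co (inverse (\<gamma> t) * inv_into V \<psi> x)) (at (\<psi> (\<gamma> t))) w) t S"
  unfolding has_left_derivative_def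
proof
  have "smooth_into A (\<lambda>x. inverse (\<gamma> t) * inv_into V \<psi> x) (\<psi> ` V)"
    by (intro smooth_into_mult smooth_into_const smooth_into_chart_inverse V chart_open)
  from smooth_into_coord_has_derivative[OF this, of "\<psi> (\<gamma> t)" dom1 co] V
  have "((\<lambda>x. co (inverse (\<gamma> t) * inv_into V \<psi> x)) has_derivative
      frechet_derivative (\<lambda>x. co (inverse (\<gamma> t) * inv_into V \<psi> x)) (at (\<psi> (\<gamma> t)))) (at (\<psi> (\<gamma> t)))"
    by (simp add: chart_inverse dom1_chart)
  from has_vector_derivative_chain[OF w this]
  show "((\<lambda>s. co (inverse (\<gamma> t) * \<gamma> s)) has_vector_derivative
      frechet_derivative (\<lambda>x. co (inverse (\<gamma> t) * inv_into V \<psi> x)) (at (\<psi> (\<gamma> t))) w) (at t within S)"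
  proof (rule has_vector_derivative_eventually_cong)
    have "\<forall>\<^sub>F s in at t within S. 1 * \<gamma> s \<in> V"
      using V by (intro eventually_left_translate_mem[OF c] chart_open(1)[OF V(1)]) auto
    then show "\<forall>\<^sub>F s in at t within S. co (inverse (\<gamma> t) * inv_into V \<psi> (\<psi> (\<gamma> s))) = co (inverse (\<gamma> t) * \<gamma> s)"
      by eventually_elim (simp add: chart_inverse[OF V(1)])
  qed (simp add: chart_inverse[OF V(1)] V(2))
qed (rule c)

text \<open>The two maps are the differentials of the translations by \<open>p\<close> and \<open>p\<^sup>-\<^sup>1\<close>.\<close>

lemma translation_derivatives_inverse:
  assumes V: "(V, \<psi>) \<in> A" "p \<in> V"
  shows "frechet_derivative (\<lambda>x. co (inverse p * inv_into V \<psi> x)) (at (\<psi> p))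
    (frechet_derivative (\<lambda>x. \<psi> (p * coi x)) (at e1) v) = v"
proof -
  have 1: "smooth_into A (\<lambda>x. p * coi x) (co ` dom1)"
    by (intro smooth_into_mult smooth_into_const smooth_into_coi) auto
  from smooth_into_coord_has_derivative[OF this e1_mem V(1)] V(2)
  have d1: "((\<lambda>x. \<psi> (p * coi x)) has_derivative frechet_derivative (\<lambda>x. \<psi> (p * coi x)) (at e1)) (at e1)" by simp
  have "smooth_into A (\<lambda>x. inverse p * inv_into V \<psi> x) (\<psi> ` V)"
    by (intro smooth_into_mult smooth_into_const smooth_into_chart_inverse V chart_open)
  from smooth_into_coord_has_derivative[OF this, of "\<psi> p" dom1 co] V
  have d2: "((\<lambda>x. co (inverse p * inv_into V \<psi> x)) has_derivative
      frechet_derivative (\<lambda>x. co (inverse p * inv_into V \<psi> x)) (at (\<psi> p))) (at (\<psi> (p * coi e1)))"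
    by (simp add: chart_inverse dom1_chart)
  have "((\<lambda>x. co (inverse p * inv_into V \<psi> (\<psi> (p * coi x)))) has_derivative
      (\<lambda>v. frechet_derivative (\<lambda>x. co (inverse p * inv_into V \<psi> x)) (at (\<psi> p))
        (frechet_derivative (\<lambda>x. \<psi> (p * coi x)) (at e1) v))) (at e1)"
    by (rule has_derivative_compose[OF d1 d2])
  then have "((\<lambda>x. x) has_derivative
      (\<lambda>v. frechet_derivative (\<lambda>x. co (inverse p * inv_into V \<psi> x)) (at (\<psi> p))
        (frechet_derivative (\<lambda>x. \<psi> (p * coi x)) (at e1) v))) (at e1)"
  proof (rule has_derivative_transform_within_open)
    show "open (co ` dom1 \<inter> (\<lambda>x. p * coi x) -` V)"
      using smooth_into_preimage_open[OF 1 chart_open(1)[OF V(1)]] .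
  qed (use V in \<open>auto simp: chart_inverse[OF V(1)]\<close>)
  from has_derivative_unique[OF this has_derivative_ident] show ?thesis by meson
qed

lemma has_left_derivative_const: "has_left_derivative (\<lambda>_. g) 0 t S"
  unfolding has_left_derivative_def by simp

lemma has_left_derivative_left_translate:
  assumes "has_left_derivative \<gamma> u t S"
  shows "has_left_derivative (\<lambda>s. g * \<gamma> s) u t S"
proof -
  have "((\<lambda>s. g * \<gamma> s) \<longlongrightarrow> g * \<gamma> t) (at t within S)"
    using assms tendsto_group_mult[OF tendsto_const, of \<gamma> "\<gamma> t" "at t within S" g]
    by (simp add: has_left_derivative_def continuous_within)
  then show ?thesis
    using assms by (simp add: has_left_derivative_def continuous_within mult_group.inverse_distrib_swap mult.assoc)
qed

lemma has_left_derivative_eventually_cong: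
  assumes \<gamma>: "has_left_derivative \<gamma> u t S" and eq: "\<forall>\<^sub>F s in at t within S. \<gamma> s = \<eta> s" "\<gamma> t = \<eta> t"
  shows "has_left_derivative \<eta> u t S"
  unfolding has_left_derivative_def
proof
  have "(\<gamma> \<longlongrightarrow> \<gamma> t) (at t within S)" using \<gamma> by (simp add: has_left_derivative_def continuous_within)
  then have "(\<eta> \<longlongrightarrow> \<gamma> t) (at t within S)" using eq(1) by (rule Lim_transform_eventually)
  then show "continuous (at t within S) \<eta>" by (simp add: continuous_within eq(2))
  have "((\<lambda>s. co (inverse (\<gamma> t) * \<gamma> s)) has_vector_derivative u) (at t within S)"
    using \<gamma> by (simp add: has_left_derivative_def)
  then show "((\<lambda>s. co (inverse (\<eta> t) * \<eta> s)) has_vector_derivative u) (at t within S)"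
  proof (rule has_vector_derivative_eventually_cong)
    show "\<forall>\<^sub>F s in at t within S. co (inverse (\<gamma> t) * \<gamma> s) = co (inverse (\<eta> t) * \<eta> s)"
      using eq(1) by eventually_elim (simp add: eq(2))
  qed (simp add: eq(2))
qed

lemma has_left_derivative_cong:
  assumes "has_left_derivative \<gamma> u t S" "\<And>s. s \<in> S \<Longrightarrow> \<gamma> s = \<eta> s" "t \<in> S"
  shows "has_left_derivative \<eta> u t S"
  by (rule has_left_derivative_eventually_cong[OF assms(1)])
    (use assms(2,3) in \<open>auto simp: eventually_at_filter\<close>)

lemma has_left_derivative_compose:
  fixes h :: "'a::euclidean_space \<Rightarrow> 'g"
  assumes h: "smooth_into A h S0" and k: "(k has_vector_derivative k') (at t within S)" "k t \<in> S0"
  shows "\<exists>u. has_left_derivative (\<lambda>s. h (k s)) u t S"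
proof -
  have "smooth_into A (\<lambda>y. inverse (h (k t)) * h y) S0"
    by (intro smooth_into_mult smooth_into_const h smooth_into_open[OF h])
  from smooth_into_coord_has_derivative[OF this k(2) dom1_chart]
  have "((\<lambda>y. co (inverse (h (k t)) * h y)) has_derivative
      frechet_derivative (\<lambda>y. co (inverse (h (k t)) * h y)) (at (k t))) (at (k t))" by simp
  from has_vector_derivative_chain[OF k(1) this]
  have "((\<lambda>s. co (inverse (h (k t)) * h (k s))) has_vector_derivative
      frechet_derivative (\<lambda>y. co (inverse (h (k t)) * h y)) (at (k t)) k') (at t within S)" .
  moreover have "continuous (at t within S) (\<lambda>s. h (k s))"
  proof -
    have "isCont h (k t)"
      using smooth_into_continuous[OF h] k(2) smooth_into_open[OF h] continuous_on_eq_continuous_at by blast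
    moreover have "continuous (at t within S) k" using k(1) by (rule has_vector_derivative_continuous)
    ultimately show ?thesis by (rule continuous_within_compose3)
  qed
  ultimately show ?thesis unfolding has_left_derivative_def by blast
qed

lemma conjugate_product_smooth_into:
  "smooth_into A (\<lambda>p. inverse b * coi (fst p) * b * coi (snd p)) (co ` dom1 \<times> co ` dom1)"
  by (intro smooth_into_mult smooth_into_const smooth_into_coi_compose open_Times open_co_dom1
      smooth_on_bounded_linear bounded_linear_fst bounded_linear_snd) auto

lemma Ad_has_derivative: "((\<lambda>x. co (g * coi x * inverse g)) has_derivative Ad g) (at e1)"
proof -
  have "smooth_into A (\<lambda>x. g * coi x * inverse g) (co ` dom1)"
    by (intro smooth_into_mult smooth_into_const smooth_into_coi) auto
  from smooth_into_coord_has_derivative[OF this e1_mem dom1_chart] show ?thesis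
    unfolding Ad_def by simp
qed

lemma Ad_linear: "linear (Ad g)"
  using has_derivative_linear[OF Ad_has_derivative] .

text \<open>The partial derivatives at the identity: with \<open>snd p\<close> fixed the map is a conjugation, with \<open>fst p\<close>
  fixed it is the identity.\<close>

lemma conjugate_product_has_derivative:
  "((\<lambda>p. co (inverse b * coi (fst p) * b * coi (snd p))) has_derivative
     (\<lambda>p. Ad (inverse b) (fst p) + snd p)) (at (e1, e1))"
proof -
  define M where "M p = co (inverse b * coi (fst p) * b * coi (snd p))" for p
  have "\<exists>M'. (M has_derivative M') (at (e1, e1))"
    unfolding M_def
    using smooth_into_coord_has_derivative[OF conjugate_product_smooth_into[of b], of "(e1, e1)", OF _ dom1_chart]
    by (intro exI) simp
  then obtain M' where M': "(M has_derivative M') (at (e1, e1))" by blast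
  have "((\<lambda>x. M (x, e1)) has_derivative (\<lambda>u. M' (u, 0))) (at e1)"
    by (rule has_derivative_compose[where g=M and f="\<lambda>x. (x, e1)", OF _ M']) (auto intro!: derivative_eq_intros)
  moreover have "(\<lambda>x. M (x, e1)) = (\<lambda>x. co (inverse b * coi x * inverse (inverse b)))" by (simp add: M_def)
  ultimately have 1: "M' (u, 0) = Ad (inverse b) u" for u
    using has_derivative_unique[OF Ad_has_derivative, of "inverse b" "\<lambda>u. M' (u, 0)"] by (metis (no_types))
  have "((\<lambda>y. M (e1, y)) has_derivative (\<lambda>w. M' (0, w))) (at e1)"
    by (rule has_derivative_compose[where g=M and f="\<lambda>y. (e1, y)", OF _ M']) (auto intro!: derivative_eq_intros)
  then have "((\<lambda>y. y) has_derivative (\<lambda>w. M' (0, w))) (at e1)"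
    by (rule has_derivative_transform_within_open[where s="co ` dom1"]) (auto simp: M_def)
  from has_derivative_unique[OF this has_derivative_ident] have 2: "M' (0, w) = w" for w by metis
  have "M' p = Ad (inverse b) (fst p) + snd p" for p
  proof -
    have "M' p = M' ((fst p, 0) + (0, snd p))" by simp
    also have "\<dots> = M' (fst p, 0) + M' (0, snd p)" using has_derivative_linear[OF M'] by (rule linear_add)
    finally show ?thesis by (simp add: 1 2)
  qed
  then have "M' = (\<lambda>p. Ad (inverse b) (fst p) + snd p)" by blast
  with M' show ?thesis unfolding M_def by simp
qed

text \<open>The product rule: \<open>(\<alpha> \<beta>)\<^sup>-\<^sup>1 (t) (\<alpha> \<beta>) (s)\<close> is \<open>\<beta> (t)\<^sup>-\<^sup>1 [\<alpha> (t)\<^sup>-\<^sup>1 \<alpha> (s)] \<beta> (t) [\<beta> (t)\<^sup>-\<^sup>1 \<beta> (s)]\<close>.\<close>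

lemma has_left_derivative_mult:
  assumes \<alpha>: "has_left_derivative \<alpha> u t S" and \<beta>: "has_left_derivative \<beta> w t S"
  shows "has_left_derivative (\<lambda>s. \<alpha> s * \<beta> s) (Ad (inverse (\<beta> t)) u + w) t S"
  unfolding has_left_derivative_def
proof
  show "continuous (at t within S) (\<lambda>s. \<alpha> s * \<beta> s)"
    using \<alpha> \<beta> unfolding has_left_derivative_def continuous_within by (auto intro: tendsto_group_mult)
  define k where "k s = (co (inverse (\<alpha> t) * \<alpha> s), co (inverse (\<beta> t) * \<beta> s))" for s
  have "(k has_vector_derivative (u, w)) (at t within S)"
    using \<alpha> \<beta> unfolding has_left_derivative_def k_def[abs_def]
    by (auto simp: has_vector_derivative_def intro!: has_derivative_Pair[THEN has_derivative_eq_rhs])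
  moreover have "k t = (e1, e1)" by (simp add: k_def co_one)
  ultimately have "((\<lambda>s. co (inverse (\<beta> t) * coi (fst (k s)) * \<beta> t * coi (snd (k s)))) has_vector_derivative
      (Ad (inverse (\<beta> t)) (fst (u, w)) + snd (u, w))) (at t within S)"
    using has_vector_derivative_chain[of k "(u, w)" t S, OF _ conjugate_product_has_derivative[of "\<beta> t", folded \<open>k t = (e1, e1)\<close>]]
    by simp
  then show "((\<lambda>s. co (inverse (\<alpha> t * \<beta> t) * (\<alpha> s * \<beta> s))) has_vector_derivative
      (Ad (inverse (\<beta> t)) u + w)) (at t within S)"
    unfolding fst_conv snd_conv
  proof (rule has_vector_derivative_eventually_cong)
    show "\<forall>\<^sub>F s in at t within S. co (inverse (\<beta> t) * coi (fst (k s)) * \<beta> t * coi (snd (k s))) =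
        co (inverse (\<alpha> t * \<beta> t) * (\<alpha> s * \<beta> s))"
      using has_left_derivative_local_coordinates[OF \<alpha>] has_left_derivative_local_coordinates[OF \<beta>]
      by eventually_elim (simp add: k_def mult_group.inverse_distrib_swap mult.assoc)
    show "co (inverse (\<beta> t) * coi (fst (k t)) * \<beta> t * coi (snd (k t))) =
        co (inverse (\<alpha> t * \<beta> t) * (\<alpha> t * \<beta> t))"
      by (simp add: k_def mult_group.inverse_distrib_swap mult.assoc)
  qed
qed

lemma Ad_one: "Ad 1 v = v"
proof -
  have "((\<lambda>x. x) has_derivative Ad 1) (at e1)"
    by (rule has_derivative_transform_within_open[OF Ad_has_derivative, where s="co ` dom1"]) auto
  from has_derivative_unique[OF this has_derivative_ident] show ?thesis by metis
qed

lemma Ad_mult: "Ad (g * k) v = Ad g (Ad k v)"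
proof -
  have h: "smooth_into A (\<lambda>x. k * coi x * inverse k) (co ` dom1)"
    by (intro smooth_into_mult smooth_into_const smooth_into_coi) auto
  have "co (k * coi e1 * inverse k) = e1" by (simp add: co_one)
  then have "((\<lambda>x. co (g * coi (co (k * coi x * inverse k)) * inverse g)) has_derivative (\<lambda>v. Ad g (Ad k v))) (at e1)"
    using has_derivative_compose[OF Ad_has_derivative, of "\<lambda>x. co (g * coi x * inverse g)" "Ad g" k] Ad_has_derivative
    by simp
  then have "((\<lambda>x. co (g * k * coi x * inverse (g * k))) has_derivative (\<lambda>v. Ad g (Ad k v))) (at e1)"
  proof (rule has_derivative_transform_within_open)
    show "open (co ` dom1 \<inter> (\<lambda>x. k * coi x * inverse k) -` dom1)"
      by (rule smooth_into_preimage_open[OF h open_dom1])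
  qed (auto simp: mult_group.inverse_distrib_swap mult.assoc)
  from has_derivative_unique[OF Ad_has_derivative this] show ?thesis by metis
qed

lemma Ad_inverse_cancel: "Ad g (Ad (inverse g) v) = v"
  using Ad_mult[of g "inverse g" v] by (simp add: Ad_one)

lemma has_left_derivative_trivial_limit:
  assumes "at t within S = bot"
  shows "has_left_derivative \<gamma> u t S"
  using assms unfolding has_left_derivative_def has_vector_derivative_def has_derivative_def continuous_within
  by (simp add: bounded_linear_scaleR_left)

text \<open>Smoothness of the inversion provides some left derivative; differentiating the constant
  \<open>\<beta>\<^sup>-\<^sup>1 \<beta>\<close> by the product rule determines it.\<close>

lemma has_left_derivative_inverse:
  assumes \<beta>: "has_left_derivative \<beta> w t S"
  shows "has_left_derivative (\<lambda>s. inverse (\<beta> s)) (- Ad (\<beta> t) w) t S"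
proof (cases "at t within S = bot")
  case True
  then show ?thesis by (rule has_left_derivative_trivial_limit)
next
  case False
  define k where "k s = co (inverse (\<beta> t) * \<beta> s)" for s
  have k: "(k has_vector_derivative w) (at t within S)"
    using \<beta> unfolding has_left_derivative_def k_def[abs_def] by simp
  have "smooth_into A (\<lambda>x. inverse (\<beta> t * coi x)) (co ` dom1)"
    by (intro smooth_into_mult smooth_into_const smooth_into_coi smooth_into_inverse) auto
  from has_left_derivative_compose[OF this k] obtain u
    where u: "has_left_derivative (\<lambda>s. inverse (\<beta> t * coi (k s))) u t S" by (auto simp: k_def co_one)
  have inv: "has_left_derivative (\<lambda>s. inverse (\<beta> s)) u t S"
    by (rule has_left_derivative_eventually_cong[OF u])
      (use has_left_derivative_local_coordinates[OF \<beta>] in \<open>auto simp: k_def co_one elim: eventually_mono\<close>)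
  from has_left_derivative_mult[OF inv \<beta>]
  have "((\<lambda>s. e1) has_vector_derivative Ad (inverse (\<beta> t)) u + w) (at t within S)"
    by (simp add: has_left_derivative_def co_one)
  from vector_derivative_unique_within[OF False this has_vector_derivative_const]
  have "Ad (inverse (\<beta> t)) u = - w" by (simp add: eq_neg_iff_add_eq_0)
  then have "u = Ad (\<beta> t) (- w)" using Ad_inverse_cancel[of "\<beta> t" u] by simp
  also have "\<dots> = - Ad (\<beta> t) w" by (rule linear_neg[OF Ad_linear])
  finally show ?thesis using inv by simp
qed

text \<open>Near each point the curve stays in a translate of \<open>dom1\<close>, where its coordinates have derivative
  zero; locally constant curves on an interval are constant.\<close>

lemma has_left_derivative_zero_constant:
  assumes S: "convex S" and z: "\<And>t. t \<in> S \<Longrightarrow> has_left_derivative \<gamma> 0 t S" and st: "s \<in> S" "t \<in> S"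
  shows "\<gamma> s = \<gamma> t"
proof -
  have "\<gamma> constant_on S"
  proof (rule locally_constant_imp_constant)
    show "connected S" using S by (rule convex_connected)
    fix a assume a: "a \<in> S"
    have "\<forall>\<^sub>F s in at a within S. inverse (\<gamma> a) * \<gamma> s \<in> dom1"
      using z[OF a] by (intro eventually_left_translate_mem) (auto simp: has_left_derivative_def)
    then obtain d where d: "d > 0" "\<And>s. s \<in> S \<Longrightarrow> s \<noteq> a \<Longrightarrow> dist s a < d \<Longrightarrow> inverse (\<gamma> a) * \<gamma> s \<in> dom1"
      unfolding eventually_at by blast
    define T where "T = S \<inter> ball a d"
    have T: "inverse (\<gamma> a) * \<gamma> s \<in> dom1" if "s \<in> T" for s
      using d(2)[of s] that by (cases "s = a") (auto simp: T_def dist_commute)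
    have "((\<lambda>s. co (inverse (\<gamma> a) * \<gamma> s)) has_vector_derivative 0) (at t within T)" if t: "t \<in> T" for t
    proof -
      have "linear (frechet_derivative (\<lambda>x. co (inverse (\<gamma> a) * \<gamma> t * coi x)) (at e1))"
      proof -
        have "smooth_into A (\<lambda>x. inverse (\<gamma> a) * \<gamma> t * coi x) (co ` dom1)"
          by (intro smooth_into_mult smooth_into_const smooth_into_coi) auto
        from smooth_into_coord_has_derivative[OF this e1_mem dom1_chart] T[OF t]
        show ?thesis by (intro has_derivative_linear) simp
      qed
      then have "frechet_derivative (\<lambda>x. co (inverse (\<gamma> a) * \<gamma> t * coi x)) (at e1) 0 = 0" by (rule linear_0)
      with has_left_derivative_chart[OF z dom1_chart T[OF t]] t
      have "((\<lambda>s. co (inverse (\<gamma> a) * \<gamma> s)) has_vector_derivative 0) (at t within S)" by (simp add: T_def)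
      then show ?thesis by (rule has_vector_derivative_within_subset) (simp add: T_def)
    qed
    moreover have "convex T" unfolding T_def using S by (intro convex_Int) auto
    ultimately obtain c where c: "\<And>s. s \<in> T \<Longrightarrow> co (inverse (\<gamma> a) * \<gamma> s) = c"
      using has_vector_derivative_zero_constant[of T "\<lambda>s. co (inverse (\<gamma> a) * \<gamma> s)"] by blast
    have aT: "a \<in> T" using a d by (simp add: T_def)
    have "\<gamma> s = \<gamma> a" if s: "s \<in> T" for s
    proof -
      have "co (inverse (\<gamma> a) * \<gamma> s) = co 1" using c[OF s] c[OF aT] by simp
      then have "inverse (\<gamma> a) * \<gamma> s = 1" using coi_co[OF T[OF s]] by (simp add: co_one)
      then show ?thesis using mult_inverse_cancel_left(1)[of "\<gamma> a" "\<gamma> s"] by simp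
    qed
    then show "\<exists>T. openin (top_of_set S) T \<and> a \<in> T \<and> (\<forall>x\<in>T. \<gamma> x = \<gamma> a)"
    proof (intro exI[of _ T] conjI ballI aT)
      show "openin (top_of_set S) T" unfolding T_def by (intro openin_open_Int open_ball)
    qed
  qed
  then show ?thesis using st unfolding constant_on_def by auto
qed

text \<open>Two curves with equal left derivatives differ by a left translation, since the left derivative
  of \<open>\<alpha> \<beta>\<^sup>-\<^sup>1\<close> vanishes.\<close>

lemma curve_determined_by_left_derivative:
  assumes S: "convex S" and \<alpha>: "\<And>t. t \<in> S \<Longrightarrow> has_left_derivative \<alpha> (v t) t S"
    and \<beta>: "\<And>t. t \<in> S \<Longrightarrow> has_left_derivative \<beta> (v t) t S"
    and "t0 \<in> S" "\<alpha> t0 = \<beta> t0" "t \<in> S"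
  shows "\<alpha> t = \<beta> t"
proof -
  have "has_left_derivative (\<lambda>s. \<alpha> s * inverse (\<beta> s)) 0 t S" if "t \<in> S" for t
    using has_left_derivative_mult[OF \<alpha> has_left_derivative_inverse[OF \<beta>], OF that that] by simp
  from has_left_derivative_zero_constant[OF S this \<open>t \<in> S\<close> \<open>t0 \<in> S\<close>]
  have "\<alpha> t * inverse (\<beta> t) = 1" using assms(5) by simp
  then have "\<alpha> t * inverse (\<beta> t) * \<beta> t = \<beta> t" by simp
  then show ?thesis by (simp only: mult.assoc mult_group.left_inverse mult_1_right)
qed

section \<open>One-parameter subgroups\<close>

text \<open>A form of \<open>one_param_subgroup\<close> that asks for a derivative at every time instead of smoothness; it
  is easier to establish and turns out to be equivalent.\<close>

definition one_param :: "'e \<Rightarrow> (real \<Rightarrow> 'g) \<Rightarrow> bool" where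
  "one_param v E \<longleftrightarrow> (\<forall>s t. E (s + t) = E s * E t) \<and> (\<forall>t. has_left_derivative E v t UNIV)"

lemma additive_imp_zero:
  assumes "\<And>s t. E (s + t) = E s * E t"
  shows "E (0::real) = (1::'g)"
proof -
  have "E 0 * E 0 = E 0 * 1" using assms[of 0 0] by simp
  then show ?thesis by (simp only: mult_group.left_cancel)
qed

lemma additive_imp_diff:
  assumes "\<And>s t. E (s + t) = E s * E t"
  shows "inverse (E t) * E s = (E (s - t :: real) :: 'g)"
  using assms[of t "s - t"] by simp

lemma one_paramI:
  assumes hom: "\<And>s t. E (s + t) = E s * E t" and d: "has_left_derivative E v 0 UNIV"
  shows "one_param v E"
  unfolding one_param_def
proof (intro conjI allI hom)
  fix t
  note z = additive_imp_zero[of E, OF hom] and diff = additive_imp_diff[of E, OF hom]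
  have d': "((\<lambda>s. co (E s)) has_vector_derivative v) (at 0)" "(E \<longlongrightarrow> 1) (at 0)"
    using d by (simp_all add: has_left_derivative_def z continuous_at)
  have "((\<lambda>s. s - t) has_vector_derivative 1) (at t)"
    by (auto intro!: derivative_eq_intros)
  from vector_diff_chain_at[OF this, of "\<lambda>s. co (E s)" v] d'(1)
  have "((\<lambda>s. co (E (s - t))) has_vector_derivative 1 *\<^sub>R v) (at t)"
    by (simp add: o_def)
  moreover have "E \<midarrow>t\<rightarrow> E t"
  proof -
    have "((\<lambda>h. E t * E h) \<longlongrightarrow> E t * 1) (at 0)" by (intro tendsto_group_mult tendsto_const d'(2))
    then have "((\<lambda>h. E (t + h)) \<longlongrightarrow> E t) (at 0)" by (simp add: hom)
    then show ?thesis by (rule LIM_offset_zero_cancel)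
  qed
  ultimately show "has_left_derivative E v t UNIV"
    by (simp add: has_left_derivative_def diff continuous_at)
qed

lemma one_param_unique:
  assumes "one_param v E" "one_param v E'"
  shows "E = E'"
proof
  fix t
  show "E t = E' t"
  proof (rule curve_determined_by_left_derivative[of UNIV E "\<lambda>_. v" E' 0])
    have "E 0 = 1" using assms(1) by (intro additive_imp_zero) (simp add: one_param_def)
    moreover have "E' 0 = 1" using assms(2) by (intro additive_imp_zero) (simp add: one_param_def)
    ultimately show "E 0 = E' 0" by simp
  qed (use assms in \<open>simp_all add: one_param_def\<close>)
qed

text \<open>In a chart the left-invariant field generated by \<open>v\<close> is smooth.\<close>

lemma left_invariant_field_smooth:
  assumes V: "(V, \<psi>) \<in> A"
  shows "smooth_on (\<lambda>y. frechet_derivative (\<lambda>x. \<psi> (inv_into V \<psi> y * coi x)) (at e1) v) (\<psi> ` V)"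
proof -
  define h where "h = (\<lambda>p. inv_into V \<psi> (fst p) * coi (snd p))"
  define m where "m p = \<psi> (h p)" for p
  have h: "smooth_into A h (\<psi> ` V \<times> co ` dom1)"
    unfolding h_def
    by (intro smooth_into_mult smooth_into_coi_compose smooth_into_compose[OF smooth_into_chart_inverse[OF V]]
        open_Times chart_open(2)[OF V] open_co_dom1 smooth_on_bounded_linear bounded_linear_fst bounded_linear_snd) auto
  define S where "S = (\<psi> ` V \<times> co ` dom1) \<inter> h -` V"
  have m: "smooth_on m S" unfolding m_def S_def by (rule smooth_into_coordinates[OF h V])
  have mem: "(y, e1) \<in> S" if "y \<in> \<psi> ` V" for y
    using that by (auto simp: S_def h_def chart_inverse[OF V])
  have "smooth_on (\<lambda>y. frechet_derivative m (at (y, e1)) (0, v)) (\<psi> ` V)"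
    by (rule smooth_on_compose[OF chart_open(2)[OF V] smooth_on_frechet_derivative[OF m]])
      (auto intro!: smooth_on_Pair smooth_on_ident smooth_on_const chart_open(2)[OF V] mem)
  then show ?thesis
  proof (rule smooth_on_cong[OF _ chart_open(2)[OF V]])
    fix y assume y: "y \<in> \<psi> ` V"
    have "((\<lambda>x. m (y, x)) has_derivative (\<lambda>v. frechet_derivative m (at (y, e1)) (0, v))) (at e1)"
      by (rule has_derivative_compose[where g=m and f="\<lambda>x. (y, x)", OF _ smooth_on_has_derivative[OF m mem[OF y]]])
        (auto intro!: derivative_eq_intros)
    from fun_cong[OF frechet_derivative_at[OF this], of v]
    show "frechet_derivative m (at (y, e1)) (0, v) =
        frechet_derivative (\<lambda>x. \<psi> (inv_into V \<psi> y * coi x)) (at e1) v"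
      by (simp add: m_def h_def)
  qed
qed

text \<open>The integral curve through the identity of that field, by Picard's theorem.\<close>

lemma local_one_param:
  obtains a E where "a > 0" "E 0 = 1" "\<And>t. t \<in> {-a..a} \<Longrightarrow> has_left_derivative E v t {-a..a}"
proof -
  define F where "F y = frechet_derivative (\<lambda>x. co (coi y * coi x)) (at e1) v" for y
  have F: "smooth_on F (co ` dom1)"
    using left_invariant_field_smooth[OF dom1_chart, of v] unfolding F_def coi_eq .
  obtain r L where rL: "r > 0" "L > 0" "cball e1 r \<subseteq> co ` dom1"
    "\<And>x y. x \<in> cball e1 r \<Longrightarrow> y \<in> cball e1 r \<Longrightarrow> dist (F x) (F y) \<le> L * dist x y"
    by (rule smooth_on_locally_lipschitz[OF F open_co_dom1 e1_mem]) blast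
  obtain a x where ax: "a > 0" "x 0 = e1" "\<And>t. t \<in> {-a..a} \<Longrightarrow> x t \<in> cball e1 r"
    "\<And>t. t \<in> {-a..a} \<Longrightarrow> (x has_vector_derivative F (x t)) (at t within {-a..a})"
    using picard_local_solution[of r L e1 F, OF rL(1,2) rL(4)] by blast
  have xd: "x t \<in> co ` dom1" if "t \<in> {-a..a}" for t using ax(3)[OF that] rL(3) by blast
  have "has_left_derivative (\<lambda>t. coi (x t)) v t {-a..a}" if t: "t \<in> {-a..a}" for t
  proof -
    have c: "continuous (at t within {-a..a}) (\<lambda>t. coi (x t))"
    proof -
      have "isCont coi (x t)"
        using smooth_into_continuous[OF smooth_into_coi] xd[OF t] continuous_on_eq_continuous_at[OF open_co_dom1] by blast
      moreover have "continuous (at t within {-a..a}) x"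
        using ax(4)[OF t] by (rule has_vector_derivative_continuous)
      ultimately show ?thesis by (rule continuous_within_compose3)
    qed
    have "((\<lambda>s. co (coi (x s))) has_vector_derivative F (x t)) (at t within {-a..a})"
      by (rule has_vector_derivative_transform[OF t _ ax(4)[OF t]]) (simp add: xd)
    from has_left_derivative_of_chart[OF c dom1_chart coi_mem[OF xd[OF t]] this]
      translation_derivatives_inverse[OF dom1_chart coi_mem[OF xd[OF t]], of v]
    show ?thesis by (simp add: F_def)
  qed
  then show ?thesis using that[of a "\<lambda>t. coi (x t)"] ax(1,2) by simp
qed

lemma power_mult_commuting:
  assumes "x * y = y * x"
  shows "(x * y) ^ n = x ^ n * (y ^ n :: 'g)"
proof (induction n)
  case (Suc n)
  have c: "y * x ^ n = x ^ n * y" using power_commuting_commutes[OF assms, of n] by simp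
  have "(x * y) ^ Suc n = x * (y * x ^ n) * y ^ n" by (simp add: Suc mult.assoc)
  also have "\<dots> = x ^ Suc n * y ^ Suc n" unfolding c by (simp add: mult.assoc)
  finally show ?case .
qed simp

text \<open>A local one-parameter group \<open>E\<close> on \<open>[-b, b]\<close> extends to \<open>\<real>\<close> by \<open>t \<mapsto> E (t / n)\<^sup>n\<close>, where \<open>n\<close> is
  any integer with \<open>\<bar>t\<bar> / n \<le> b\<close>; the value does not depend on the choice because two of them have
  a common multiple.\<close>

lemma extend_local_one_param:
  fixes E :: "real \<Rightarrow> 'g"
  assumes "b > 0" and E: "\<And>s t. \<bar>s\<bar> \<le> b \<Longrightarrow> \<bar>t\<bar> \<le> b \<Longrightarrow> E (s + t) = E s * E t"
  obtains E' where "\<And>s t. E' (s + t) = E' s * E' t" "\<And>t. \<bar>t\<bar> \<le> b \<Longrightarrow> E' t = E t"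
proof -
  have E0: "E 0 = 1"
  proof -
    have "E 0 * E 0 = E 0 * 1" using E[of 0 0] \<open>b > 0\<close> by simp
    then show ?thesis by (simp only: mult_group.left_cancel)
  qed
  have pow: "E (real k * t) = E t ^ k" if "\<bar>real k * t\<bar> \<le> b" for k t
    using that
  proof (induction k)
    case (Suc k)
    have k: "\<bar>real k * t\<bar> \<le> b" "\<bar>t\<bar> \<le> b"
    proof -
      have "real k * \<bar>t\<bar> \<le> real (Suc k) * \<bar>t\<bar>" "1 * \<bar>t\<bar> \<le> real (Suc k) * \<bar>t\<bar>" by (intro mult_right_mono; simp)+
      then show "\<bar>real k * t\<bar> \<le> b" "\<bar>t\<bar> \<le> b" using Suc.prems by (simp_all add: abs_mult)
    qed
    have "E (t + real k * t) = E t * E (real k * t)" using E k by blast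
    then show ?case using Suc.IH[OF k(1)] by (simp add: algebra_simps)
  qed (simp add: E0)
  have indep: "E (t / real n) ^ n = E (t / real m) ^ m"
    if "n > 0" "m > 0" "\<bar>t\<bar> / real n \<le> b" "\<bar>t\<bar> / real m \<le> b" for n m :: nat and t
  proof -
    have "E (t / real n) = E (t / real (n * m)) ^ m"
      using pow[of m "t / real (n * m)"] that by simp
    moreover have "E (t / real m) = E (t / real (n * m)) ^ n"
      using pow[of n "t / real (n * m)"] that by simp
    ultimately show ?thesis by (simp add: power_mult[symmetric] mult.commute)
  qed
  define N where "N t = nat \<lceil>\<bar>t\<bar> / b\<rceil> + 1" for t
  have big: "\<bar>t\<bar> / real n \<le> b" if "n \<ge> N t" for n t
  proof -
    have "\<bar>t\<bar> / b \<le> real (N t)" unfolding N_def by linarith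
    also have "\<dots> \<le> real n" using that by simp
    finally have "\<bar>t\<bar> \<le> real n * b" using \<open>b > 0\<close> by (simp add: pos_divide_le_eq)
    moreover have "n > 0" using that by (simp add: N_def)
    ultimately show ?thesis by (simp add: pos_divide_le_eq mult.commute)
  qed
  define E' where "E' t = E (t / real (N t)) ^ N t" for t
  have E': "E' t = E (t / real n) ^ n" if "n > 0" "\<bar>t\<bar> / real n \<le> b" for n t
    unfolding E'_def by (rule indep[OF _ that(1) big[OF order_refl] that(2)]) (simp add: N_def)
  have "E' (s + t) = E' s * E' t" for s t
  proof -
    define n where "n = N s + N t + N (s + t)"
    have "N s \<le> n" "N t \<le> n" "N (s + t) \<le> n" by (simp_all add: n_def)
    then have n: "\<bar>s\<bar> / real n \<le> b" "\<bar>t\<bar> / real n \<le> b" "\<bar>s + t\<bar> / real n \<le> b"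
      using big by blast+
    have n0: "n > 0" by (simp add: n_def N_def)
    have *: "E (s / real n + t / real n) = E (s / real n) * E (t / real n)"
      "E (t / real n + s / real n) = E (t / real n) * E (s / real n)"
      using n by (auto intro!: E)
    then have c: "E (s / real n) * E (t / real n) = E (t / real n) * E (s / real n)"
      by (simp add: add.commute)
    have "E' (s + t) = E (s / real n + t / real n) ^ n"
      using E'[OF n0 n(3)] by (simp add: add_divide_distrib)
    also have "\<dots> = E' s * E' t"
      using E'[OF n0 n(1)] E'[OF n0 n(2)] power_mult_commuting[OF c] * by simp
    finally show ?thesis .
  qed
  moreover have "E' t = E t" if "\<bar>t\<bar> \<le> b" for t using E'[of 1 t] that by simp
  ultimately show ?thesis using that by blast
qed

text \<open>The local integral curve \<open>E\<close> is a local homomorphism because \<open>t \<mapsto> E (s + t)\<close> and \<open>t \<mapsto> E s * E t\<close>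
  have the same left derivative.\<close>

lemma one_param_exists: "\<exists>E. one_param v E"
proof -
  obtain a E where a: "a > 0" "E 0 = 1" and E: "\<And>t. t \<in> {-a..a} \<Longrightarrow> has_left_derivative E v t {-a..a}"
    by (rule local_one_param[of v]) blast
  define b where "b = a / 2"
  have b: "b > 0" using a by (simp add: b_def)
  have hom: "E (s + t) = E s * E t" if s: "\<bar>s\<bar> \<le> b" and t: "\<bar>t\<bar> \<le> b" for s t
  proof (rule curve_determined_by_left_derivative[of "{-b..b}" "\<lambda>t. E (s + t)" "\<lambda>_. v" "\<lambda>t. E s * E t" 0])
    fix \<tau> assume \<tau>: "\<tau> \<in> {-b..b}"
    have "s + \<tau> \<in> {-a..a}" using s \<tau> by (auto simp: b_def)
    from E[OF this] have d: "((\<lambda>\<sigma>. co (inverse (E (s + \<tau>)) * E \<sigma>)) has_vector_derivative v) (at (s + \<tau>) within {-a..a})"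
      and c: "continuous (at (s + \<tau>) within {-a..a}) E" by (auto simp: has_left_derivative_def)
    have sub: "(\<lambda>\<tau>. s + \<tau>) ` {-b..b} \<subseteq> {-a..a}" using s by (auto simp: b_def)
    have "((\<lambda>\<sigma>. co (inverse (E (s + \<tau>)) * E \<sigma>)) \<circ> (\<lambda>\<tau>. s + \<tau>) has_vector_derivative 1 *\<^sub>R v) (at \<tau> within {-b..b})"
      by (rule vector_diff_chain_within[OF _ has_vector_derivative_within_subset[OF d sub]])
        (auto intro!: derivative_eq_intros)
    moreover have "continuous (at \<tau> within {-b..b}) (\<lambda>\<tau>. E (s + \<tau>))"
    proof (rule continuous_within_compose2[OF _ continuous_within_subset[OF c sub]])
      show "continuous (at \<tau> within {-b..b}) ((+) s)" by (intro continuous_intros)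
    qed
    ultimately show "has_left_derivative (\<lambda>t. E (s + t)) v \<tau> {-b..b}"
      by (simp add: has_left_derivative_def o_def)
    show "has_left_derivative (\<lambda>t. E s * E t) v \<tau> {-b..b}"
      using \<tau> b by (intro has_left_derivative_left_translate has_left_derivative_subset[OF E]) (auto simp: b_def)
  qed (use t b a in auto)
  obtain E' where E': "\<And>s t. E' (s + t) = E' s * E' t" "\<And>t. \<bar>t\<bar> \<le> b \<Longrightarrow> E' t = E t"
    by (rule extend_local_one_param[OF b hom]) blast+
  have "has_left_derivative E' v 0 {-b<..<b}"
    using b a E' by (intro has_left_derivative_cong[OF has_left_derivative_subset[OF E]]) (auto simp: b_def)
  then have "has_left_derivative E' v 0 UNIV"
    using b at_within_open[of 0 "{-b<..<b}"] by (simp add: has_left_derivative_def)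
  then have "one_param v E'" by (rule one_paramI[where E=E', OF E'(1)])
  then show ?thesis by (rule exI[of _ E'])
qed

text \<open>In a chart a one-parameter subgroup is an integral curve of a smooth vector field, and each
  derivative gained for the curve yields one more for its velocity.\<close>

lemma one_param_smooth_into:
  assumes "one_param v E"
  shows "smooth_into A E UNIV"
proof (rule smooth_intoI)
  have E: "has_left_derivative E v t UNIV" for t using assms by (simp add: one_param_def)
  show cont: "continuous_on UNIV E"
    using E by (simp add: has_left_derivative_def continuous_on_eq_continuous_at)
  fix V \<psi> assume V: "(V, \<psi>) \<in> A"
  define T where "T = UNIV \<inter> E -` V"
  have T: "open T" unfolding T_def by (rule continuous_open_preimage[OF cont open_UNIV chart_open(1)[OF V]])
  define F where "F y = frechet_derivative (\<lambda>x. \<psi> (inv_into V \<psi> y * coi x)) (at e1) v" for y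
  have F: "smooth_on F (\<psi> ` V)" unfolding F_def by (rule left_invariant_field_smooth[OF V])
  have d: "((\<lambda>t. \<psi> (E t)) has_derivative (\<lambda>r. r *\<^sub>R F (\<psi> (E t)))) (at t)" if "t \<in> T" for t
    using has_left_derivative_chart[OF E V, of 1 t] that
    by (simp add: T_def F_def chart_inverse[OF V] has_vector_derivative_def)
  have "Ck_on k (\<lambda>t. \<psi> (E t)) T" for k
  proof (induction k)
    case 0
    show ?case using continuous_on_compose2[OF chart_continuous(1)[OF V] continuous_on_subset[OF cont]]
      by (auto simp: T_def)
  next
    case (Suc k)
    have "Ck_on k (\<lambda>t. frechet_derivative (\<lambda>t. \<psi> (E t)) (at t) r) T" for r
    proof -
      have "Ck_on k (\<lambda>t. r *\<^sub>R F (\<psi> (E t))) T"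
        by (intro Ck_on_bounded_linear_compose[OF bounded_linear_scaleR_right T]
            Ck_on_compose[OF T smooth_on_imp_Ck_on[OF F] Suc]) (auto simp: T_def)
      then show ?thesis
        by (rule Ck_on_cong[OF T, rotated]) (simp add: frechet_derivative_at[OF d, symmetric])
    qed
    then show ?case using d by (auto simp: differentiable_def)
  qed
  then show "smooth_on (\<lambda>t. \<psi> (E t)) (UNIV \<inter> E -` V)" unfolding T_def by (rule smooth_onI)
qed simp

lemma one_param_subgroup_iff: "one_param_subgroup A v E \<longleftrightarrow> one_param v E"
proof
  assume E: "one_param_subgroup A v E"
  then have hom: "\<And>s t. E (s + t) = E s * E t"
    and "((co \<circ> E) has_vector_derivative v) (at 0)" "continuous_on UNIV E"
    unfolding one_param_subgroup_def smooth_map_def co_def by auto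
  moreover note additive_imp_zero[of E, OF hom]
  ultimately have "has_left_derivative E v 0 UNIV"
    by (simp add: has_left_derivative_def o_def continuous_on_eq_continuous_at)
  then show "one_param v E" by (rule one_paramI[OF hom])
next
  assume E: "one_param v E"
  then have hom: "\<And>s t. E (s + t) = E s * E t" by (simp add: one_param_def)
  have sm: "smooth_into A E UNIV" by (rule one_param_smooth_into[OF E])
  have inv: "inv_into UNIV (\<lambda>x::real. x) = (\<lambda>x. x)"
    by (rule ext) (metis f_inv_into_f rangeI)
  have "smooth_map real_atlas A E"
    unfolding smooth_map_def real_atlas_def
    using smooth_into_continuous[OF sm] smooth_into_coordinates[OF sm] by (auto simp: inv o_def)
  moreover have "((coord_at A 1 \<circ> E) has_vector_derivative v) (at 0)"
  proof -
    have "has_left_derivative E v 0 UNIV" using E by (simp add: one_param_def)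
    then show ?thesis using additive_imp_zero[of E, OF hom] by (simp add: has_left_derivative_def o_def co_def)
  qed
  ultimately show "one_param_subgroup A v E" using hom by (simp add: one_param_subgroup_def)
qed

lemma has_left_derivative_one_param_compose:
  assumes E: "one_param v E" and c: "(c has_real_derivative c') (at t within S)"
  shows "has_left_derivative (\<lambda>s. E (c s)) (c' *\<^sub>R v) t S"
proof -
  have hom: "\<And>s t. E (s + t) = E s * E t" and d: "has_left_derivative E v 0 UNIV"
    and cont: "isCont E (c t)"
    using E by (auto simp: one_param_def has_left_derivative_def)
  note z = additive_imp_zero[of E, OF hom] and diff = additive_imp_diff[of E, OF hom]
  have "((\<lambda>s. co (E s)) has_derivative (\<lambda>r. r *\<^sub>R v)) (at (c t - c t))"
    using d by (simp add: has_left_derivative_def z has_vector_derivative_def)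
  moreover have "((\<lambda>s. c s - c t) has_vector_derivative c') (at t within S)"
    using c by (auto simp: has_real_derivative_iff_has_vector_derivative intro!: derivative_eq_intros)
  ultimately have "((\<lambda>s. co (E (c s - c t))) has_vector_derivative c' *\<^sub>R v) (at t within S)"
    by (rule has_vector_derivative_chain[rotated])
  moreover have "continuous (at t within S) (\<lambda>s. E (c s))"
    by (rule continuous_within_compose3[where g=E and f=c, OF cont DERIV_continuous[OF c]])
  ultimately show ?thesis by (simp add: has_left_derivative_def diff)
qed

lemma one_param_scale:
  assumes E: "one_param v E"
  shows "one_param (r *\<^sub>R v) (\<lambda>t. E (r * t))"
proof (rule one_paramI)
  show "E (r * (s + t)) = E (r * s) * E (r * t)" for s t
    using E by (simp add: one_param_def distrib_left)
  show "has_left_derivative (\<lambda>t. E (r * t)) (r *\<^sub>R v) 0 UNIV"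
    by (rule has_left_derivative_one_param_compose[OF E]) (auto intro!: derivative_eq_intros)
qed

text \<open>The one-parameter subgroup with velocity \<open>v\<close>.\<close>

definition ep :: "'e \<Rightarrow> real \<Rightarrow> 'g" where "ep v t = lie_exp A (t *\<^sub>R v)"

lemma lie_exp_eq: "one_param v E \<Longrightarrow> lie_exp A v = E 1"
proof -
  assume E: "one_param v E"
  have "(THE \<gamma>. one_param_subgroup A v \<gamma>) = E"
  proof (rule the_equality)
    show "one_param_subgroup A v E" using E by (simp add: one_param_subgroup_iff)
    show "\<gamma> = E" if "one_param_subgroup A v \<gamma>" for \<gamma>
      using that by (intro one_param_unique[OF _ E]) (simp add: one_param_subgroup_iff)
  qed
  then show ?thesis by (simp add: lie_exp_def)
qed

lemma one_param_ep: "one_param v (ep v)"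
proof -
  obtain E where E: "one_param v E" using one_param_exists by blast
  have "ep v t = E t" for t
    using lie_exp_eq[OF one_param_scale[OF E, of t]] by (simp add: ep_def)
  then have "ep v = E" by blast
  with E show ?thesis by simp
qed

lemma ep_add: "ep v (s + t) = ep v s * ep v t"
  using one_param_ep by (simp add: one_param_def)

lemma ep_zero [simp]: "ep v 0 = 1"
  using additive_imp_zero[of "ep v", OF ep_add] .

lemma ep_minus: "ep v (- t) = inverse (ep v t)"
  using additive_imp_diff[of "ep v" t 0, OF ep_add] by simp

lemma lie_exp_zero [simp]: "lie_exp A 0 = 1"
  using ep_zero[of 0] by (simp add: ep_def)

lemma lie_exp_minus: "lie_exp A (- v) = inverse (lie_exp A v)"
  using ep_minus[of v 1] by (simp add: ep_def)

lemma lie_exp_eq_ep: "lie_exp A v = ep v 1"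
  by (simp add: ep_def)

lemma one_param_conjugate: "one_param (Ad g v) (\<lambda>t. g * ep v t * inverse g)"
proof (rule one_paramI)
  show "g * ep v (s + t) * inverse g = g * ep v s * inverse g * (g * ep v t * inverse g)" for s t
    by (simp add: ep_add mult.assoc)
  have "has_left_derivative (\<lambda>t. g * ep v t) v 0 UNIV"
    using one_param_ep by (intro has_left_derivative_left_translate) (simp add: one_param_def)
  from has_left_derivative_mult[OF this has_left_derivative_const[of "inverse g"]]
  show "has_left_derivative (\<lambda>t. g * ep v t * inverse g) (Ad g v) 0 UNIV" by simp
qed

text \<open>Conjugation by \<open>g\<close> turns \<open>ep v\<close> into the one-parameter subgroup with velocity \<open>Ad g v\<close>.\<close>

lemma ep_commute_if_Ad_fixed:
  assumes "Ad g v = v"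
  shows "g * ep v t = ep v t * g"
proof -
  have "(\<lambda>t. g * ep v t * inverse g) = ep v"
    using one_param_conjugate[of g v] one_param_ep[of v] by (intro one_param_unique[of v]) (simp_all add: assms)
  from fun_cong[OF this, of t] have "g * ep v t * inverse g = ep v t" .
  then have "g * ep v t * inverse g * g = ep v t * g" by simp
  then show ?thesis by (simp only: mult.assoc mult_group.left_inverse mult_1_right)
qed

section \<open>The adjoint representation and the Lie bracket\<close>

text \<open>The multiplication in the coordinates at the identity, and the set on which it is defined.\<close>

definition mult_co :: "'e \<times> 'e \<Rightarrow> 'e" where
  "mult_co p = co (coi (fst p) * coi (snd p))"

definition mult_dom :: "('e \<times> 'e) set" where
  "mult_dom = (co ` dom1 \<times> co ` dom1) \<inter> (\<lambda>p. coi (fst p) * coi (snd p)) -` dom1"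

lemma mult_smooth_into: "smooth_into A (\<lambda>p. coi (fst p) * coi (snd p)) (co ` dom1 \<times> co ` dom1)"
  by (intro smooth_into_mult smooth_into_const smooth_into_coi_compose open_Times open_co_dom1
      smooth_on_bounded_linear bounded_linear_fst bounded_linear_snd) auto

lemma open_mult_dom: "open mult_dom"
  unfolding mult_dom_def by (rule smooth_into_preimage_open[OF mult_smooth_into open_dom1])

lemma mult_co_smooth: "smooth_on mult_co mult_dom"
  unfolding mult_dom_def mult_co_def[abs_def]
  by (rule smooth_into_coordinates[OF mult_smooth_into dom1_chart])

lemma mult_dom_mem: "x \<in> co ` dom1 \<Longrightarrow> (x, e1) \<in> mult_dom" "x \<in> co ` dom1 \<Longrightarrow> (e1, x) \<in> mult_dom"
  by (auto simp: mult_dom_def)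

lemma mult_co_derivative:
  "p \<in> mult_dom \<Longrightarrow> (mult_co has_derivative frechet_derivative mult_co (at p)) (at p)"
  by (rule smooth_on_has_derivative[OF mult_co_smooth])

lemma mult_co_derivative_e1: "frechet_derivative mult_co (at (e1, e1)) (v, w) = v + w"
proof -
  have "(mult_co has_derivative (\<lambda>p. fst p + snd p)) (at (e1, e1))"
    using conjugate_product_has_derivative[of 1] unfolding mult_co_def[abs_def] by (simp add: Ad_one)
  from fun_cong[OF frechet_derivative_at[OF this], of "(v, w)"] show ?thesis by simp
qed

text \<open>The mixed second derivative at the identity of the product in coordinates; the Lie bracket is
  its antisymmetrization.\<close>

definition mixed :: "'e \<Rightarrow> 'e \<Rightarrow> 'e" where
  "mixed v w = frechet_derivative (\<lambda>p. frechet_derivative mult_co (at p) (0, w)) (at (e1, e1)) (v, 0)"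

lemma mult_co_second_derivative:
  "((\<lambda>p. frechet_derivative mult_co (at p) u) has_derivative
    frechet_derivative (\<lambda>p. frechet_derivative mult_co (at p) u) (at (e1, e1))) (at (e1, e1))"
  by (rule smooth_on_has_derivative[OF smooth_on_frechet_derivative[OF mult_co_smooth]])
    (simp add: mult_dom_mem)

lemma mixed_linear_left: "linear (\<lambda>v. mixed v w)"
proof -
  have "linear (frechet_derivative (\<lambda>p. frechet_derivative mult_co (at p) (0, w)) (at (e1, e1)))"
    using has_derivative_linear[OF mult_co_second_derivative] .
  moreover have "linear (\<lambda>v::'e. (v, 0::'e))" by (auto intro!: linearI)
  ultimately have "linear (frechet_derivative (\<lambda>p. frechet_derivative mult_co (at p) (0, w)) (at (e1, e1)) \<circ> (\<lambda>v. (v, 0)))"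
    by (rule linear_compose[rotated])
  then show ?thesis by (simp add: mixed_def[abs_def] o_def)
qed

text \<open>The definition of the field at the point with coordinates \<open>x\<close> uses the preferred chart there;
  by the chain rule the change to the chart at the identity cancels it.\<close>

lemma left_inv_field_repr:
  assumes x: "x \<in> co ` dom1"
  shows "vf_repr A 1 (left_inv_field A w) x = frechet_derivative mult_co (at (x, e1)) (0, w)"
proof -
  define p where "p = coi x"
  define V where "V = fst (chart_at A p)"
  define \<psi> where "\<psi> = coord_at A p"
  have V: "(V, \<psi>) \<in> A" "p \<in> V" unfolding V_def \<psi>_def using chart_at_pair chart_at_mem(2) by auto
  have pd: "p \<in> dom1" "co p = x" using x by (simp_all add: p_def)
  have h: "smooth_into A (\<lambda>y. p * coi y) (co ` dom1)"
    by (intro smooth_into_mult smooth_into_const smooth_into_coi) auto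
  from smooth_into_coord_has_derivative[OF h e1_mem V(1)] V(2)
  have d1: "((\<lambda>y. \<psi> (p * coi y)) has_derivative frechet_derivative (\<lambda>y. \<psi> (p * coi y)) (at e1)) (at e1)" by simp
  have "p \<in> V \<inter> dom1" using V pd by simp
  then have px: "\<psi> p \<in> \<psi> ` V \<inter> inv_into V \<psi> -` dom1" using V by (auto simp: chart_inverse[OF V(1)])
  from smooth_into_coord_has_derivative[OF smooth_into_chart_inverse[OF V(1)], of "\<psi> p" dom1 co] px
  have d2: "((\<lambda>y. co (inv_into V \<psi> y)) has_derivative
      frechet_derivative (\<lambda>y. co (inv_into V \<psi> y)) (at (\<psi> p))) (at (\<psi> (p * coi e1)))"
    by (simp add: dom1_chart)
  have "((\<lambda>y. co (inv_into V \<psi> (\<psi> (p * coi y)))) has_derivative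
      (\<lambda>w. frechet_derivative (\<lambda>y. co (inv_into V \<psi> y)) (at (\<psi> p))
        (frechet_derivative (\<lambda>y. \<psi> (p * coi y)) (at e1) w))) (at e1)"
    by (rule has_derivative_compose[OF d1 d2])
  then have "((\<lambda>y. mult_co (x, y)) has_derivative
      (\<lambda>w. frechet_derivative (\<lambda>y. co (inv_into V \<psi> y)) (at (\<psi> p))
        (frechet_derivative (\<lambda>y. \<psi> (p * coi y)) (at e1) w))) (at e1)"
  proof (rule has_derivative_transform_within_open)
    show "open (co ` dom1 \<inter> (\<lambda>y. p * coi y) -` V)"
      by (rule smooth_into_preimage_open[OF h chart_open(1)[OF V(1)]])
  qed (use V in \<open>auto simp: chart_inverse[OF V(1)] mult_co_def p_def\<close>)
  moreover have "((\<lambda>y. mult_co (x, y)) has_derivative (\<lambda>w. frechet_derivative mult_co (at (x, e1)) (0, w))) (at e1)"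
    by (rule has_derivative_compose[where g=mult_co and f="\<lambda>y. (x, y)", OF _ mult_co_derivative[OF mult_dom_mem(1)[OF x]]])
      (auto intro!: derivative_eq_intros)
  ultimately have "(\<lambda>w. frechet_derivative (\<lambda>y. co (inv_into V \<psi> y)) (at (\<psi> p))
        (frechet_derivative (\<lambda>y. \<psi> (p * coi y)) (at e1) w)) = (\<lambda>w. frechet_derivative mult_co (at (x, e1)) (0, w))"
    by (rule has_derivative_unique)
  from fun_cong[OF this, of w]
  have "frechet_derivative (\<lambda>y. co (inv_into V \<psi> y)) (at (\<psi> p))
        (frechet_derivative (\<lambda>y. \<psi> (p * coi y)) (at e1) w) = frechet_derivative mult_co (at (x, e1)) (0, w)" .
  then show ?thesis
    by (simp add: vf_repr_def left_inv_field_def tangent_map_def Let_def o_def e1_def co_def[symmetric]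
        coi_eq[unfolded dom1_def, symmetric] p_def[symmetric] V_def[symmetric] \<psi>_def[symmetric])
qed

lemma lie_bracket_eq_mixed: "lie_bracket A v w = mixed v w - mixed w v"
proof -
  have "frechet_derivative (vf_repr A 1 (left_inv_field A w)) (at e1) v = mixed v w" for v w
  proof -
    have "((\<lambda>x. frechet_derivative mult_co (at (x, e1)) (0, w)) has_derivative (\<lambda>v. mixed v w)) (at e1)"
      unfolding mixed_def
      by (rule has_derivative_compose[where f="\<lambda>x. (x, e1)", OF _ mult_co_second_derivative])
        (auto intro!: derivative_eq_intros)
    then have "(vf_repr A 1 (left_inv_field A w) has_derivative (\<lambda>v. mixed v w)) (at e1)"
      by (rule has_derivative_transform_within_open[OF _ open_co_dom1 e1_mem]) (simp add: left_inv_field_repr)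
    from fun_cong[OF frechet_derivative_at[OF this], of v] show ?thesis by simp
  qed
  then show ?thesis
    by (simp add: lie_bracket_def vf_bracket_def Let_def co_def[symmetric] e1_def[symmetric]
        left_inv_field_repr mult_co_derivative_e1)
qed

lemma lie_bracket_antisym: "lie_bracket A v w = - lie_bracket A w v"
  by (simp add: lie_bracket_eq_mixed)

lemma Ad_ep_differentiable: "\<exists>D. ((\<lambda>t. Ad (ep X t) w) has_vector_derivative D) (at t)"
proof -
  define h where "h = (\<lambda>p::real \<times> 'e. ep X (fst p) * coi (snd p) * inverse (ep X (fst p)))"
  have e: "smooth_into A (\<lambda>p::real \<times> 'e. ep X (fst p)) (UNIV \<times> co ` dom1)"
    by (rule smooth_into_compose[OF one_param_smooth_into[OF one_param_ep]])
      (auto intro!: open_Times smooth_on_bounded_linear bounded_linear_fst)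
  have h: "smooth_into A h (UNIV \<times> co ` dom1)"
    unfolding h_def
    by (intro smooth_into_mult smooth_into_inverse e smooth_into_coi_compose open_Times open_UNIV open_co_dom1
        smooth_on_bounded_linear bounded_linear_snd) auto
  define S where "S = (UNIV \<times> co ` dom1) \<inter> h -` dom1"
  have C: "smooth_on (\<lambda>p. co (h p)) S" unfolding S_def by (rule smooth_into_coordinates[OF h dom1_chart])
  have mem: "(t, e1) \<in> S" for t by (simp add: S_def h_def)
  have "Ad (ep X t) w = frechet_derivative (\<lambda>p. co (h p)) (at (t, e1)) (0, w)" for t
  proof -
    have "((\<lambda>y. co (h (t, y))) has_derivative (\<lambda>w. frechet_derivative (\<lambda>p. co (h p)) (at (t, e1)) (0, w))) (at e1)"
      by (rule has_derivative_compose[where f="\<lambda>y. (t, y)", OF _ smooth_on_has_derivative[OF C mem]])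
        (auto intro!: derivative_eq_intros)
    from has_derivative_unique[OF Ad_has_derivative this[unfolded h_def fst_conv snd_conv]]
    show ?thesis unfolding h_def by (rule fun_cong)
  qed
  moreover have "((\<lambda>t. frechet_derivative (\<lambda>p. co (h p)) (at (t, e1)) (0, w)) has_vector_derivative
      frechet_derivative (\<lambda>p. frechet_derivative (\<lambda>p. co (h p)) (at p) (0, w)) (at (t, e1)) (1, 0)) (at t)"
    by (rule has_vector_derivative_chain[where k="\<lambda>t. (t, e1)", OF _ smooth_on_has_derivative[OF smooth_on_frechet_derivative[OF C] mem]])
      (auto simp: has_vector_derivative_def intro!: derivative_eq_intros)
  ultimately show ?thesis by auto
qed

text \<open>Differentiate \<open>g k = (g k g\<^sup>-\<^sup>1) g\<close>, first in \<open>k\<close> at the identity and then in \<open>g\<close> along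
  \<open>t \<mapsto> ep X t\<close>.  The left-hand side gives \<open>mixed X w\<close> and the right-hand side \<open>mixed w X\<close> plus the
  derivative sought, because second derivatives are symmetric.\<close>

lemma Ad_ep_derivative_0: "((\<lambda>t. Ad (ep X t) w) has_vector_derivative lie_bracket A X w) (at 0)"
proof -
  obtain D where D: "((\<lambda>t. Ad (ep X t) w) has_vector_derivative D) (at 0)"
    using Ad_ep_differentiable by blast
  define \<xi> where "\<xi> t = co (ep X t)" for t
  have \<xi>0: "\<xi> 0 = e1" by (simp add: \<xi>_def co_one)
  have "has_left_derivative (ep X) X 0 UNIV" using one_param_ep by (simp add: one_param_def)
  then have \<xi>': "(\<xi> has_vector_derivative X) (at 0)" and cont: "isCont (ep X) 0"
    by (simp_all add: has_left_derivative_def \<xi>_def[abs_def])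
  define T where "T = {t. ep X t \<in> dom1}"
  have T: "open T" "0 \<in> T"
  proof -
    have "T = ep X -` dom1" by (auto simp: T_def)
    then show "open T"
      using smooth_into_preimage_open[OF one_param_smooth_into[OF one_param_ep[of X]] open_dom1] by simp
  qed (simp add: T_def)
  have id: "frechet_derivative mult_co (at (\<xi> t, e1)) (0, w) =
      (\<Sum>b\<in>Basis. (Ad (ep X t) w \<bullet> b) *\<^sub>R frechet_derivative mult_co (at (e1, \<xi> t)) (b, 0))" if t: "t \<in> T" for t
  proof -
    have xt: "\<xi> t \<in> co ` dom1" "coi (\<xi> t) = ep X t" using t by (auto simp: T_def \<xi>_def)
    have h: "smooth_into A (\<lambda>y. ep X t * coi y * inverse (ep X t)) (co ` dom1)"
      by (intro smooth_into_mult smooth_into_const smooth_into_coi) auto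
    have d: "((\<lambda>y. mult_co (co (ep X t * coi y * inverse (ep X t)), \<xi> t)) has_derivative
        (\<lambda>w. frechet_derivative mult_co (at (e1, \<xi> t)) (Ad (ep X t) w, 0))) (at e1)"
    proof (rule has_derivative_compose[where g=mult_co and f="\<lambda>y. (co (ep X t * coi y * inverse (ep X t)), \<xi> t)"])
      show "((\<lambda>y. (co (ep X t * coi y * inverse (ep X t)), \<xi> t)) has_derivative (\<lambda>w. (Ad (ep X t) w, 0))) (at e1)"
        by (intro has_derivative_Pair Ad_has_derivative has_derivative_const)
      show "(mult_co has_derivative frechet_derivative mult_co (at (e1, \<xi> t)))
          (at (co (ep X t * coi e1 * inverse (ep X t)), \<xi> t))"
        using mult_co_derivative[OF mult_dom_mem(2)[OF xt(1)]] by (simp add: co_one)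
    qed
    have "((\<lambda>y. mult_co (\<xi> t, y)) has_derivative
        (\<lambda>w. frechet_derivative mult_co (at (e1, \<xi> t)) (Ad (ep X t) w, 0))) (at e1)"
    proof (rule has_derivative_transform_within_open[OF d])
      show "open (co ` dom1 \<inter> (\<lambda>y. ep X t * coi y * inverse (ep X t)) -` dom1)"
        by (rule smooth_into_preimage_open[OF h open_dom1])
    qed (auto simp: mult_co_def xt(2) mult.assoc)
    moreover have "((\<lambda>y. mult_co (\<xi> t, y)) has_derivative (\<lambda>w. frechet_derivative mult_co (at (\<xi> t, e1)) (0, w))) (at e1)"
      by (rule has_derivative_compose[where g=mult_co and f="\<lambda>y. (\<xi> t, y)", OF _ mult_co_derivative[OF mult_dom_mem(1)[OF xt(1)]]])
        (auto intro!: derivative_eq_intros)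
    ultimately have "(\<lambda>w. frechet_derivative mult_co (at (e1, \<xi> t)) (Ad (ep X t) w, 0)) =
        (\<lambda>w. frechet_derivative mult_co (at (\<xi> t, e1)) (0, w))" by (rule has_derivative_unique)
    from fun_cong[OF this, of w]
    have "frechet_derivative mult_co (at (\<xi> t, e1)) (0, w) =
        frechet_derivative mult_co (at (e1, \<xi> t)) (Ad (ep X t) w, 0)" by simp
    also have "(Ad (ep X t) w, 0) = (\<Sum>b\<in>Basis. (Ad (ep X t) w \<bullet> b) *\<^sub>R (b, 0::'e))"
      by (simp add: prod_eq_iff fst_sum snd_sum euclidean_representation)
    also have "frechet_derivative mult_co (at (e1, \<xi> t)) \<dots> =
        (\<Sum>b\<in>Basis. (Ad (ep X t) w \<bullet> b) *\<^sub>R frechet_derivative mult_co (at (e1, \<xi> t)) (b, 0))"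
      using has_derivative_linear[OF mult_co_derivative[OF mult_dom_mem(2)[OF xt(1)]]]
      by (simp only: linear_sum linear_cmul)
    finally show ?thesis .
  qed
  have lhs: "((\<lambda>t. frechet_derivative mult_co (at (\<xi> t, e1)) (0, w)) has_vector_derivative mixed X w) (at 0)"
    unfolding mixed_def
    by (rule has_vector_derivative_chain[where k="\<lambda>t. (\<xi> t, e1)"])
      (use \<xi>' mult_co_second_derivative in \<open>auto simp: \<xi>0 intro!: derivative_eq_intros\<close>)
  have R: "((\<lambda>t. frechet_derivative mult_co (at (e1, \<xi> t)) (b, 0)) has_vector_derivative mixed b X) (at 0)" for b
  proof -
    have "((\<lambda>t. frechet_derivative mult_co (at (e1, \<xi> t)) (b, 0)) has_vector_derivative
      frechet_derivative (\<lambda>p. frechet_derivative mult_co (at p) (b, 0)) (at (e1, e1)) (0, X)) (at 0)"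
      by (rule has_vector_derivative_chain[where k="\<lambda>t. (e1, \<xi> t)"])
        (use \<xi>' mult_co_second_derivative in \<open>auto simp: \<xi>0 intro!: derivative_eq_intros\<close>)
    then show ?thesis
      unfolding mixed_def
      using smooth_on_second_derivative_symmetric[OF mult_co_smooth open_mult_dom, of "(e1, e1)" "(b, 0)" "(0, X)"]
      by (simp add: mult_dom_mem)
  qed
  have "((\<lambda>t. \<Sum>b\<in>Basis. (Ad (ep X t) w \<bullet> b) *\<^sub>R frechet_derivative mult_co (at (e1, \<xi> t)) (b, 0))
      has_vector_derivative (\<Sum>b\<in>Basis. (Ad (ep X 0) w \<bullet> b) *\<^sub>R mixed b X +
        (D \<bullet> b) *\<^sub>R frechet_derivative mult_co (at (e1, \<xi> 0)) (b, 0))) (at 0)"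
  proof (intro has_vector_derivative_sum has_vector_derivative_scaleR R)
    fix b :: 'e
    show "((\<lambda>t. Ad (ep X t) w \<bullet> b) has_real_derivative D \<bullet> b) (at 0)"
      using bounded_linear.has_vector_derivative[OF bounded_linear_inner_left D, of b]
      by (simp add: has_real_derivative_iff_has_vector_derivative)
  qed
  moreover have "(\<Sum>b\<in>Basis. (Ad (ep X 0) w \<bullet> b) *\<^sub>R mixed b X +
        (D \<bullet> b) *\<^sub>R frechet_derivative mult_co (at (e1, \<xi> 0)) (b, 0)) = mixed w X + D"
  proof -
    have "(\<Sum>b\<in>Basis. (w \<bullet> b) *\<^sub>R mixed b X) = mixed (\<Sum>b\<in>Basis. (w \<bullet> b) *\<^sub>R b) X"
      by (simp only: linear_sum[OF mixed_linear_left] linear_cmul[OF mixed_linear_left])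
    then show ?thesis
      by (simp add: \<xi>0 Ad_one mult_co_derivative_e1 sum.distrib euclidean_representation)
  qed
  ultimately have "((\<lambda>t. \<Sum>b\<in>Basis. (Ad (ep X t) w \<bullet> b) *\<^sub>R frechet_derivative mult_co (at (e1, \<xi> t)) (b, 0))
      has_vector_derivative mixed w X + D) (at 0)" by simp
  then have "((\<lambda>t. frechet_derivative mult_co (at (\<xi> t, e1)) (0, w)) has_vector_derivative mixed w X + D) (at 0)"
    by (rule has_vector_derivative_transform_within_open[OF _ T]) (simp add: id)
  from vector_derivative_unique_at[OF lhs this]
  have "D = lie_bracket A X w" by (simp add: lie_bracket_eq_mixed algebra_simps)
  with D show ?thesis by simp
qed

text \<open>Since \<open>Ad\<close> is a homomorphism, its derivative along \<open>ep X\<close> at \<open>0\<close> determines it at all times.\<close>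

lemma Ad_ep_derivative: "((\<lambda>t. Ad (ep X t) w) has_vector_derivative Ad (ep X t) (lie_bracket A X w)) (at t)"
proof -
  have "((\<lambda>s. s - t) has_vector_derivative 1) (at t)" by (auto intro!: derivative_eq_intros)
  from vector_diff_chain_at[OF this, of "\<lambda>s. Ad (ep X s) w" "lie_bracket A X w"] Ad_ep_derivative_0[of X w]
  have "((\<lambda>s. Ad (ep X (s - t)) w) has_vector_derivative lie_bracket A X w) (at t)" by (simp add: o_def)
  from bounded_linear.has_vector_derivative[OF linear_conv_bounded_linear[THEN iffD1, OF Ad_linear[of "ep X t"]] this]
  show ?thesis by (simp add: Ad_mult[symmetric] ep_add[symmetric])
qed

text \<open>Linearity is inherited from \<open>Ad\<close> by differentiation.\<close>

lemma lie_bracket_linear_right: "linear (lie_bracket A X)"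
proof (rule linearI)
  fix v w r
  have "((\<lambda>t. Ad (ep X t) v + Ad (ep X t) w) has_vector_derivative lie_bracket A X v + lie_bracket A X w) (at 0)"
    by (intro has_vector_derivative_add Ad_ep_derivative_0)
  then show "lie_bracket A X (v + w) = lie_bracket A X v + lie_bracket A X w"
    using vector_derivative_unique_at[OF Ad_ep_derivative_0[of X "v + w"]]
    by (simp add: linear_add[OF Ad_linear])
  have "((\<lambda>t. r *\<^sub>R Ad (ep X t) v) has_vector_derivative r *\<^sub>R lie_bracket A X v) (at 0)"
    by (rule bounded_linear.has_vector_derivative[OF bounded_linear_scaleR_right Ad_ep_derivative_0])
  then show "lie_bracket A X (r *\<^sub>R v) = r *\<^sub>R lie_bracket A X v"
    using vector_derivative_unique_at[OF Ad_ep_derivative_0[of X "r *\<^sub>R v"]]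
    by (simp add: linear_cmul[OF Ad_linear])
qed

lemma lie_bracket_linear_left: "linear (\<lambda>v. lie_bracket A v w)"
  using linear_compose_neg[OF lie_bracket_linear_right[of w]]
  by (simp add: lie_bracket_antisym[of _ w])

text \<open>The exponential series of \<open>t ad X\<close> ends after the linear term: \<open>Ad (ep X t)\<close> fixes \<open>[X, w]\<close>, so
  that \<open>Ad (ep X t) w\<close> has a constant derivative in \<open>t\<close>.\<close>

lemma Ad_ep_two_step:
  assumes "lie_bracket A X (lie_bracket A X w) = 0"
  shows "Ad (ep X t) w = w + t *\<^sub>R lie_bracket A X w"
proof -
  have "((\<lambda>t. Ad (ep X t) (lie_bracket A X w)) has_vector_derivative 0) (at t within UNIV)" for t
    using Ad_ep_derivative[of X "lie_bracket A X w" t] by (simp add: assms linear_0[OF Ad_linear])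
  then obtain c where c: "Ad (ep X t) (lie_bracket A X w) = c" for t
    using has_vector_derivative_zero_constant[of UNIV] by auto
  from c[of 0] have cw: "c = lie_bracket A X w" by (simp add: Ad_one)
  have "((\<lambda>t. Ad (ep X t) w - t *\<^sub>R lie_bracket A X w) has_vector_derivative
      lie_bracket A X w - 1 *\<^sub>R lie_bracket A X w) (at t within UNIV)" for t
    using Ad_ep_derivative[of X w t] unfolding c cw
    by (intro has_vector_derivative_diff) (auto simp: has_vector_derivative_def intro!: derivative_eq_intros)
  then have "((\<lambda>t. Ad (ep X t) w - t *\<^sub>R lie_bracket A X w) has_vector_derivative 0) (at t within UNIV)" for t
    by simp
  then obtain d where d: "Ad (ep X t) w - t *\<^sub>R lie_bracket A X w = d" for t
    using has_vector_derivative_zero_constant[of UNIV] by auto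
  from d[of 0] d[of t] show ?thesis by (simp add: Ad_one algebra_simps)
qed

text \<open>Central elements of the Lie algebra exponentiate to elements that commute with every
  one-parameter subgroup, so on the centre the exponential map is a homomorphism.\<close>

lemma Ad_ep_central:
  assumes "\<And>v. lie_bracket A v z = 0"
  shows "Ad (ep z t) w = w"
proof -
  have "lie_bracket A z v = 0" for v using assms[of v] lie_bracket_antisym[of z v] by simp
  then show ?thesis using Ad_ep_two_step[of z w t] by simp
qed

lemma lie_exp_add_central:
  assumes z: "\<And>v. lie_bracket A v z = 0"
  shows "lie_exp A (z + w) = lie_exp A z * lie_exp A w"
proof -
  have comm: "ep z s * ep w t = ep w t * ep z s" for s t
    by (rule ep_commute_if_Ad_fixed) (rule Ad_ep_central[OF z])
  have "one_param (z + w) (\<lambda>t. ep w t * ep z t)"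
  proof (rule one_paramI)
    show "ep w (s + t) * ep z (s + t) = ep w s * ep z s * (ep w t * ep z t)" for s t
    proof -
      have "ep w s * (ep w t * ep z s) * ep z t = ep w s * (ep z s * ep w t) * ep z t" by (simp add: comm)
      then show ?thesis by (simp add: ep_add mult.assoc)
    qed
    have "has_left_derivative (ep w) w 0 UNIV" "has_left_derivative (ep z) z 0 UNIV"
      using one_param_ep by (simp_all add: one_param_def)
    from has_left_derivative_mult[OF this]
    show "has_left_derivative (\<lambda>t. ep w t * ep z t) (z + w) 0 UNIV"
      by (simp add: Ad_one add.commute)
  qed
  from lie_exp_eq[OF this] show ?thesis by (simp add: lie_exp_eq_ep comm)
qed

section \<open>Absolutely continuous curves in the group\<close>

lemma smooth_image_abs_continuous:
  fixes h :: "'a::euclidean_space \<Rightarrow> 'g"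
  assumes h: "smooth_into A h D" and V: "(V, \<psi>) \<in> A" and x0: "x0 \<in> D" "h x0 \<in> V"
  obtains r where "r > 0" "\<And>a b k. abs_continuous_on a b k \<Longrightarrow> k ` {a..b} \<subseteq> cball x0 r \<Longrightarrow>
    (\<forall>s\<in>{a..b}. h (k s) \<in> V) \<and> abs_continuous_on a b (\<lambda>s. \<psi> (h (k s)))"
proof -
  have S: "open (D \<inter> h -` V)" by (rule smooth_into_preimage_open[OF h chart_open(1)[OF V]])
  have xS: "x0 \<in> D \<inter> h -` V" using x0 by simp
  obtain r L where rL: "r > 0" "L > 0" "cball x0 r \<subseteq> D \<inter> h -` V"
    "\<And>x y. x \<in> cball x0 r \<Longrightarrow> y \<in> cball x0 r \<Longrightarrow> dist (\<psi> (h x)) (\<psi> (h y)) \<le> L * dist x y"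
    by (rule smooth_on_locally_lipschitz[OF smooth_into_coordinates[OF h V] S xS]) blast
  show ?thesis
  proof (rule that[OF rL(1)], rule conjI)
    fix a b and k :: "real \<Rightarrow> 'a" assume k: "abs_continuous_on a b k" "k ` {a..b} \<subseteq> cball x0 r"
    show "\<forall>s\<in>{a..b}. h (k s) \<in> V" using k(2) rL(3) by blast
    show "abs_continuous_on a b (\<lambda>s. \<psi> (h (k s)))"
      by (rule abs_continuous_on_compose_lipschitz[OF k rL(2), of "\<lambda>x. \<psi> (h x)"]) (rule rL(4))
  qed
qed

text \<open>Absolute continuity near \<open>t\<close>, expressed in the single chart at the identity after translating
  \<open>\<gamma> t\<close> there.  In this form it is visibly inherited by products.\<close>

definition locally_ac :: "(real \<Rightarrow> 'g) \<Rightarrow> bool" where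
  "locally_ac \<gamma> \<longleftrightarrow> continuous_on {0..1} \<gamma> \<and> (\<forall>t\<in>{0..1}. \<exists>d>0. \<forall>a b.
     0 \<le> a \<longrightarrow> a \<le> t \<longrightarrow> t \<le> b \<longrightarrow> b \<le> 1 \<longrightarrow> b - a < d \<longrightarrow>
     (\<forall>s\<in>{a..b}. inverse (\<gamma> t) * \<gamma> s \<in> dom1) \<and> abs_continuous_on a b (\<lambda>s. co (inverse (\<gamma> t) * \<gamma> s)))"

lemma locally_ac_continuous_within: "locally_ac \<gamma> \<Longrightarrow> t \<in> {0..1} \<Longrightarrow> continuous (at t within {0..1}) \<gamma>"
  by (simp add: locally_ac_def continuous_on_eq_continuous_within)

lemma locally_acE:
  assumes "locally_ac \<gamma>" "t \<in> {0..1}"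
  obtains d where "d > 0" "\<And>a b. 0 \<le> a \<Longrightarrow> a \<le> t \<Longrightarrow> t \<le> b \<Longrightarrow> b \<le> 1 \<Longrightarrow> b - a < d \<Longrightarrow>
     (\<forall>s\<in>{a..b}. inverse (\<gamma> t) * \<gamma> s \<in> dom1) \<and> abs_continuous_on a b (\<lambda>s. co (inverse (\<gamma> t) * \<gamma> s))"
  using assms unfolding locally_ac_def by blast

lemma coordinate_continuous_within:
  assumes "continuous (at t within S) \<gamma>"
  shows "continuous (at t within S) (\<lambda>s. co (inverse (\<gamma> t) * \<gamma> s))"
proof (rule continuous_within_co)
  show "continuous (at t within S) (\<lambda>s. inverse (\<gamma> t) * \<gamma> s)"
    using tendsto_group_mult[OF tendsto_const, of \<gamma> "\<gamma> t" "at t within S" "inverse (\<gamma> t)"] assms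
    by (simp add: continuous_within)
qed simp

text \<open>A curve is locally absolutely continuous if near every \<open>t\<close> it is, after translation, the image
  of an absolutely continuous curve under a smooth map.\<close>

lemma locally_acI:
  fixes h :: "real \<Rightarrow> 'a::euclidean_space \<Rightarrow> 'g"
  assumes "continuous_on {0..1} \<gamma>"
    and h: "\<And>t. t \<in> {0..1} \<Longrightarrow> smooth_into A (h t) (D t)"
    and k0: "\<And>t. t \<in> {0..1} \<Longrightarrow> k t t \<in> D t"
    and kc: "\<And>t. t \<in> {0..1} \<Longrightarrow> continuous (at t within {0..1}) (k t)"
    and ac: "\<And>t. t \<in> {0..1} \<Longrightarrow> \<exists>d>0. \<forall>a b. 0 \<le> a \<longrightarrow> a \<le> t \<longrightarrow> t \<le> b \<longrightarrow> b \<le> 1 \<longrightarrow> b - a < d \<longrightarrow>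
      abs_continuous_on a b (k t) \<and> (\<forall>s\<in>{a..b}. inverse (\<gamma> t) * \<gamma> s = h t (k t s))"
  shows "locally_ac \<gamma>"
  unfolding locally_ac_def
proof (intro conjI ballI assms(1))
  fix t :: real assume t: "t \<in> {0..1}"
  obtain d where d: "d > 0" "\<forall>a b. 0 \<le> a \<longrightarrow> a \<le> t \<longrightarrow> t \<le> b \<longrightarrow> b \<le> 1 \<longrightarrow> b - a < d \<longrightarrow>
      abs_continuous_on a b (k t) \<and> (\<forall>s\<in>{a..b}. inverse (\<gamma> t) * \<gamma> s = h t (k t s))"
    using ac[OF t] by blast
  have "h t (k t t) = inverse (\<gamma> t) * \<gamma> t" using d t by (metis atLeastAtMost_iff diff_self order_refl)
  then have "h t (k t t) \<in> dom1" by simp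
  then obtain r where r: "r > 0" "\<And>a b f. abs_continuous_on a b f \<Longrightarrow> f ` {a..b} \<subseteq> cball (k t t) r \<Longrightarrow>
    (\<forall>s\<in>{a..b}. h t (f s) \<in> dom1) \<and> abs_continuous_on a b (\<lambda>s. co (h t (f s)))"
    by (rule smooth_image_abs_continuous[OF h[OF t] dom1_chart k0[OF t]]) blast
  obtain d' where d': "d' > 0"
    "\<And>a b. 0 \<le> a \<Longrightarrow> a \<le> t \<Longrightarrow> t \<le> b \<Longrightarrow> b \<le> 1 \<Longrightarrow> b - a < d' \<Longrightarrow> k t ` {a..b} \<subseteq> cball (k t t) r"
    by (rule continuous_within_small_interval[OF kc[OF t] r(1)]) blast
  show "\<exists>d>0. \<forall>a b. 0 \<le> a \<longrightarrow> a \<le> t \<longrightarrow> t \<le> b \<longrightarrow> b \<le> 1 \<longrightarrow> b - a < d \<longrightarrow>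
     (\<forall>s\<in>{a..b}. inverse (\<gamma> t) * \<gamma> s \<in> dom1) \<and> abs_continuous_on a b (\<lambda>s. co (inverse (\<gamma> t) * \<gamma> s))"
  proof (intro exI[of _ "min d d'"] conjI allI impI)
    show "0 < min d d'" using d(1) d'(1) by simp
  next
    fix a b assume ab: "0 \<le> a" "a \<le> t" "t \<le> b" "b \<le> 1" "b - a < min d d'"
    then have *: "abs_continuous_on a b (k t)" "\<forall>s\<in>{a..b}. inverse (\<gamma> t) * \<gamma> s = h t (k t s)"
      "k t ` {a..b} \<subseteq> cball (k t t) r" using d(2) d'(2) by auto
    note ** = r(2)[OF *(1,3)]
    show "\<forall>s\<in>{a..b}. inverse (\<gamma> t) * \<gamma> s \<in> dom1" using ** *(2) by simp
    show "abs_continuous_on a b (\<lambda>s. co (inverse (\<gamma> t) * \<gamma> s))"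
      by (rule abs_continuous_on_cong[OF conjunct2[OF **]]) (use *(2) in simp)
  qed
qed

lemma abs_continuous_curve_imp_locally_ac:
  assumes "abs_continuous_curve A \<gamma>"
  shows "locally_ac \<gamma>"
proof (rule locally_acI[where h="\<lambda>t x. inverse (\<gamma> t) * coord_inv_at A (\<gamma> t) x"
      and D="\<lambda>t. coord_at A (\<gamma> t) ` fst (chart_at A (\<gamma> t))" and k="\<lambda>t s. coord_at A (\<gamma> t) (\<gamma> s)"])
  show c: "continuous_on {0..1} \<gamma>" using assms by (simp add: abs_continuous_curve_def)
  fix t :: real assume t: "t \<in> {0..1}"
  define V where "V = fst (chart_at A (\<gamma> t))"
  define \<psi> where "\<psi> = coord_at A (\<gamma> t)"
  have V: "(V, \<psi>) \<in> A" "\<gamma> t \<in> V" unfolding V_def \<psi>_def using chart_at_pair chart_at_mem(2) by auto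
  have ct: "continuous (at t within {0..1}) \<gamma>" using c t by (simp add: continuous_on_eq_continuous_within)
  show "smooth_into A (\<lambda>x. inverse (\<gamma> t) * inv_into (fst (chart_at A (\<gamma> t))) (coord_at A (\<gamma> t)) x) (coord_at A (\<gamma> t) ` fst (chart_at A (\<gamma> t)))"
    unfolding V_def[symmetric] \<psi>_def[symmetric]
    by (intro smooth_into_mult smooth_into_const smooth_into_chart_inverse V chart_open)
  show "coord_at A (\<gamma> t) (\<gamma> t) \<in> coord_at A (\<gamma> t) ` fst (chart_at A (\<gamma> t))"
    using V by (simp add: V_def)
  have "isCont \<psi> (\<gamma> t)"
    using chart_continuous(1)[OF V(1)] chart_open(1)[OF V(1)] V(2) continuous_on_eq_continuous_at by blast
  then show "continuous (at t within {0..1}) (\<lambda>s. coord_at A (\<gamma> t) (\<gamma> s))"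
    unfolding \<psi>_def using ct by (rule continuous_within_compose3)
  have "\<forall>\<^sub>F s in at t within {0..1}. 1 * \<gamma> s \<in> V"
    using V by (intro eventually_left_translate_mem[OF ct] chart_open(1)[OF V(1)]) simp
  then obtain d where d: "d > 0" "\<forall>s\<in>{0..1}. s \<noteq> t \<and> dist s t < d \<longrightarrow> \<gamma> s \<in> V"
    unfolding eventually_at by auto
  have "abs_continuous_on a b (\<lambda>s. \<psi> (\<gamma> s)) \<and> (\<forall>s\<in>{a..b}. inverse (\<gamma> t) * \<gamma> s = inverse (\<gamma> t) * inv_into V \<psi> (\<psi> (\<gamma> s)))"
    if ab: "0 \<le> a" "a \<le> t" "t \<le> b" "b \<le> 1" "b - a < d" for a b
  proof
    have s: "\<gamma> s \<in> V" if "s \<in> {a..b}" for s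
    proof (cases "s = t")
      case False
      moreover have "s \<in> {0..1}" "dist s t < d" using that ab by (auto simp: dist_real_def)
      ultimately show ?thesis using d(2) by blast
    qed (use V in simp)
    then have "\<gamma> ` {a..b} \<subseteq> V" by blast
    then have "abs_continuous_on a b (\<psi> \<circ> \<gamma>)"
      using assms V(1) ab unfolding abs_continuous_curve_def by fastforce
    then show "abs_continuous_on a b (\<lambda>s. \<psi> (\<gamma> s))" by (simp add: o_def)
    show "\<forall>s\<in>{a..b}. inverse (\<gamma> t) * \<gamma> s = inverse (\<gamma> t) * inv_into V \<psi> (\<psi> (\<gamma> s))"
      using s by (simp add: chart_inverse[OF V(1)])
  qed
  then show "\<exists>d>0. \<forall>a b. 0 \<le> a \<longrightarrow> a \<le> t \<longrightarrow> t \<le> b \<longrightarrow> b \<le> 1 \<longrightarrow> b - a < d \<longrightarrow>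
      abs_continuous_on a b (\<lambda>s. coord_at A (\<gamma> t) (\<gamma> s)) \<and>
      (\<forall>s\<in>{a..b}. inverse (\<gamma> t) * \<gamma> s = inverse (\<gamma> t) * inv_into (fst (chart_at A (\<gamma> t))) (coord_at A (\<gamma> t)) (coord_at A (\<gamma> t) (\<gamma> s)))"
    unfolding V_def \<psi>_def using d(1) by blast
qed

lemma locally_ac_imp_abs_continuous_curve:
  assumes \<gamma>: "locally_ac \<gamma>"
  shows "abs_continuous_curve A \<gamma>"
proof -
  have "abs_continuous_on a b (\<lambda>s. \<psi> (\<gamma> s))"
    if V: "(V, \<psi>) \<in> A" and ab: "0 \<le> a" "a \<le> b" "b \<le> 1" "\<gamma> ` {a..b} \<subseteq> V" for V \<psi> a b
  proof (rule abs_continuous_on_local[OF ab(2)])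
    fix t assume t: "t \<in> {a..b}"
    then have t01: "t \<in> {0..1}" and tV: "\<gamma> t * coi e1 \<in> V" using ab by auto
    define k where "k s = co (inverse (\<gamma> t) * \<gamma> s)" for s
    have kt: "k t = e1" by (simp add: k_def co_one)
    have h: "smooth_into A (\<lambda>x. \<gamma> t * coi x) (co ` dom1)"
      by (intro smooth_into_mult smooth_into_const smooth_into_coi) auto
    obtain r where r: "r > 0" "\<And>a b f. abs_continuous_on a b f \<Longrightarrow> f ` {a..b} \<subseteq> cball e1 r \<Longrightarrow>
      (\<forall>s\<in>{a..b}. \<gamma> t * coi (f s) \<in> V) \<and> abs_continuous_on a b (\<lambda>s. \<psi> (\<gamma> t * coi (f s)))"
      by (rule smooth_image_abs_continuous[OF h V e1_mem tV]) blast
    obtain d where d: "d > 0" "\<And>a b. 0 \<le> a \<Longrightarrow> a \<le> t \<Longrightarrow> t \<le> b \<Longrightarrow> b \<le> 1 \<Longrightarrow> b - a < d \<Longrightarrow>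
       (\<forall>s\<in>{a..b}. inverse (\<gamma> t) * \<gamma> s \<in> dom1) \<and> abs_continuous_on a b k"
      unfolding k_def[abs_def] by (rule locally_acE[OF \<gamma> t01]) blast
    have "continuous (at t within {0..1}) k"
      unfolding k_def[abs_def] by (rule coordinate_continuous_within[OF locally_ac_continuous_within[OF \<gamma> t01]])
    then obtain d' where d': "d' > 0"
      "\<And>a b. 0 \<le> a \<Longrightarrow> a \<le> t \<Longrightarrow> t \<le> b \<Longrightarrow> b \<le> 1 \<Longrightarrow> b - a < d' \<Longrightarrow> k ` {a..b} \<subseteq> cball (k t) r"
      by (rule continuous_within_small_interval[OF _ r(1)]) blast
    have "abs_continuous_on a' b' (\<lambda>s. \<psi> (\<gamma> s))"
      if *: "a \<le> a'" "a' \<le> t" "t \<le> b'" "b' \<le> b" "b' - a' < min d d'" for a' b'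
    proof -
      have "\<forall>s\<in>{a'..b'}. inverse (\<gamma> t) * \<gamma> s \<in> dom1" "abs_continuous_on a' b' k" "k ` {a'..b'} \<subseteq> cball e1 r"
        using d(2)[of a' b'] d'(2)[of a' b'] * ab kt by auto
      moreover from this r(2) have "abs_continuous_on a' b' (\<lambda>s. \<psi> (\<gamma> t * coi (k s)))" by blast
      ultimately show ?thesis by (auto simp: k_def elim: abs_continuous_on_cong)
    qed
    then show "\<exists>d>0. \<forall>a' b'. a \<le> a' \<and> a' \<le> t \<and> t \<le> b' \<and> b' \<le> b \<and> b' - a' < d \<longrightarrow> abs_continuous_on a' b' (\<lambda>s. \<psi> (\<gamma> s))"
      using d(1) d'(1) by (intro exI[of _ "min d d'"]) simp
  qed
  then show ?thesis
    using \<gamma> by (auto simp: abs_continuous_curve_def locally_ac_def o_def)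
qed

lemma locally_ac_mult:
  assumes \<alpha>: "locally_ac \<alpha>" and \<beta>: "locally_ac \<beta>"
  shows "locally_ac (\<lambda>s. \<alpha> s * \<beta> s)"
proof (rule locally_acI[where h="\<lambda>t p. inverse (\<beta> t) * coi (fst p) * \<beta> t * coi (snd p)"
      and D="\<lambda>t. co ` dom1 \<times> co ` dom1" and k="\<lambda>t s. (co (inverse (\<alpha> t) * \<alpha> s), co (inverse (\<beta> t) * \<beta> s))"])
  show "continuous_on {0..1} (\<lambda>s. \<alpha> s * \<beta> s)"
    using \<alpha> \<beta> by (intro continuous_on_group_mult) (simp_all add: locally_ac_def)
  fix t :: real assume t: "t \<in> {0..1}"
  show "smooth_into A (\<lambda>p. inverse (\<beta> t) * coi (fst p) * \<beta> t * coi (snd p)) (co ` dom1 \<times> co ` dom1)"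
    by (rule conjugate_product_smooth_into)
  show "continuous (at t within {0..1}) (\<lambda>s. (co (inverse (\<alpha> t) * \<alpha> s), co (inverse (\<beta> t) * \<beta> s)))"
    by (intro continuous_Pair coordinate_continuous_within locally_ac_continuous_within \<alpha> \<beta> t)
  obtain d1 where d1: "d1 > 0" "\<And>a b. 0 \<le> a \<Longrightarrow> a \<le> t \<Longrightarrow> t \<le> b \<Longrightarrow> b \<le> 1 \<Longrightarrow> b - a < d1 \<Longrightarrow>
     (\<forall>s\<in>{a..b}. inverse (\<alpha> t) * \<alpha> s \<in> dom1) \<and> abs_continuous_on a b (\<lambda>s. co (inverse (\<alpha> t) * \<alpha> s))"
    by (rule locally_acE[OF \<alpha> t]) blast
  obtain d2 where d2: "d2 > 0" "\<And>a b. 0 \<le> a \<Longrightarrow> a \<le> t \<Longrightarrow> t \<le> b \<Longrightarrow> b \<le> 1 \<Longrightarrow> b - a < d2 \<Longrightarrow>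
     (\<forall>s\<in>{a..b}. inverse (\<beta> t) * \<beta> s \<in> dom1) \<and> abs_continuous_on a b (\<lambda>s. co (inverse (\<beta> t) * \<beta> s))"
    by (rule locally_acE[OF \<beta> t]) blast
  show "\<exists>d>0. \<forall>a b. 0 \<le> a \<longrightarrow> a \<le> t \<longrightarrow> t \<le> b \<longrightarrow> b \<le> 1 \<longrightarrow> b - a < d \<longrightarrow>
      abs_continuous_on a b (\<lambda>s. (co (inverse (\<alpha> t) * \<alpha> s), co (inverse (\<beta> t) * \<beta> s))) \<and>
      (\<forall>s\<in>{a..b}. inverse (\<alpha> t * \<beta> t) * (\<alpha> s * \<beta> s) =
        inverse (\<beta> t) * coi (fst (co (inverse (\<alpha> t) * \<alpha> s), co (inverse (\<beta> t) * \<beta> s))) * \<beta> t *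
        coi (snd (co (inverse (\<alpha> t) * \<alpha> s), co (inverse (\<beta> t) * \<beta> s))))"
  proof (intro exI[of _ "min d1 d2"] conjI allI impI)
    show "0 < min d1 d2" using d1(1) d2(1) by simp
  next
    fix a b assume "0 \<le> a" "a \<le> t" "t \<le> b" "b \<le> 1" "b - a < min d1 d2"
    then have *: "\<forall>s\<in>{a..b}. inverse (\<alpha> t) * \<alpha> s \<in> dom1" "abs_continuous_on a b (\<lambda>s. co (inverse (\<alpha> t) * \<alpha> s))"
      "\<forall>s\<in>{a..b}. inverse (\<beta> t) * \<beta> s \<in> dom1" "abs_continuous_on a b (\<lambda>s. co (inverse (\<beta> t) * \<beta> s))"
      using d1(2)[of a b] d2(2)[of a b] by auto
    show "abs_continuous_on a b (\<lambda>s. (co (inverse (\<alpha> t) * \<alpha> s), co (inverse (\<beta> t) * \<beta> s)))"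
      by (intro abs_continuous_on_Pair *)
    show "\<forall>s\<in>{a..b}. inverse (\<alpha> t * \<beta> t) * (\<alpha> s * \<beta> s) =
        inverse (\<beta> t) * coi (fst (co (inverse (\<alpha> t) * \<alpha> s), co (inverse (\<beta> t) * \<beta> s))) * \<beta> t *
        coi (snd (co (inverse (\<alpha> t) * \<alpha> s), co (inverse (\<beta> t) * \<beta> s)))"
      using *(1,3) by (simp add: mult_group.inverse_distrib_swap mult.assoc)
  qed
qed (simp add: co_one)

lemma locally_ac_ep:
  assumes c: "abs_continuous_on 0 1 c"
  shows "locally_ac (\<lambda>s. ep v (c s))"
proof (rule locally_acI[where h="\<lambda>t r. ep v (r - c t)" and D="\<lambda>t. UNIV" and k="\<lambda>t. c"])
  have cc: "continuous_on {0..1} c" by (rule abs_continuous_on_continuous[OF c])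
  have sm: "smooth_into A (ep v) UNIV" by (rule one_param_smooth_into[OF one_param_ep])
  show "continuous_on {0..1} (\<lambda>s. ep v (c s))"
    by (rule continuous_on_compose2[OF smooth_into_continuous[OF sm] cc]) simp
  fix t :: real assume t: "t \<in> {0..1}"
  have "smooth_on (\<lambda>r. r + - c t) UNIV"
    by (intro smooth_on_add smooth_on_ident smooth_on_const open_UNIV)
  then show "smooth_into A (\<lambda>r. ep v (r - c t)) UNIV"
    by (intro smooth_into_compose[OF sm]) auto
  show "continuous (at t within {0..1}) c" using cc t by (simp add: continuous_on_eq_continuous_within)
  show "\<exists>d>0. \<forall>a b. 0 \<le> a \<longrightarrow> a \<le> t \<longrightarrow> t \<le> b \<longrightarrow> b \<le> 1 \<longrightarrow> b - a < d \<longrightarrow>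
      abs_continuous_on a b c \<and> (\<forall>s\<in>{a..b}. inverse (ep v (c t)) * ep v (c s) = ep v (c s - c t))"
    by (intro exI[of _ 1]) (auto intro: abs_continuous_on_subinterval[OF c] additive_imp_diff ep_add)
qed simp

lemma locally_ac_const: "locally_ac (\<lambda>_. g)"
proof -
  have "abs_continuous_on a b (\<lambda>_. x)" for a b and x :: 'e
    by (auto simp: abs_continuous_on_def intro: exI[of _ 1])
  then show ?thesis unfolding locally_ac_def by (auto intro: exI[of _ 1])
qed

lemma locally_ac_cong:
  assumes \<gamma>: "locally_ac \<gamma>" and eq: "\<And>t. t \<in> {0..1} \<Longrightarrow> \<eta> t = \<gamma> t"
  shows "locally_ac \<eta>"
  unfolding locally_ac_def
proof (intro conjI ballI)
  show "continuous_on {0..1} \<eta>"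
    using \<gamma> continuous_on_cong[of "{0..1}" "{0..1}" \<eta> \<gamma>] eq by (simp add: locally_ac_def)
  fix t :: real assume t: "t \<in> {0..1}"
  obtain d where d: "d > 0" "\<And>a b. 0 \<le> a \<Longrightarrow> a \<le> t \<Longrightarrow> t \<le> b \<Longrightarrow> b \<le> 1 \<Longrightarrow> b - a < d \<Longrightarrow>
     (\<forall>s\<in>{a..b}. inverse (\<gamma> t) * \<gamma> s \<in> dom1) \<and> abs_continuous_on a b (\<lambda>s. co (inverse (\<gamma> t) * \<gamma> s))"
    by (rule locally_acE[OF \<gamma> t]) blast
  have "(\<forall>s\<in>{a..b}. inverse (\<eta> t) * \<eta> s \<in> dom1) \<and> abs_continuous_on a b (\<lambda>s. co (inverse (\<eta> t) * \<eta> s))"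
    if ab: "0 \<le> a" "a \<le> t" "t \<le> b" "b \<le> 1" "b - a < d" for a b
  proof -
    have "inverse (\<eta> t) * \<eta> s = inverse (\<gamma> t) * \<gamma> s" if "s \<in> {a..b}" for s
      using that ab t by (simp add: eq)
    then show ?thesis
      using d(2)[OF ab] abs_continuous_on_cong[of a b "\<lambda>s. co (inverse (\<gamma> t) * \<gamma> s)" "\<lambda>s. co (inverse (\<eta> t) * \<eta> s)"]
      by simp
  qed
  then show "\<exists>d>0. \<forall>a b. 0 \<le> a \<longrightarrow> a \<le> t \<longrightarrow> t \<le> b \<longrightarrow> b \<le> 1 \<longrightarrow> b - a < d \<longrightarrow>
     (\<forall>s\<in>{a..b}. inverse (\<eta> t) * \<eta> s \<in> dom1) \<and> abs_continuous_on a b (\<lambda>s. co (inverse (\<eta> t) * \<eta> s))"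
    using d(1) by blast
qed

lemma locally_ac_clamp:
  assumes \<gamma>: "locally_ac \<gamma>" and pq: "0 \<le> p" "p \<le> q" "q \<le> 1"
  shows "locally_ac (\<lambda>s. \<gamma> (max p (min q s)))"
  unfolding locally_ac_def
proof (intro conjI ballI)
  show "continuous_on {0..1} (\<lambda>s. \<gamma> (max p (min q s)))"
    by (rule continuous_on_compose2[of "{0..1}" \<gamma>])
      (use \<gamma> pq in \<open>auto simp: locally_ac_def intro!: continuous_intros\<close>)
  fix t :: real assume t: "t \<in> {0..1}"
  define t' where "t' = max p (min q t)"
  have t': "t' \<in> {0..1}" using pq by (auto simp: t'_def)
  obtain d where d: "d > 0" "\<And>a b. 0 \<le> a \<Longrightarrow> a \<le> t' \<Longrightarrow> t' \<le> b \<Longrightarrow> b \<le> 1 \<Longrightarrow> b - a < d \<Longrightarrow>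
     (\<forall>s\<in>{a..b}. inverse (\<gamma> t') * \<gamma> s \<in> dom1) \<and> abs_continuous_on a b (\<lambda>s. co (inverse (\<gamma> t') * \<gamma> s))"
    by (rule locally_acE[OF \<gamma> t']) blast
  have "(\<forall>s\<in>{a..b}. inverse (\<gamma> t') * \<gamma> (max p (min q s)) \<in> dom1) \<and>
      abs_continuous_on a b (\<lambda>s. co (inverse (\<gamma> t') * \<gamma> (max p (min q s))))"
    if ab: "0 \<le> a" "a \<le> t" "t \<le> b" "b \<le> 1" "b - a < d" for a b
  proof -
    define a' where "a' = max p (min q a)"
    define b' where "b' = max p (min q b)"
    have "0 \<le> a'" "a' \<le> t'" "t' \<le> b'" "b' \<le> 1" "b' - a' \<le> b - a"
      using ab pq by (auto simp: a'_def b'_def t'_def)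
    then have *: "\<forall>s\<in>{a'..b'}. inverse (\<gamma> t') * \<gamma> s \<in> dom1" "abs_continuous_on a' b' (\<lambda>s. co (inverse (\<gamma> t') * \<gamma> s))"
      using d(2)[of a' b'] ab by auto
    have "max p (min q s) \<in> {a'..b'}" if "s \<in> {a..b}" for s
      using that by (auto simp: a'_def b'_def)
    with *(1) have "\<forall>s\<in>{a..b}. inverse (\<gamma> t') * \<gamma> (max p (min q s)) \<in> dom1" by blast
    with abs_continuous_on_clamp[OF *(2)[unfolded a'_def b'_def] pq(2)] show ?thesis by simp
  qed
  then show "\<exists>d>0. \<forall>a b. 0 \<le> a \<longrightarrow> a \<le> t \<longrightarrow> t \<le> b \<longrightarrow> b \<le> 1 \<longrightarrow> b - a < d \<longrightarrow>
     (\<forall>s\<in>{a..b}. inverse (\<gamma> (max p (min q t))) * \<gamma> (max p (min q s)) \<in> dom1) \<and>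
     abs_continuous_on a b (\<lambda>s. co (inverse (\<gamma> (max p (min q t))) * \<gamma> (max p (min q s))))"
    unfolding t'_def[symmetric] using d(1) by (intro exI[of _ d]) simp
qed

text \<open>An absolutely continuous curve together with its left derivative, the control.\<close>

definition controlled :: "(real \<Rightarrow> 'g) \<Rightarrow> (real \<Rightarrow> 'e) \<Rightarrow> bool" where
  "controlled \<gamma> u \<longleftrightarrow> locally_ac \<gamma> \<and>
     (AE t in lebesgue. t \<in> {0..1} \<longrightarrow> has_left_derivative \<gamma> (u t) t {0..1})"

lemma controlled_const: "controlled (\<lambda>_. g) (\<lambda>_. 0)"
  by (simp add: controlled_def locally_ac_const has_left_derivative_const)

lemma controlled_mult:
  assumes "controlled \<alpha> u" "controlled \<beta> w"
  shows "controlled (\<lambda>t. \<alpha> t * \<beta> t) (\<lambda>t. Ad (inverse (\<beta> t)) (u t) + w t)"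
  unfolding controlled_def
proof
  show "locally_ac (\<lambda>t. \<alpha> t * \<beta> t)" using assms by (simp add: controlled_def locally_ac_mult)
  have "AE t in lebesgue. t \<in> {0..1} \<longrightarrow> has_left_derivative \<alpha> (u t) t {0..1}"
    "AE t in lebesgue. t \<in> {0..1} \<longrightarrow> has_left_derivative \<beta> (w t) t {0..1}"
    using assms by (simp_all add: controlled_def)
  then show "AE t in lebesgue. t \<in> {0..1} \<longrightarrow>
      has_left_derivative (\<lambda>t. \<alpha> t * \<beta> t) (Ad (inverse (\<beta> t)) (u t) + w t) t {0..1}"
    by eventually_elim (auto intro: has_left_derivative_mult)
qed

lemma controlled_ep:
  assumes "abs_continuous_on 0 1 c"
    and "AE t in lebesgue. t \<in> {0..1} \<longrightarrow> (c has_real_derivative c' t) (at t within {0..1})"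
  shows "controlled (\<lambda>t. ep v (c t)) (\<lambda>t. c' t *\<^sub>R v)"
  unfolding controlled_def
proof
  show "locally_ac (\<lambda>t. ep v (c t))" by (rule locally_ac_ep[OF assms(1)])
  show "AE t in lebesgue. t \<in> {0..1} \<longrightarrow> has_left_derivative (\<lambda>t. ep v (c t)) (c' t *\<^sub>R v) t {0..1}"
    using assms(2) by eventually_elim (auto intro: has_left_derivative_one_param_compose[OF one_param_ep])
qed

text \<open>The piece of a curve between the times \<open>p\<close> and \<open>q\<close>, again parametrized by \<open>[0, 1]\<close>: it rests
  before \<open>p\<close> and after \<open>q\<close>.\<close>

lemma controlled_clamp:
  assumes \<gamma>: "controlled \<gamma> u" and pq: "0 \<le> p" "p \<le> q" "q \<le> 1"
  shows "controlled (\<lambda>t. \<gamma> (max p (min q t))) (\<lambda>t. if p < t \<and> t < q then u t else 0)"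
  unfolding controlled_def
proof
  show "locally_ac (\<lambda>t. \<gamma> (max p (min q t)))" using \<gamma> pq by (simp add: controlled_def locally_ac_clamp)
  have "AE t in lebesgue. t \<in> {0..1} \<longrightarrow> has_left_derivative \<gamma> (u t) t {0..1}"
    using \<gamma> by (simp add: controlled_def)
  then show "AE t in lebesgue. t \<in> {0..1} \<longrightarrow>
      has_left_derivative (\<lambda>t. \<gamma> (max p (min q t))) (if p < t \<and> t < q then u t else 0) t {0..1}"
    using AE_lebesgue_not_equal[of p] AE_lebesgue_not_equal[of q]
  proof eventually_elim
    case (elim t)
    show ?case
    proof
      assume t: "t \<in> {0..1}"
      consider "p < t" "t < q" | "t < p" | "q < t" using elim by linarith
      then show "has_left_derivative (\<lambda>t. \<gamma> (max p (min q t))) (if p < t \<and> t < q then u t else 0) t {0..1}"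
      proof cases
        case 1
        have "\<forall>\<^sub>F s in at t within {0..1}. p < s" "\<forall>\<^sub>F s in at t within {0..1}. s < q"
          using 1 by (auto intro!: order_tendstoD tendsto_ident_at)
        then have "\<forall>\<^sub>F s in at t within {0..1}. \<gamma> s = \<gamma> (max p (min q s))"
          by eventually_elim simp
        moreover have "\<gamma> t = \<gamma> (max p (min q t))" using 1 by simp
        moreover have "has_left_derivative \<gamma> (u t) t {0..1}" using elim t by simp
        ultimately have "has_left_derivative (\<lambda>t. \<gamma> (max p (min q t))) (u t) t {0..1}"
          by (intro has_left_derivative_eventually_cong[where \<gamma>=\<gamma> and \<eta>="\<lambda>t. \<gamma> (max p (min q t))"])
        then show ?thesis using 1 by simp
      next
        case 2
        then have "\<forall>\<^sub>F s in at t within {0..1}. s < p"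
          by (auto intro!: order_tendstoD tendsto_ident_at)
        then have "\<forall>\<^sub>F s in at t within {0..1}. \<gamma> p = \<gamma> (max p (min q s))"
          by eventually_elim (use pq in simp)
        moreover have "\<gamma> p = \<gamma> (max p (min q t))" using 2 pq by simp
        ultimately have "has_left_derivative (\<lambda>t. \<gamma> (max p (min q t))) 0 t {0..1}"
          by (rule has_left_derivative_eventually_cong[where \<gamma>="\<lambda>_. \<gamma> p" and \<eta>="\<lambda>t. \<gamma> (max p (min q t))",
                OF has_left_derivative_const])
        then show ?thesis using 2 by simp
      next
        case 3
        then have "\<forall>\<^sub>F s in at t within {0..1}. q < s"
          by (auto intro!: order_tendstoD tendsto_ident_at)
        then have "\<forall>\<^sub>F s in at t within {0..1}. \<gamma> q = \<gamma> (max p (min q s))"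
          by eventually_elim (use pq in simp)
        moreover have "\<gamma> q = \<gamma> (max p (min q t))" using 3 pq by simp
        ultimately have "has_left_derivative (\<lambda>t. \<gamma> (max p (min q t))) 0 t {0..1}"
          by (rule has_left_derivative_eventually_cong[where \<gamma>="\<lambda>_. \<gamma> q" and \<eta>="\<lambda>t. \<gamma> (max p (min q t))",
                OF has_left_derivative_const])
        then show ?thesis using 3 by simp
      qed
    qed
  qed
qed

text \<open>The control is almost everywhere the limit of difference quotients that are measurable in \<open>t\<close>.\<close>

lemma controlled_measurable:
  assumes \<gamma>: "controlled \<gamma> u"
  shows "u \<in> borel_measurable (lebesgue_on {0..1})"
proof -
  have cont: "continuous_on {0..1} \<gamma>" using \<gamma> by (simp add: controlled_def locally_ac_def)
  define \<tau> where "\<tau> n t = min 1 (t + 1 / real (Suc n))" for n t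
  define g where "g n t = inverse (\<gamma> t) * \<gamma> (\<tau> n t)" for n t
  define S where "S n = {0..1} \<inter> g n -` dom1" for n
  define f where "f n t = indicat_real (S n) t *\<^sub>R (real (Suc n) *\<^sub>R (co (g n t) - e1))" for n t
  have g: "continuous_on {0..1} (g n)" for n
    unfolding g_def \<tau>_def
    by (intro continuous_on_group_mult continuous_on_group_inverse cont continuous_on_compose2[OF cont] continuous_intros)
      (auto simp: add_nonneg_pos)
  have "f n \<in> borel_measurable borel" for n
  proof -
    have "openin (top_of_set {0..1}) (S n)"
      unfolding S_def using g[of n] open_dom1 by (rule continuous_openin_preimage_gen)
    then obtain T where "open T" "S n = {0..1} \<inter> T" by (auto simp: openin_open)
    then have Sb: "S n \<in> sets borel" by auto
    have "continuous_on (S n) (\<lambda>t. co (g n t))"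
      by (rule continuous_on_compose2[OF chart_continuous(1)[OF dom1_chart] continuous_on_subset[OF g[of n]]])
        (auto simp: S_def)
    then have "continuous_on (S n) (\<lambda>t. real (Suc n) *\<^sub>R (co (g n t) - e1))"
      by (intro continuous_intros)
    then show ?thesis
      unfolding f_def using Sb by (rule borel_measurable_continuous_on_indicator[rotated])
  qed
  then have [measurable]: "(\<lambda>t. lim (\<lambda>n. f n t)) \<in> borel_measurable borel"
    by (rule borel_measurable_lim_metric)
  have "(\<lambda>t. indicat_real {0..1} t *\<^sub>R lim (\<lambda>n. f n t)) \<in> borel_measurable borel"
    by measurable
  then have m: "(\<lambda>t. indicat_real {0..1} t *\<^sub>R lim (\<lambda>n. f n t)) \<in> borel_measurable lebesgue"
    by (intro measurable_completion) simp
  have "AE t in lebesgue. t \<in> {0..1} \<longrightarrow> has_left_derivative \<gamma> (u t) t {0..1}"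
    using \<gamma> by (simp add: controlled_def)
  moreover note AE_lebesgue_not_equal[of 1]
  ultimately have "AE t in lebesgue. indicat_real {0..1} t *\<^sub>R lim (\<lambda>n. f n t) = indicat_real {0..1} t *\<^sub>R u t"
  proof eventually_elim
    case (elim t)
    show ?case
    proof (cases "t \<in> {0..1}")
      case True
      then have t: "0 \<le> t" "t < 1" using elim(2) by auto
      have d: "has_left_derivative \<gamma> (u t) t {0..1}" using elim True by simp
      define x where "x n = t + 1 / real (Suc n)" for n
      obtain N :: nat where N: "1 / real (Suc N) < 1 - t" using t nat_approx_posE[of "1 - t"] by auto
      have x1: "x n < 1" "\<tau> n t = x n" if "n \<ge> N" for n
      proof -
        have "1 / real (Suc n) \<le> 1 / real (Suc N)" using that by (intro divide_left_mono) auto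
        then show "x n < 1" "\<tau> n t = x n" using N by (auto simp: x_def \<tau>_def)
      qed
      have xl: "x \<longlonglongrightarrow> t"
        using tendsto_add[OF tendsto_const LIMSEQ_inverse_real_of_nat, of t] by (simp add: x_def[abs_def] inverse_eq_divide)
      have xf: "filterlim x (at t within {0..1}) sequentially"
        unfolding filterlim_at
      proof
        show "\<forall>\<^sub>F n in sequentially. x n \<in> {0..1} \<and> x n \<noteq> t"
          unfolding eventually_sequentially
        proof (intro exI[of _ N] allI impI)
          fix n assume "N \<le> n"
          moreover have "0 < 1 / real (Suc n)" by simp
          ultimately show "x n \<in> {0..1} \<and> x n \<noteq> t" using x1(1)[of n] t unfolding x_def by simp
        qed
      qed (rule xl)
      have "((\<lambda>s. co (inverse (\<gamma> t) * \<gamma> s)) has_vector_derivative u t) (at t within {0..1})"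
        using d by (simp add: has_left_derivative_def)
      then have "((\<lambda>s. norm (co (inverse (\<gamma> t) * \<gamma> s) - e1 - (s - t) *\<^sub>R u t) / norm (s - t)) \<longlongrightarrow> 0) (at t within {0..1})"
        by (simp add: has_vector_derivative_def has_derivative_iff_norm co_one)
      moreover have "\<forall>\<^sub>F s in at t within {0..1}. norm (co (inverse (\<gamma> t) * \<gamma> s) - e1 - (s - t) *\<^sub>R u t) / norm (s - t) =
          norm ((co (inverse (\<gamma> t) * \<gamma> s) - e1) /\<^sub>R (s - t) - u t)"
      proof -
        have "norm (w - r *\<^sub>R u t) / norm r = norm (w /\<^sub>R r - u t)" if "r \<noteq> 0" for w r
        proof -
          have "w /\<^sub>R r - u t = (w - r *\<^sub>R u t) /\<^sub>R r" using that by (simp add: scaleR_diff_right)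
          then show ?thesis by (simp add: divide_inverse mult.commute)
        qed
        then show ?thesis by (auto simp: eventually_at_filter)
      qed
      ultimately have "((\<lambda>s. norm ((co (inverse (\<gamma> t) * \<gamma> s) - e1) /\<^sub>R (s - t) - u t)) \<longlongrightarrow> 0) (at t within {0..1})"
        by (rule Lim_transform_eventually)
      then have "((\<lambda>s. (co (inverse (\<gamma> t) * \<gamma> s) - e1) /\<^sub>R (s - t)) \<longlongrightarrow> u t) (at t within {0..1})"
        unfolding tendsto_norm_zero_iff by (rule LIM_zero_cancel)
      from filterlim_compose[OF this xf]
      have "(\<lambda>n. (co (inverse (\<gamma> t) * \<gamma> (x n)) - e1) /\<^sub>R (x n - t)) \<longlonglongrightarrow> u t" .
      moreover have "\<forall>\<^sub>F n in sequentially. (co (inverse (\<gamma> t) * \<gamma> (x n)) - e1) /\<^sub>R (x n - t) = f n t"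
      proof -
        have "\<forall>\<^sub>F s in at t within {0..1}. inverse (\<gamma> t) * \<gamma> s \<in> dom1"
          using has_left_derivative_local_coordinates[OF d] by eventually_elim simp
        then have "\<forall>\<^sub>F n in sequentially. inverse (\<gamma> t) * \<gamma> (x n) \<in> dom1"
          by (rule eventually_compose_filterlim[OF _ xf])
        moreover have "\<forall>\<^sub>F n in sequentially. N \<le> n" by (rule eventually_ge_at_top)
        ultimately show ?thesis
        proof eventually_elim
          case (elim n)
          then have "t \<in> S n" using True x1(2)[of n] by (simp add: S_def g_def)
          then show ?case using x1(2)[OF elim(2)] by (simp add: f_def g_def x_def)
        qed
      qed
      ultimately have "(\<lambda>n. f n t) \<longlonglongrightarrow> u t" by (rule Lim_transform_eventually)
      then have "lim (\<lambda>n. f n t) = u t" by (rule limI)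
      then show ?thesis by simp
    qed simp
  qed
  from borel_measurable_AE[OF m this]
  have "(\<lambda>t. indicat_real {0..1} t *\<^sub>R u t) \<in> borel_measurable lebesgue" .
  then show ?thesis
    by (subst borel_measurable_restrict_space_iff) auto
qed

end

section \<open>Integrals over the unit interval\<close>

lemma nn_integral_unit_interval:
  fixes f :: "real \<Rightarrow> real"
  assumes f: "f absolutely_integrable_on {0..1}" and nonneg: "\<And>t. t \<in> {0..1} \<Longrightarrow> 0 \<le> f t"
  shows "(\<integral>\<^sup>+t\<in>{0..1}. ennreal (f t) \<partial>lebesgue) = ennreal (integral {0..1} f)"
proof -
  have "(\<integral>\<^sup>+t\<in>{0..1}. ennreal (f t) \<partial>lebesgue) = (\<integral>\<^sup>+t. ennreal (indicat_real {0..1} t *\<^sub>R f t) \<partial>lebesgue)"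
    by (intro nn_integral_cong) (simp add: indicator_def)
  also have "\<dots> = ennreal (\<integral>t. indicat_real {0..1} t *\<^sub>R f t \<partial>lebesgue)"
    using f nonneg unfolding set_integrable_def
    by (intro nn_integral_eq_integral) (auto simp: indicator_def)
  also have "\<dots> = ennreal (integral {0..1} f)"
    using set_lebesgue_integral_eq_integral(2)[OF f] by (simp add: set_lebesgue_integral_def)
  finally show ?thesis .
qed

lemma absolutely_integrable_if_finite_nn_integral:
  fixes f :: "real \<Rightarrow> real"
  assumes f: "f \<in> borel_measurable (lebesgue_on {0..1})" and nonneg: "\<And>t. t \<in> {0..1} \<Longrightarrow> 0 \<le> f t"
    and fin: "(\<integral>\<^sup>+t\<in>{0..1}. ennreal (f t) \<partial>lebesgue) < \<infinity>"
  shows "f absolutely_integrable_on {0..1}"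
  unfolding set_integrable_def
proof (rule integrableI_nonneg)
  show "(\<lambda>t. indicat_real {0..1} t *\<^sub>R f t) \<in> borel_measurable lebesgue"
    using f by (subst (asm) borel_measurable_restrict_space_iff) auto
  show "AE t in lebesgue. 0 \<le> indicat_real {0..1} t *\<^sub>R f t"
    using nonneg by (intro AE_I2) (simp add: indicator_def)
  have "(\<integral>\<^sup>+t. ennreal (indicat_real {0..1} t *\<^sub>R f t) \<partial>lebesgue) = (\<integral>\<^sup>+t\<in>{0..1}. ennreal (f t) \<partial>lebesgue)"
    by (intro nn_integral_cong) (simp add: indicator_def)
  with fin show "(\<integral>\<^sup>+t. ennreal (indicat_real {0..1} t *\<^sub>R f t) \<partial>lebesgue) < \<infinity>" by simp
qed

lemma absolutely_integrable_continuous_scaleR: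
  fixes \<psi> :: "real \<Rightarrow> real" and f :: "real \<Rightarrow> 'a::euclidean_space"
  assumes "continuous_on {0..1} \<psi>" "f absolutely_integrable_on {0..1}"
  shows "(\<lambda>t. \<psi> t *\<^sub>R f t) absolutely_integrable_on {0..1}"
proof (rule absolutely_integrable_bounded_measurable_product[where h="\<lambda>r x. r *\<^sub>R x"])
  show "bilinear (\<lambda>(r::real) (x::'a). r *\<^sub>R x)"
    by (simp add: bilinear_conv_bounded_bilinear bounded_bilinear_scaleR)
  show "\<psi> \<in> borel_measurable (lebesgue_on {0..1})"
    by (rule continuous_imp_measurable_on_sets_lebesgue[OF assms(1)]) simp
  show "bounded (\<psi> ` {0..1})"
    by (intro compact_imp_bounded compact_continuous_image assms(1)) simp
qed (use assms in auto)

section \<open>Forms and norms on subspaces\<close>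

text \<open>The constant is the minimum of \<open>f\<close> over the unit sphere of \<open>S\<close>.\<close>

lemma homogeneous_lower_bound:
  fixes S :: "'a::euclidean_space set"
  assumes S: "subspace S" and c: "continuous_on S f"
    and hom: "\<And>u c. u \<in> S \<Longrightarrow> f (c *\<^sub>R u) = \<bar>c\<bar> * f u" and pos: "\<And>u. u \<in> S \<Longrightarrow> u \<noteq> 0 \<Longrightarrow> f u > (0::real)"
  obtains m where "m > 0" "\<And>u. u \<in> S \<Longrightarrow> m * norm u \<le> f u"
proof -
  define K where "K = S \<inter> sphere 0 1"
  have K: "compact K" unfolding K_def using closed_subspace[OF S] by (intro closed_Int_compact) auto
  have f0: "f 0 = 0" using hom[OF subspace_0[OF S], of 0] by simp
  have scale: "m * norm u \<le> f u" if m: "\<And>x. x \<in> K \<Longrightarrow> m \<le> f x" and u: "u \<in> S" for m u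
  proof (cases "u = 0")
    case False
    have "(1 / norm u) *\<^sub>R u \<in> K"
      unfolding K_def using False subspace_scale[OF S u] by simp
    from m[OF this] have "m \<le> (1 / norm u) * f u" using hom[OF u, of "1 / norm u"] by simp
    then show ?thesis using False by (simp add: field_simps)
  qed (simp add: f0)
  show ?thesis
  proof (cases "K = {}")
    case True
    then show ?thesis using that[of 1] scale[of 1] by simp
  next
    case False
    have "continuous_on K f" using c by (rule continuous_on_subset) (simp add: K_def)
    then obtain x where x: "x \<in> K" "\<And>y. y \<in> K \<Longrightarrow> f x \<le> f y"
      using continuous_attains_inf[OF K False] by blast
    have "f x > 0" using x(1) by (intro pos) (auto simp: K_def)
    then show ?thesis using that[of "f x"] scale[of "f x"] x(2) by blast
  qed
qed

lemma orthonormal_basis_of_subspace: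
  fixes S :: "'a::euclidean_space set"
  assumes "subspace S"
  obtains B where "finite B" "B \<subseteq> S" "\<And>x. x \<in> S \<Longrightarrow> (\<Sum>b\<in>B. (x \<bullet> b) *\<^sub>R b) = x"
proof -
  obtain B where B: "B \<subseteq> S" "pairwise orthogonal B" "\<And>x. x \<in> B \<Longrightarrow> norm x = 1" "independent B" "span B = S"
    using orthonormal_basis_subspace[OF assms] by metis
  have "finite B" using B(4) by (rule independent_imp_finite)
  then show ?thesis using that B orthonormal_basis_expand by blast
qed

text \<open>Compose with the orthogonal projection onto \<open>S\<close>.  A form on the whole space is bounded bilinear, so
  that continuity and integrability of expressions in it are at hand.\<close>

lemma inner_product_extension:
  fixes S :: "'a::euclidean_space set"
  assumes S: "subspace S" and ip: "inner_product_on S \<rho>"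
  obtains R where "bounded_bilinear R" "\<And>u v. R u v = R v u" "\<And>u. R u u \<ge> (0::real)"
    "\<And>u v. u \<in> S \<Longrightarrow> v \<in> S \<Longrightarrow> R u v = \<rho> u v"
proof -
  obtain B where B: "finite B" "B \<subseteq> S" "\<And>x. x \<in> S \<Longrightarrow> (\<Sum>b\<in>B. (x \<bullet> b) *\<^sub>R b) = x"
    by (rule orthonormal_basis_of_subspace[OF S]) blast
  define P where "P x = (\<Sum>b\<in>B. (x \<bullet> b) *\<^sub>R b)" for x
  have PS: "P x \<in> S" for x
    unfolding P_def using B(2) by (intro subspace_sum[OF S] subspace_scale[OF S]) auto
  have Plin: "P (x + y) = P x + P y" "P (c *\<^sub>R x) = c *\<^sub>R P x" for x y c
    by (simp_all add: P_def inner_add_left scaleR_add_left sum.distrib scaleR_sum_right)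
  define R where "R u v = \<rho> (P u) (P v)" for u v
  have sym: "R u v = R v u" for u v
    using ip PS unfolding R_def inner_product_on_def by blast
  have add: "R (u + u') v = R u v + R u' v" and scale: "R (c *\<^sub>R u) v = c * R u v" for u u' v c
    using ip PS unfolding R_def Plin inner_product_on_def by blast+
  have "bilinear R"
    unfolding bilinear_def using add scale sym by (auto intro!: linearI)
  moreover have "R u u \<ge> 0" for u
  proof (cases "P u = 0")
    case True
    then have "R u u = R 0 0" using Plin(2)[of 0 0] by (simp add: R_def)
    then show ?thesis using scale[of 0 0 0] by simp
  next
    case False
    moreover have "\<forall>u\<in>S. u \<noteq> 0 \<longrightarrow> \<rho> u u > 0" using ip by (simp add: inner_product_on_def)
    ultimately have "\<rho> (P u) (P u) > 0" using PS[of u] by blast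
    then show ?thesis by (simp add: R_def)
  qed
  moreover have "R u v = \<rho> u v" if "u \<in> S" "v \<in> S" for u v
    using that B(3) by (simp add: R_def P_def)
  ultimately show ?thesis using that sym bilinear_conv_bounded_bilinear by blast
qed

text \<open>Expanding in a basis bounds \<open>N\<close> by a multiple of the Euclidean norm, whence \<open>N\<close> is continuous.\<close>

lemma norm_on_subspace_lower_bound:
  fixes S :: "'a::euclidean_space set"
  assumes S: "subspace S" and N: "norm_on S N"
  obtains m where "m > 0" "\<And>u. u \<in> S \<Longrightarrow> m * norm u \<le> N u"
proof -
  obtain B where B: "finite B" "B \<subseteq> S" "\<And>x. x \<in> S \<Longrightarrow> (\<Sum>b\<in>B. (x \<bullet> b) *\<^sub>R b) = x"
    by (rule orthonormal_basis_of_subspace[OF S]) blast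
  have N1: "N u \<ge> 0" "N u = 0 \<longleftrightarrow> u = 0" "N (c *\<^sub>R u) = \<bar>c\<bar> * N u" if "u \<in> S" for u c
    using N that unfolding norm_on_def by blast+
  have N2: "N (u + v) \<le> N u + N v" if "u \<in> S" "v \<in> S" for u v
    using N that unfolding norm_on_def by blast
  have N0: "N 0 = 0" using N1(2)[OF subspace_0[OF S]] by simp
  have Nsum: "N (\<Sum>b\<in>B'. c b *\<^sub>R b) \<le> (\<Sum>b\<in>B'. \<bar>c b\<bar> * N b)" if "B' \<subseteq> B" for B' c
    using finite_subset[OF that B(1)] that
  proof (induction B')
    case (insert b B')
    have "N (c b *\<^sub>R b + (\<Sum>b\<in>B'. c b *\<^sub>R b)) \<le> N (c b *\<^sub>R b) + N (\<Sum>b\<in>B'. c b *\<^sub>R b)"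
      using insert.prems B(2) by (intro N2 subspace_scale[OF S] subspace_sum[OF S]) auto
    moreover have "N (c b *\<^sub>R b) = \<bar>c b\<bar> * N b" using insert.prems B(2) by (intro N1) auto
    ultimately show ?case using insert by simp
  qed (simp add: N0)
  define M where "M = (\<Sum>b\<in>B. norm b * N b)"
  have M: "N u \<le> M * norm u" if "u \<in> S" for u
  proof -
    have "N u \<le> (\<Sum>b\<in>B. \<bar>u \<bullet> b\<bar> * N b)" using Nsum[of B "\<lambda>b. u \<bullet> b"] B(3)[OF that] by simp
    also have "\<dots> \<le> (\<Sum>b\<in>B. norm u * norm b * N b)"
      using B(2) N1(1) by (intro sum_mono mult_right_mono Cauchy_Schwarz_ineq2) auto
    also have "\<dots> = norm u * M" by (simp add: M_def sum_distrib_left mult.assoc)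
    finally show ?thesis by (simp add: mult.commute)
  qed
  have "M \<ge> 0" unfolding M_def using B(2) N1(1) by (intro sum_nonneg mult_nonneg_nonneg) auto
  have "dist (N x) (N y) \<le> M * dist x y" if "x \<in> S" "y \<in> S" for x y
  proof -
    have "x - y \<in> S" "y - x \<in> S" using that subspace_diff[OF S] by auto
    then have "N x \<le> N (x - y) + N y" "N y \<le> N (y - x) + N x" "N (x - y) \<le> M * norm (x - y)" "N (y - x) \<le> M * norm (y - x)"
      using N2[of "x - y" y] N2[of "y - x" x] M that by auto
    then show ?thesis by (simp add: dist_real_def dist_norm norm_minus_commute abs_le_iff)
  qed
  then have "continuous_on S N"
    by (intro lipschitz_on_continuous_on[of M] lipschitz_onI \<open>M \<ge> 0\<close>)
  moreover have "N u > 0" if "u \<in> S" "u \<noteq> 0" for u using N1[OF that(1)] that by (simp add: less_le)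
  ultimately show ?thesis
    using homogeneous_lower_bound[OF S _ N1(3)] that by blast
qed

section \<open>Horizontal curves and their controls\<close>

locale two_step_sub_riemannian = lie_group_atlas A
  for A :: "('g::{mult_group, t2_space, second_countable_topology}, 'e::euclidean_space) chart set" +
  fixes \<Delta> :: "'g \<Rightarrow> 'e set" and \<rho> :: "'g \<Rightarrow> 'e \<Rightarrow> 'e \<Rightarrow> real"
  assumes two_step: "two_step_nilpotent A" and sub_riemannian: "sub_riemannian A \<Delta> \<rho>"
begin

abbreviation br :: "'e \<Rightarrow> 'e \<Rightarrow> 'e" where "br \<equiv> lie_bracket A"

lemma subspace_horizontal: "subspace (\<Delta> p)"
  using sub_riemannian by (simp add: sub_riemannian_def)

lemma inner_product_horizontal: "inner_product_on (\<Delta> p) (\<rho> p)"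
  using sub_riemannian by (simp add: sub_riemannian_def)

lemma tangent_translation:
  "tangent_map A A (\<lambda>x. p * x) 1 = frechet_derivative (\<lambda>x. coord_at A p (p * coi x)) (at e1)"
  by (simp add: tangent_map_def o_def e1_def co_def coi_def)

lemma horizontal_translate: "\<Delta> p = tangent_map A A (\<lambda>x. p * x) 1 ` \<Delta> 1"
proof -
  have "\<Delta> (p * 1) = tangent_map A A (\<lambda>x. p * x) 1 ` \<Delta> 1"
    using sub_riemannian unfolding sub_riemannian_def by blast
  then show ?thesis by simp
qed

lemma metric_translate:
  assumes "u \<in> \<Delta> 1" "v \<in> \<Delta> 1"
  shows "\<rho> p (tangent_map A A (\<lambda>x. p * x) 1 u) (tangent_map A A (\<lambda>x. p * x) 1 v) = \<rho> 1 u v"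
proof -
  have "\<rho> (p * 1) (tangent_map A A (\<lambda>x. p * x) 1 u) (tangent_map A A (\<lambda>x. p * x) 1 v) = \<rho> 1 u v"
    using sub_riemannian assms unfolding sub_riemannian_def by blast
  then show ?thesis by simp
qed

text \<open>The velocity in the preferred chart at \<open>\<gamma> t\<close> is the left translate of the left derivative.\<close>

lemma velocity_eq:
  assumes d: "has_left_derivative \<gamma> u t {0..1}" and t: "t \<in> {0..1}"
  shows "(coord_at A (\<gamma> t) \<circ> \<gamma>) differentiable (at t within {0..1})"
    and "velocity A \<gamma> t = tangent_map A A (\<lambda>x. \<gamma> t * x) 1 u"
proof -
  have "((\<lambda>s. coord_at A (\<gamma> t) (1 * \<gamma> s)) has_vector_derivative
      frechet_derivative (\<lambda>x. coord_at A (\<gamma> t) (1 * \<gamma> t * coi x)) (at e1) u) (at t within {0..1})"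
    by (rule has_left_derivative_chart[OF d chart_at_pair]) (simp add: chart_at_mem)
  then have "((coord_at A (\<gamma> t) \<circ> \<gamma>) has_vector_derivative tangent_map A A (\<lambda>x. \<gamma> t * x) 1 u) (at t within {0..1})"
    by (simp add: o_def tangent_translation)
  then show "(coord_at A (\<gamma> t) \<circ> \<gamma>) differentiable (at t within {0..1})"
    "velocity A \<gamma> t = tangent_map A A (\<lambda>x. \<gamma> t * x) 1 u"
    using t by (auto simp: velocity_def intro: differentiableI_vector vector_derivative_within_closed_interval)
qed

lemma controlled_imp_horizontal:
  assumes \<gamma>: "controlled \<gamma> u" and u: "AE t in lebesgue. t \<in> {0..1} \<longrightarrow> u t \<in> \<Delta> 1"
  shows "horizontal_curve A \<Delta> \<gamma>"
    and "curve_length A \<rho> \<gamma> = (\<integral>\<^sup>+t\<in>{0..1}. ennreal (sqrt (\<rho> 1 (u t) (u t))) \<partial>lebesgue)"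
proof -
  have d: "AE t in lebesgue. t \<in> {0..1} \<longrightarrow> has_left_derivative \<gamma> (u t) t {0..1}"
    using \<gamma> by (simp add: controlled_def)
  have "AE t in lebesgue. t \<in> {0..1} \<longrightarrow>
      (coord_at A (\<gamma> t) \<circ> \<gamma>) differentiable (at t within {0..1}) \<and> velocity A \<gamma> t \<in> \<Delta> (\<gamma> t)"
    using d u
  proof eventually_elim
    case (elim t)
    then show ?case using velocity_eq[of \<gamma> "u t" t] horizontal_translate[of "\<gamma> t"] by auto
  qed
  then show "horizontal_curve A \<Delta> \<gamma>"
    using \<gamma> by (simp add: horizontal_curve_def controlled_def locally_ac_imp_abs_continuous_curve)
  show "curve_length A \<rho> \<gamma> = (\<integral>\<^sup>+t\<in>{0..1}. ennreal (sqrt (\<rho> 1 (u t) (u t))) \<partial>lebesgue)"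
    unfolding curve_length_def
  proof (rule nn_integral_cong_AE)
    show "AE t in lebesgue. ennreal (sqrt (\<rho> (\<gamma> t) (velocity A \<gamma> t) (velocity A \<gamma> t))) * indicator {0..1} t =
        ennreal (sqrt (\<rho> 1 (u t) (u t))) * indicator {0..1} t"
      using d u
    proof eventually_elim
      case (elim t)
      then show ?case
        using velocity_eq(2)[of \<gamma> "u t" t] metric_translate[of "u t" "u t" "\<gamma> t"]
        by (cases "t \<in> {0..1}") auto
    qed
  qed
qed

text \<open>The control is the velocity translated back to the identity; where the velocity is not horizontal,
  on a null set, the control is \<open>0\<close>, so that it lies in \<open>\<Delta> 1\<close> at all times.\<close>

lemma horizontal_imp_controlled:
  assumes "horizontal_curve A \<Delta> \<gamma>"
  shows "\<exists>u. controlled \<gamma> u \<and> (\<forall>t. u t \<in> \<Delta> 1)"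
proof -
  define u where "u t = (if velocity A \<gamma> t \<in> \<Delta> (\<gamma> t)
    then SOME v. v \<in> \<Delta> 1 \<and> velocity A \<gamma> t = tangent_map A A (\<lambda>x. \<gamma> t * x) 1 v else 0)" for t
  have u: "u t \<in> \<Delta> 1 \<and> velocity A \<gamma> t = tangent_map A A (\<lambda>x. \<gamma> t * x) 1 (u t)"
    if "velocity A \<gamma> t \<in> \<Delta> (\<gamma> t)" for t
  proof -
    have "\<exists>v. v \<in> \<Delta> 1 \<and> velocity A \<gamma> t = tangent_map A A (\<lambda>x. \<gamma> t * x) 1 v"
      using that unfolding horizontal_translate[of "\<gamma> t"] by blast
    from someI_ex[OF this] show ?thesis using that by (simp add: u_def)
  qed
  have "u t \<in> \<Delta> 1" for t
    using u[of t] subspace_0[OF subspace_horizontal] by (cases "velocity A \<gamma> t \<in> \<Delta> (\<gamma> t)") (auto simp: u_def)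
  moreover have ac: "locally_ac \<gamma>"
    using assms by (simp add: horizontal_curve_def abs_continuous_curve_imp_locally_ac)
  moreover have "AE t in lebesgue. t \<in> {0..1} \<longrightarrow> has_left_derivative \<gamma> (u t) t {0..1}"
  proof -
    have "AE t in lebesgue. t \<in> {0..1} \<longrightarrow>
      (coord_at A (\<gamma> t) \<circ> \<gamma>) differentiable (at t within {0..1}) \<and> velocity A \<gamma> t \<in> \<Delta> (\<gamma> t)"
      using assms by (simp add: horizontal_curve_def)
    then show ?thesis
    proof eventually_elim
      case (elim t)
      show ?case
      proof
        assume t: "t \<in> {0..1}"
        with elim have e: "(coord_at A (\<gamma> t) \<circ> \<gamma>) differentiable (at t within {0..1})" "velocity A \<gamma> t \<in> \<Delta> (\<gamma> t)" by auto
        have "((coord_at A (\<gamma> t) \<circ> \<gamma>) has_vector_derivative velocity A \<gamma> t) (at t within {0..1})"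
          using e(1) by (simp add: velocity_def vector_derivative_works)
        then have "((\<lambda>s. coord_at A (\<gamma> t) (\<gamma> s)) has_vector_derivative
            frechet_derivative (\<lambda>x. coord_at A (\<gamma> t) (\<gamma> t * coi x)) (at e1) (u t)) (at t within {0..1})"
          using u[OF e(2)] by (simp add: o_def tangent_translation)
        from has_left_derivative_of_chart[OF locally_ac_continuous_within[OF ac t] chart_at_pair chart_at_mem(2) this]
          translation_derivatives_inverse[OF chart_at_pair chart_at_mem(2), of "\<gamma> t" "u t"]
        show "has_left_derivative \<gamma> (u t) t {0..1}" by simp
      qed
    qed
  qed
  ultimately show ?thesis by (intro exI[of _ u]) (simp add: controlled_def)
qed

section \<open>The derived algebra\<close>

lemma bracket_mem_derived: "br v w \<in> derived_algebra A"
  unfolding bracket_space_def by (rule span_base) blast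

lemma subspace_derived: "subspace (derived_algebra A)"
  unfolding bracket_space_def by (rule subspace_span)

lemma bracket_derived_right:
  assumes "z \<in> derived_algebra A"
  shows "br v z = 0"
proof -
  have "br v z \<in> bracket_space A UNIV (derived_algebra A)"
    using assms unfolding bracket_space_def[of A UNIV "derived_algebra A"] by (intro span_base) blast
  then show ?thesis using two_step by (simp add: two_step_nilpotent_def)
qed

lemma bracket_derived_left: "z \<in> derived_algebra A \<Longrightarrow> br z v = 0"
  using bracket_derived_right lie_bracket_antisym[of z v] by simp

lemma Ad_ep: "Ad (ep X t) w = w + t *\<^sub>R br X w"
  by (rule Ad_ep_two_step) (rule bracket_derived_right[OF bracket_mem_derived])

lemma Ad_ep_derived: "z \<in> derived_algebra A \<Longrightarrow> Ad (ep z t) w = w"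
  by (rule Ad_ep_central) (rule bracket_derived_right)

lemma lie_exp_add_derived:
  "z \<in> derived_algebra A \<Longrightarrow> lie_exp A (z + w) = lie_exp A z * lie_exp A w"
  by (rule lie_exp_add_central) (rule bracket_derived_right)

text \<open>Modulo \<open>[\<gg>, \<gg>]\<close>, which is central, the horizontal space is all of \<open>\<gg>\<close>; hence brackets of
  horizontal vectors already span \<open>[\<gg>, \<gg>]\<close>.\<close>

lemma derived_algebra_horizontal:
  "derived_algebra A = span {br v w | v w. v \<in> \<Delta> 1 \<and> w \<in> \<Delta> 1}"
proof
  define Z where "Z = span {br v w | v w. v \<in> \<Delta> 1 \<and> w \<in> \<Delta> 1}"
  have ZD: "Z \<subseteq> derived_algebra A"
    unfolding Z_def by (intro span_minimal subspace_derived) (auto simp: bracket_mem_derived)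
  then show "span {br v w | v w. v \<in> \<Delta> 1 \<and> w \<in> \<Delta> 1} \<subseteq> derived_algebra A" by (simp add: Z_def)
  define W where "W = {x + y | x y. x \<in> \<Delta> 1 \<and> y \<in> Z}"
  have Zs: "subspace Z" by (simp add: Z_def)
  have W: "\<exists>v z. x = v + z \<and> v \<in> \<Delta> 1 \<and> z \<in> Z" if "x \<in> W" for x using that by (auto simp: W_def)
  have brW: "br x y \<in> Z" if xy: "x \<in> W" "y \<in> W" for x y
  proof -
    obtain v z where v: "x = v + z" "v \<in> \<Delta> 1" "z \<in> Z" using W[OF xy(1)] by blast
    obtain w z' where w: "y = w + z'" "w \<in> \<Delta> 1" "z' \<in> Z" using W[OF xy(2)] by blast
    have "br x y = br v w"
      using v w ZD bracket_derived_right bracket_derived_left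
      by (simp add: linear_add[OF lie_bracket_linear_right] linear_add[OF lie_bracket_linear_left] subset_iff)
    then show ?thesis unfolding Z_def using v(2) w(2) by (auto intro: span_base)
  qed
  have "lie_subalgebra A W"
    unfolding lie_subalgebra_def
  proof
    show "subspace W" unfolding W_def by (intro subspace_sums subspace_horizontal Zs)
    show "\<forall>v\<in>W. \<forall>w\<in>W. br v w \<in> W"
    proof (intro ballI)
      fix v w assume "v \<in> W" "w \<in> W"
      from brW[OF this] have "0 + br v w \<in> W" unfolding W_def using subspace_0[OF subspace_horizontal] by blast
      then show "br v w \<in> W" by simp
    qed
  qed
  moreover have "\<Delta> 1 \<subseteq> W"
  proof
    fix x assume "x \<in> \<Delta> 1"
    then have "x + 0 \<in> W" unfolding W_def using subspace_0[OF Zs] by blast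
    then show "x \<in> W" by simp
  qed
  ultimately have "lie_subalgebra A hull \<Delta> 1 \<subseteq> W" by (intro hull_minimal)
  then have "W = UNIV" using sub_riemannian by (simp add: sub_riemannian_def top.extremum_unique)
  then show "derived_algebra A \<subseteq> span {br v w | v w. v \<in> \<Delta> 1 \<and> w \<in> \<Delta> 1}"
    unfolding bracket_space_def Z_def[symmetric]
    by (intro span_minimal Zs) (use brW in auto)
qed

text \<open>For a single \<open>b\<close> in the derived algebra, right multiplication by \<open>ep b (c t)\<close> adds \<open>c' (t) b\<close> to the
  control by the product rule, since \<open>Ad (ep b (c t))\<close> is the identity.  The general case is an induction
  over a basis.\<close>

lemma controlled_mult_central:
  assumes \<gamma>: "controlled \<gamma> u" and q: "q absolutely_integrable_on {0..1}"
    and qZ: "\<And>t. t \<in> {0..1} \<Longrightarrow> q t \<in> derived_algebra A"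
  shows "controlled (\<lambda>t. \<gamma> t * lie_exp A (integral {0..t} q)) (\<lambda>t. u t + q t)"
proof -
  obtain B where B: "finite B" "B \<subseteq> derived_algebra A"
    "\<And>x. x \<in> derived_algebra A \<Longrightarrow> (\<Sum>b\<in>B. (x \<bullet> b) *\<^sub>R b) = x"
    by (rule orthonormal_basis_of_subspace[OF subspace_derived]) blast
  define c where "c b t = integral {0..t} (\<lambda>t. q t \<bullet> b)" for b t
  have qb: "(\<lambda>t. q t \<bullet> b) absolutely_integrable_on {0..1}" for b
    using absolutely_integrable_linear[OF q bounded_linear_inner_left[of b]] by (simp add: o_def)
  have cb: "controlled (\<lambda>t. ep b (c b t)) (\<lambda>t. (q t \<bullet> b) *\<^sub>R b)" for b
  proof (rule controlled_ep)
    show "abs_continuous_on 0 1 (c b)" unfolding c_def by (rule abs_continuous_on_indefinite_integral[OF qb])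
    show "AE t in lebesgue. t \<in> {0..1} \<longrightarrow> (c b has_real_derivative q t \<bullet> b) (at t within {0..1})"
      unfolding c_def by (rule AE_indefinite_integral_has_derivative_within[OF qb])
  qed
  have sumD: "(\<Sum>b\<in>B'. c b t *\<^sub>R b) \<in> derived_algebra A" if "B' \<subseteq> B" for B' t
    using that B(2) by (intro subspace_sum[OF subspace_derived] subspace_scale[OF subspace_derived]) auto
  have "controlled (\<lambda>t. \<gamma> t * lie_exp A (\<Sum>b\<in>B'. c b t *\<^sub>R b)) (\<lambda>t. u t + (\<Sum>b\<in>B'. (q t \<bullet> b) *\<^sub>R b))" if "B' \<subseteq> B" for B'
    using finite_subset[OF that B(1)] that
  proof (induction B')
    case empty
    then show ?case using \<gamma> by simp
  next
    case (insert b B')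
    have b: "b \<in> derived_algebra A" using insert.prems B(2) by auto
    have "controlled (\<lambda>t. \<gamma> t * lie_exp A (\<Sum>b\<in>B'. c b t *\<^sub>R b) * ep b (c b t))
        (\<lambda>t. Ad (inverse (ep b (c b t))) (u t + (\<Sum>b\<in>B'. (q t \<bullet> b) *\<^sub>R b)) + (q t \<bullet> b) *\<^sub>R b)"
      using insert by (intro controlled_mult cb) auto
    moreover have "\<gamma> t * lie_exp A (\<Sum>b\<in>B'. c b t *\<^sub>R b) * ep b (c b t) = \<gamma> t * lie_exp A (\<Sum>b\<in>insert b B'. c b t *\<^sub>R b)" for t
      using lie_exp_add_derived[OF sumD[of B' t], of "c b t *\<^sub>R b"] insert
      by (simp add: ep_def mult.assoc add.commute)
    moreover have "Ad (inverse (ep b (c b t))) (u t + (\<Sum>b\<in>B'. (q t \<bullet> b) *\<^sub>R b)) + (q t \<bullet> b) *\<^sub>R b =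
        u t + (\<Sum>b\<in>insert b B'. (q t \<bullet> b) *\<^sub>R b)" for t
      using insert.hyps by (simp add: ep_minus[symmetric] Ad_ep_derived[OF b] algebra_simps)
    ultimately show ?case by simp
  qed
  from this[of B] have 1: "controlled (\<lambda>t. \<gamma> t * lie_exp A (\<Sum>b\<in>B. c b t *\<^sub>R b)) (\<lambda>t. u t + (\<Sum>b\<in>B. (q t \<bullet> b) *\<^sub>R b))"
    by simp
  have 2: "integral {0..t} q = (\<Sum>b\<in>B. c b t *\<^sub>R b)" if t: "t \<in> {0..1}" for t
  proof -
    have i: "(\<lambda>t. q t \<bullet> b) integrable_on {0..t}" for b
      using t by (intro set_lebesgue_integral_eq_integral(1) absolutely_integrable_on_subinterval[OF qb]) auto
    have "integral {0..t} q = integral {0..t} (\<lambda>t. \<Sum>b\<in>B. (q t \<bullet> b) *\<^sub>R b)"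
      by (rule integral_cong) (use t B(3) qZ in auto)
    also have "\<dots> = (\<Sum>b\<in>B. integral {0..t} (\<lambda>t. (q t \<bullet> b) *\<^sub>R b))"
      using i B(1) by (intro integral_sum integrable_on_scaleR_left)
    also have "\<dots> = (\<Sum>b\<in>B. c b t *\<^sub>R b)"
      using i unfolding c_def by (intro sum.cong refl integral_unique has_integral_scaleR_left integrable_integral)
    finally show ?thesis .
  qed
  have "locally_ac (\<lambda>t. \<gamma> t * lie_exp A (\<Sum>b\<in>B. c b t *\<^sub>R b))" using 1 by (simp add: controlled_def)
  then have ac: "locally_ac (\<lambda>t. \<gamma> t * lie_exp A (integral {0..t} q))"
    by (rule locally_ac_cong) (simp add: 2)
  show ?thesis
    unfolding controlled_def
  proof
    show "AE t in lebesgue. t \<in> {0..1} \<longrightarrow> has_left_derivative (\<lambda>t. \<gamma> t * lie_exp A (integral {0..t} q)) (u t + q t) t {0..1}"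
    proof -
      have "AE t in lebesgue. t \<in> {0..1} \<longrightarrow> has_left_derivative (\<lambda>t. \<gamma> t * lie_exp A (\<Sum>b\<in>B. c b t *\<^sub>R b)) (u t + (\<Sum>b\<in>B. (q t \<bullet> b) *\<^sub>R b)) t {0..1}"
        using 1 by (simp add: controlled_def)
      then show ?thesis
      proof eventually_elim
        case (elim t)
        show ?case
        proof
          assume t: "t \<in> {0..1}"
          have "has_left_derivative (\<lambda>t. \<gamma> t * lie_exp A (\<Sum>b\<in>B. c b t *\<^sub>R b)) (u t + q t) t {0..1}"
            using elim t B(3)[OF qZ[OF t]] by simp
          then show "has_left_derivative (\<lambda>t. \<gamma> t * lie_exp A (integral {0..t} q)) (u t + q t) t {0..1}"
            by (rule has_left_derivative_cong) (use 2 t in simp_all)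
        qed
      qed
    qed
  qed (rule ac)
qed

end

section \<open>Oscillating functions\<close>

text \<open>The value \<open>2\<close> makes the sine polynomial with the coefficients \<open>a j\<close> a unit vector of \<open>L\<^sup>2\<close>.\<close>

lemma linear_relation_squares:
  fixes f :: "nat \<Rightarrow> 'a::euclidean_space"
  assumes n: "n > DIM('a)"
  obtains a where "(\<Sum>j\<in>{1..n}. (a j)\<^sup>2) = (2::real)" "(\<Sum>j\<in>{1..n}. a j *\<^sub>R f j) = 0"
proof -
  have "\<exists>a. (\<exists>j\<in>{1..n}. a j \<noteq> 0) \<and> (\<Sum>j\<in>{1..n}. a j *\<^sub>R f j) = 0"
  proof (cases "inj_on f {1..n}")
    case True
    have "dependent (f ` {1..n})"
      by (rule dependent_biggerset) (use n card_image[OF True] in auto)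
    then obtain u where u: "\<exists>v\<in>f ` {1..n}. u v \<noteq> 0" "(\<Sum>v\<in>f ` {1..n}. u v *\<^sub>R v) = 0"
      using dependent_finite[of "f ` {1..n}"] by blast
    then show ?thesis
      using sum.reindex[OF True, of "\<lambda>v. u v *\<^sub>R v"] by (intro exI[of _ "\<lambda>j. u (f j)"]) (auto simp: o_def)
  next
    case False
    then obtain i k where ik: "i \<in> {1..n}" "k \<in> {1..n}" "i \<noteq> k" "f i = f k" by (auto simp: inj_on_def)
    define a where "a j = (if j = i then 1 else if j = k then -1 else (0::real))" for j
    have "(\<Sum>j\<in>{1..n}. a j *\<^sub>R f j) = (\<Sum>j\<in>{i, k}. a j *\<^sub>R f j)"
      using ik by (intro sum.mono_neutral_right) (auto simp: a_def)
    also have "\<dots> = 0" using ik by (simp add: a_def)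
    finally show ?thesis using ik by (intro exI[of _ a]) (auto simp: a_def)
  qed
  then obtain a j where a: "j \<in> {1..n}" "a j \<noteq> 0" "(\<Sum>j\<in>{1..n}. a j *\<^sub>R f j) = 0" by blast
  define S where "S = (\<Sum>j\<in>{1..n}. (a j)\<^sup>2)"
  have "0 < (a j)\<^sup>2" using a(2) by simp
  also have "\<dots> \<le> S" unfolding S_def using a(1) by (intro member_le_sum) auto
  finally have S: "S > 0" .
  show ?thesis
  proof (rule that[of "\<lambda>j. sqrt (2 / S) * a j"])
    show "(\<Sum>j\<in>{1..n}. (sqrt (2 / S) * a j)\<^sup>2) = 2"
    proof -
      have "(\<Sum>j\<in>{1..n}. (sqrt (2 / S) * a j)\<^sup>2) = (\<Sum>j\<in>{1..n}. (2 / S) * (a j)\<^sup>2)"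
        using S by (intro sum.cong refl) (simp add: power_mult_distrib)
      also have "\<dots> = (2 / S) * S" unfolding S_def by (rule sum_distrib_left[symmetric])
      finally show ?thesis using S by simp
    qed
    have "(\<Sum>j\<in>{1..n}. (sqrt (2 / S) * a j) *\<^sub>R f j) = sqrt (2 / S) *\<^sub>R (\<Sum>j\<in>{1..n}. a j *\<^sub>R f j)"
      by (simp add: scaleR_sum_right)
    then show "(\<Sum>j\<in>{1..n}. (sqrt (2 / S) * a j) *\<^sub>R f j) = 0" using a(3) by simp
  qed
qed

lemma sin_2pi_nat [simp]: "sin (2 * pi * real n) = 0" and cos_2pi_nat [simp]: "cos (2 * pi * real n) = 1"
  using sin_2npi[of n] cos_2npi[of n] by (simp_all add: mult.commute mult.left_commute)

lemma has_integral_sin_sin: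
  assumes "i \<ge> 1" "j \<ge> 1"
  shows "((\<lambda>x. sin (2 * pi * real i * x) * sin (2 * pi * real j * x)) has_integral (if i = j then 1 / 2 else 0)) {0..1}"
proof (cases "i = j")
  case True
  have "((\<lambda>x. sin (2 * pi * real i * x) * sin (2 * pi * real i * x)) has_integral
      (1 / 2 - sin (2 * (2 * pi * real i * 1)) / (8 * pi * real i)) - (0 / 2 - sin (2 * (2 * pi * real i * 0)) / (8 * pi * real i))) {0..1}"
  proof (rule fundamental_theorem_of_calculus)
    fix x :: real
    have "((\<lambda>x. x / 2 - sin (2 * (2 * pi * real i * x)) / (8 * pi * real i)) has_real_derivative
        1 / 2 - cos (2 * (2 * pi * real i * x)) / 2) (at x within {0..1})"
      using assms by (auto intro!: derivative_eq_intros simp: field_simps)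
    moreover have "1 / 2 - cos (2 * (2 * pi * real i * x)) / 2 = sin (2 * pi * real i * x) * sin (2 * pi * real i * x)"
      unfolding cos_double_sin by (simp add: power2_eq_square field_simps)
    ultimately show "((\<lambda>x. x / 2 - sin (2 * (2 * pi * real i * x)) / (8 * pi * real i)) has_vector_derivative
        sin (2 * pi * real i * x) * sin (2 * pi * real i * x)) (at x within {0..1})"
      by (simp add: has_real_derivative_iff_has_vector_derivative)
  qed simp
  then show ?thesis using True sin_2npi[of "2 * i"] by (simp add: mult.commute mult.left_commute sin_double)
next
  case False
  define p where "p = 2 * pi * (real i - real j)"
  define q where "q = 2 * pi * (real i + real j)"
  have pq: "p \<noteq> 0" "q \<noteq> 0" using assms False by (auto simp: p_def q_def)
  have s: "sin p = 0" "sin q = 0"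
    by (simp_all add: p_def q_def right_diff_distrib distrib_left sin_diff sin_add)
  have "((\<lambda>x. sin (2 * pi * real i * x) * sin (2 * pi * real j * x)) has_integral
      (sin (p * 1) / (2 * p) - sin (q * 1) / (2 * q)) - (sin (p * 0) / (2 * p) - sin (q * 0) / (2 * q))) {0..1}"
  proof (rule fundamental_theorem_of_calculus)
    fix x :: real
    have "((\<lambda>x. sin (p * x) / (2 * p) - sin (q * x) / (2 * q)) has_real_derivative
        cos (p * x) / 2 - cos (q * x) / 2) (at x within {0..1})"
      using pq by (auto intro!: derivative_eq_intros simp: field_simps)
    moreover have "cos (p * x) / 2 - cos (q * x) / 2 = sin (2 * pi * real i * x) * sin (2 * pi * real j * x)"
    proof -
      have "p * x = 2 * pi * real i * x - 2 * pi * real j * x" "q * x = 2 * pi * real i * x + 2 * pi * real j * x"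
        by (simp_all add: p_def q_def algebra_simps)
      then show ?thesis by (simp only: cos_diff cos_add) (simp add: field_simps)
    qed
    ultimately show "((\<lambda>x. sin (p * x) / (2 * p) - sin (q * x) / (2 * q)) has_vector_derivative
        sin (2 * pi * real i * x) * sin (2 * pi * real j * x)) (at x within {0..1})"
      by (simp add: has_real_derivative_iff_has_vector_derivative)
  qed simp
  then show ?thesis using False by (simp add: s)
qed

text \<open>The primitive is normalized so that it vanishes at both ends of the unit interval, as the sine
  polynomial itself does.\<close>

definition osc :: "(nat \<Rightarrow> real) \<Rightarrow> nat \<Rightarrow> real \<Rightarrow> real" where
  "osc a n x = (\<Sum>j\<in>{1..n}. a j * sin (2 * pi * real j * x))"

definition osc_deriv :: "(nat \<Rightarrow> real) \<Rightarrow> nat \<Rightarrow> real \<Rightarrow> real" where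
  "osc_deriv a n x = (\<Sum>j\<in>{1..n}. a j * (2 * pi * real j * cos (2 * pi * real j * x)))"

definition osc_prim :: "(nat \<Rightarrow> real) \<Rightarrow> nat \<Rightarrow> real \<Rightarrow> real" where
  "osc_prim a n x = (\<Sum>j\<in>{1..n}. a j * ((1 - cos (2 * pi * real j * x)) / (2 * pi * real j)))"

lemma osc_has_derivative: "(osc a n has_real_derivative osc_deriv a n x) (at x within S)"
  unfolding osc_def[abs_def] osc_deriv_def
  by (auto intro!: derivative_eq_intros sum.cong simp: algebra_simps)

lemma osc_prim_has_derivative: "(osc_prim a n has_real_derivative osc a n x) (at x within S)"
  unfolding osc_def osc_prim_def[abs_def]
  by (auto intro!: derivative_eq_intros sum.cong simp: field_simps)

lemma osc_endpoints [simp]: "osc a n 0 = 0" "osc a n 1 = 0" "osc_prim a n 0 = 0" "osc_prim a n 1 = 0"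
  by (simp_all add: osc_def osc_prim_def)

lemma osc_continuous: "continuous_on S (osc a n)" "continuous_on S (osc_deriv a n)" "continuous_on S (osc_prim a n)"
  unfolding osc_def[abs_def] osc_deriv_def[abs_def] osc_prim_def[abs_def]
  by (intro continuous_intros; simp)+

lemma coefficient_bound:
  fixes a :: "nat \<Rightarrow> real"
  assumes "(\<Sum>j\<in>{1..n}. (a j)\<^sup>2) = 2" "j \<in> {1..n}"
  shows "\<bar>a j\<bar> \<le> 2"
proof -
  have "(a j)\<^sup>2 \<le> (\<Sum>j\<in>{1..n}. (a j)\<^sup>2)" using assms(2) by (intro member_le_sum) auto
  then have "\<bar>a j\<bar>\<^sup>2 \<le> 2\<^sup>2" using assms(1) by simp
  then show ?thesis by (rule power2_le_imp_le) simp
qed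

lemma osc_bounds:
  assumes a: "(\<Sum>j\<in>{1..n}. (a j)\<^sup>2) = 2"
  shows "\<bar>osc a n x\<bar> \<le> 2 * real n" "\<bar>osc_deriv a n x\<bar> \<le> 4 * pi * real n * real n"
proof -
  have "\<bar>osc a n x\<bar> \<le> (\<Sum>j\<in>{1..n}. \<bar>a j * sin (2 * pi * real j * x)\<bar>)" unfolding osc_def by (rule sum_abs)
  also have "\<dots> \<le> (\<Sum>j\<in>{1..n}. 2 * 1)"
    unfolding abs_mult using coefficient_bound[OF a] by (intro sum_mono mult_mono) auto
  finally show "\<bar>osc a n x\<bar> \<le> 2 * real n" by simp
  have "\<bar>osc_deriv a n x\<bar> \<le> (\<Sum>j\<in>{1..n}. \<bar>a j * (2 * pi * real j * cos (2 * pi * real j * x))\<bar>)"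
    unfolding osc_deriv_def by (rule sum_abs)
  also have "\<dots> \<le> (\<Sum>j\<in>{1..n}. 2 * (2 * pi * real n * 1))"
    unfolding abs_mult using coefficient_bound[OF a] by (intro sum_mono mult_mono) auto
  finally show "\<bar>osc_deriv a n x\<bar> \<le> 4 * pi * real n * real n" by (simp add: algebra_simps)
qed

lemma integral_osc_squared: "((\<lambda>x. osc a n x * osc a n x) has_integral (\<Sum>j\<in>{1..n}. (a j)\<^sup>2) / 2) {0..1}"
proof -
  have "((\<lambda>x. \<Sum>i\<in>{1..n}. \<Sum>j\<in>{1..n}. (a i * a j) * (sin (2 * pi * real i * x) * sin (2 * pi * real j * x))) has_integral
      (\<Sum>i\<in>{1..n}. \<Sum>j\<in>{1..n}. (a i * a j) * (if i = j then 1 / 2 else 0))) {0..1}"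
    by (intro has_integral_sum has_integral_mult_right has_integral_sin_sin) auto
  moreover have "(\<Sum>i\<in>{1..n}. \<Sum>j\<in>{1..n}. (a i * a j) * (sin (2 * pi * real i * x) * sin (2 * pi * real j * x))) = osc a n x * osc a n x" for x
    unfolding osc_def sum_product by (intro sum.cong refl) (simp add: algebra_simps)
  moreover have "(\<Sum>i\<in>{1..n}. \<Sum>j\<in>{1..n}. (a i * a j) * (if i = j then 1 / 2 else 0)) = (\<Sum>j\<in>{1..n}. (a j)\<^sup>2) / 2"
    by (simp add: if_distrib[of "\<lambda>x. _ * x"] sum.delta' sum_divide_distrib power2_eq_square cong: if_cong)
  ultimately show ?thesis by (simp only:)
qed

text \<open>Integration by parts.\<close>

lemma integral_osc_prim_deriv:
  "integral {0..1} (\<lambda>x. osc_prim a n x * osc_deriv a n x) = - (\<Sum>j\<in>{1..n}. (a j)\<^sup>2) / 2"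
proof -
  have "((\<lambda>x. osc_prim a n x * osc_deriv a n x + osc a n x * osc a n x) has_integral
      osc_prim a n 1 * osc a n 1 - osc_prim a n 0 * osc a n 0) {0..1}"
  proof (rule fundamental_theorem_of_calculus)
    fix x :: real
    have "((\<lambda>x. osc_prim a n x * osc a n x) has_real_derivative osc a n x * osc a n x + osc_deriv a n x * osc_prim a n x) (at x within {0..1})"
      by (intro DERIV_mult osc_has_derivative osc_prim_has_derivative)
    then show "((\<lambda>x. osc_prim a n x * osc a n x) has_vector_derivative osc_prim a n x * osc_deriv a n x + osc a n x * osc a n x) (at x within {0..1})"
      by (simp add: has_real_derivative_iff_has_vector_derivative algebra_simps)
  qed simp
  from has_integral_diff[OF this integral_osc_squared[of a n]] show ?thesis
    by (simp add: integral_unique)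
qed

lemma abs_continuous_on_compose_C1:
  assumes \<sigma>: "abs_continuous_on 0 1 \<sigma>" and im: "\<sigma> ` {0..1} \<subseteq> {0..1}"
    and d: "\<And>x. x \<in> {0..1} \<Longrightarrow> (\<psi> has_real_derivative \<psi>' x) (at x within {0..1})"
    and c: "continuous_on {0..1} \<psi>'"
  shows "abs_continuous_on 0 1 (\<lambda>t. \<psi> (\<sigma> t))"
proof -
  have "bounded (\<psi>' ` {0..1})" by (intro compact_imp_bounded compact_continuous_image c) simp
  then obtain K where K: "\<forall>x\<in>{0..1}. \<bar>\<psi>' x\<bar> \<le> K" by (auto simp: bounded_iff)
  have "dist (\<psi> x) (\<psi> y) \<le> (\<bar>K\<bar> + 1) * dist x y" if "x \<in> {0..1}" "y \<in> {0..1}" for x y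
    unfolding dist_norm
  proof (rule field_differentiable_bound[of "{0..1}" \<psi> \<psi>' "\<bar>K\<bar> + 1" x y])
    show "norm (\<psi>' z) \<le> \<bar>K\<bar> + 1" if "z \<in> {0..1}" for z using K that by fastforce
  qed (use d that in auto)
  then show ?thesis
    by (intro abs_continuous_on_compose_lipschitz[OF \<sigma> im, of "\<bar>K\<bar> + 1" \<psi>]) auto
qed

section \<open>Moving the endpoint in a central direction\<close>

context two_step_sub_riemannian
begin

text \<open>A curve whose control is \<open>u\<close> perturbed by the horizontal vector \<open>F' X + G' Y\<close>.  Multiplying by
  \<open>ep X F\<close> and \<open>ep Y G\<close> gives this control up to the brackets \<open>- q\<close>, which the last factor removes.  If
  \<open>F\<close> and \<open>G\<close> vanish at both ends, the endpoint is displaced by this factor alone.\<close>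

lemma controlled_perturbation:
  assumes \<gamma>: "controlled \<gamma> u"
    and F: "abs_continuous_on 0 1 F" "AE t in lebesgue. t \<in> {0..1} \<longrightarrow> (F has_real_derivative f t) (at t within {0..1})"
    and G: "abs_continuous_on 0 1 G" "AE t in lebesgue. t \<in> {0..1} \<longrightarrow> (G has_real_derivative g t) (at t within {0..1})"
    and q: "q = (\<lambda>t. F t *\<^sub>R br X (u t) + G t *\<^sub>R br Y (u t) + (G t * f t) *\<^sub>R br Y X)"
      "q absolutely_integrable_on {0..1}"
  shows "controlled (\<lambda>t. \<gamma> t * ep X (F t) * ep Y (G t) * lie_exp A (integral {0..t} q))
    (\<lambda>t. u t + f t *\<^sub>R X + g t *\<^sub>R Y)"
proof -
  define w1 where "w1 t = Ad (inverse (ep X (F t))) (u t) + f t *\<^sub>R X" for t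
  define w2 where "w2 t = Ad (inverse (ep Y (G t))) (w1 t) + g t *\<^sub>R Y" for t
  have "controlled (\<lambda>t. \<gamma> t * ep X (F t)) w1"
    unfolding w1_def by (intro controlled_mult \<gamma> controlled_ep F)
  then have c2: "controlled (\<lambda>t. \<gamma> t * ep X (F t) * ep Y (G t)) w2"
    unfolding w2_def by (intro controlled_mult controlled_ep G)
  have qZ: "q t \<in> derived_algebra A" for t
    unfolding q(1) by (intro subspace_add[OF subspace_derived] subspace_scale[OF subspace_derived] bracket_mem_derived)
  have w2: "w2 t + q t = u t + f t *\<^sub>R X + g t *\<^sub>R Y" for t
  proof -
    have w1: "w1 t = u t - F t *\<^sub>R br X (u t) + f t *\<^sub>R X"
      by (simp add: w1_def ep_minus[symmetric] Ad_ep)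
    have "br Y (w1 t) = br Y (u t) + f t *\<^sub>R br Y X"
      unfolding w1 by (simp add: linear_add[OF lie_bracket_linear_right] linear_diff[OF lie_bracket_linear_right]
          linear_cmul[OF lie_bracket_linear_right] bracket_derived_right[OF bracket_mem_derived])
    then have "w2 t = w1 t - G t *\<^sub>R (br Y (u t) + f t *\<^sub>R br Y X) + g t *\<^sub>R Y"
      by (simp add: w2_def ep_minus[symmetric] Ad_ep)
    then show ?thesis by (simp add: w1 q(1) algebra_simps)
  qed
  show ?thesis using controlled_mult_central[OF c2 q(2) qZ] by (simp add: w2)
qed

text \<open>Every curve with a horizontal control can be replaced by one with the same initial point whose endpoint
  is moved by \<open>lie_exp A z\<close>, at the price of adding little more than \<open>K\<close> to the square of its length.\<close>

definition displaceable :: "('e \<Rightarrow> 'e \<Rightarrow> real) \<Rightarrow> 'e \<Rightarrow> real \<Rightarrow> bool" where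
  "displaceable R z K \<longleftrightarrow> (\<forall>\<gamma> u \<epsilon>. controlled \<gamma> u \<longrightarrow> (\<forall>t. u t \<in> \<Delta> 1) \<longrightarrow> u absolutely_integrable_on {0..1} \<longrightarrow>
    (\<lambda>t. sqrt (R (u t) (u t))) absolutely_integrable_on {0..1} \<longrightarrow> \<epsilon> > 0 \<longrightarrow>
    (\<exists>\<eta> w. controlled \<eta> w \<and> (\<forall>t. w t \<in> \<Delta> 1) \<and> \<eta> 0 = \<gamma> 0 \<and> \<eta> 1 = \<gamma> 1 * lie_exp A z \<and>
      (\<integral>\<^sup>+t\<in>{0..1}. ennreal (sqrt (R (w t) (w t))) \<partial>lebesgue) \<le>
        ennreal (sqrt ((integral {0..1} (\<lambda>t. sqrt (R (u t) (u t))) + \<epsilon>)\<^sup>2 + K))))"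

lemma displaceableD:
  assumes "displaceable R z K" "controlled \<gamma> u" "\<And>t. u t \<in> \<Delta> 1" "u absolutely_integrable_on {0..1}"
    "(\<lambda>t. sqrt (R (u t) (u t))) absolutely_integrable_on {0..1}" "\<epsilon> > 0"
  obtains \<eta> w where "controlled \<eta> w" "\<And>t. w t \<in> \<Delta> 1" "\<eta> 0 = \<gamma> 0" "\<eta> 1 = \<gamma> 1 * lie_exp A z"
    "(\<integral>\<^sup>+t\<in>{0..1}. ennreal (sqrt (R (w t) (w t))) \<partial>lebesgue) \<le>
      ennreal (sqrt ((integral {0..1} (\<lambda>t. sqrt (R (u t) (u t))) + \<epsilon>)\<^sup>2 + K))"
  using assms unfolding displaceable_def by blast

lemma displaceable_mono:
  assumes d: "displaceable R z K" and "K \<le> K'"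
  shows "displaceable R z K'"
  unfolding displaceable_def
proof (intro allI impI)
  fix \<gamma> u and \<epsilon> :: real
  assume h: "controlled \<gamma> u" "\<forall>t. u t \<in> \<Delta> 1" "u absolutely_integrable_on {0..1}"
    "(\<lambda>t. sqrt (R (u t) (u t))) absolutely_integrable_on {0..1}" "\<epsilon> > 0"
  define L where "L = integral {0..1} (\<lambda>t. sqrt (R (u t) (u t))) + \<epsilon>"
  obtain \<eta> w where \<eta>: "controlled \<eta> w" "\<And>t. w t \<in> \<Delta> 1" "\<eta> 0 = \<gamma> 0" "\<eta> 1 = \<gamma> 1 * lie_exp A z"
    and le: "(\<integral>\<^sup>+t\<in>{0..1}. ennreal (sqrt (R (w t) (w t))) \<partial>lebesgue) \<le> ennreal (sqrt (L\<^sup>2 + K))"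
    unfolding L_def by (rule displaceableD[OF d h(1) spec[OF h(2)] h(3-5)]) blast
  have "ennreal (sqrt (L\<^sup>2 + K)) \<le> ennreal (sqrt (L\<^sup>2 + K'))"
    using assms(2) by (intro ennreal_leI real_sqrt_le_mono add_left_mono)
  with le have "(\<integral>\<^sup>+t\<in>{0..1}. ennreal (sqrt (R (w t) (w t))) \<partial>lebesgue) \<le> ennreal (sqrt (L\<^sup>2 + K'))"
    by (rule order_trans)
  with \<eta> show "\<exists>\<eta> w. controlled \<eta> w \<and> (\<forall>t. w t \<in> \<Delta> 1) \<and> \<eta> 0 = \<gamma> 0 \<and> \<eta> 1 = \<gamma> 1 * lie_exp A z \<and>
      (\<integral>\<^sup>+t\<in>{0..1}. ennreal (sqrt (R (w t) (w t))) \<partial>lebesgue) \<le>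
        ennreal (sqrt ((integral {0..1} (\<lambda>t. sqrt (R (u t) (u t))) + \<epsilon>)\<^sup>2 + K'))"
    unfolding L_def by blast
qed

text \<open>The curve is perturbed by a loop \<open>(F, G)\<close> that runs along it at the pace of its arc length.  The loop
  is a combination of finitely many oscillations: enough of them to satisfy the linear conditions that
  it contributes neither a first-order term to the length nor, through the interaction with \<open>u\<close>, to the
  endpoint.  The area that it encloses is nonzero because, in the arc length parameter, \<open>F\<close> is the
  derivative of \<open>G\<close>.  The number of conditions
  depends on the dimension only, so the constant does not depend on the curve.\<close>

lemma displaceable_nonneg_multiple:
  assumes R: "bounded_bilinear R" "\<And>u v. R u v = R v u" "\<And>u. R u u \<ge> (0::real)"
    and XY: "X \<in> \<Delta> 1" "Y \<in> \<Delta> 1"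
  obtains C where "C \<ge> 0" "\<And>c. c \<ge> 0 \<Longrightarrow> displaceable R (c *\<^sub>R br X Y) (C * c)"
proof -
  interpret R: bounded_bilinear R by (rule R(1))
  \<comment> \<open>one more oscillation than there are linear conditions\<close>
  define n where "n = DIM('e \<times> 'e \<times> real) + 1"
  define P where "P = 4 * pi * real n * real n"
  define Q where "Q = 2 * real n"
  define C where "C = P\<^sup>2 * R X X + 2 * (P * Q) * \<bar>R X Y\<bar> + Q\<^sup>2 * R Y Y"
  have PQ: "P \<ge> 0" "Q \<ge> 0" by (simp_all add: P_def Q_def)
  have C0: "C \<ge> 0" unfolding C_def using PQ R(3)[of X] R(3)[of Y] by simp
  show ?thesis
  proof (rule that[OF C0], unfold displaceable_def, intro allI impI)
    fix \<gamma> u and c \<epsilon> :: real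
    assume c: "c \<ge> 0" and \<gamma>: "controlled \<gamma> u" and "\<forall>t. u t \<in> \<Delta> 1" and ui: "u absolutely_integrable_on {0..1}"
      and Rui: "(\<lambda>t. sqrt (R (u t) (u t))) absolutely_integrable_on {0..1}" and \<epsilon>: "\<epsilon> > 0"
    then have u\<Delta>: "u t \<in> \<Delta> 1" for t by blast
    \<comment> \<open>the summand \<open>\<epsilon>\<close> lets \<open>\<sigma>\<close> advance also where \<open>u\<close> vanishes\<close>
    define s where "s t = sqrt (R (u t) (u t)) + \<epsilon>" for t
    define \<Lambda> where "\<Lambda> = integral {0..1} s"
    have s_pos: "s t > 0" for t using R(3) \<epsilon> by (simp add: s_def add_nonneg_pos)
    have si: "s absolutely_integrable_on {0..1}"
      unfolding s_def by (intro set_integral_add Rui) (simp add: absolutely_integrable_on_const)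
    have \<Lambda>_eq: "\<Lambda> = integral {0..1} (\<lambda>t. sqrt (R (u t) (u t))) + \<epsilon>"
      unfolding \<Lambda>_def s_def using set_lebesgue_integral_eq_integral(1)[OF Rui] by (subst integral_add) auto
    have "0 \<le> integral {0..1} (\<lambda>t. sqrt (R (u t) (u t)))"
      by (rule Henstock_Kurzweil_Integration.integral_nonneg[OF set_lebesgue_integral_eq_integral(1)[OF Rui]]) (simp add: R(3))
    then have \<Lambda>: "\<Lambda> > 0" using \<Lambda>_eq \<epsilon> by simp
    define s' where "s' t = s t / \<Lambda>" for t
    have s'i: "s' absolutely_integrable_on {0..1}"
      using set_integrable_mult_right[of "1 / \<Lambda>" lebesgue "{0..1}" s] si by (simp add: s'_def[abs_def])
    have s'_pos: "s' t \<ge> 0" for t using s_pos[of t] \<Lambda> by (simp add: s'_def)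
    define \<sigma> where "\<sigma> t = integral {0..t} s'" for t
    have \<sigma>0: "\<sigma> 0 = 0" by (simp add: \<sigma>_def)
    have \<sigma>1: "\<sigma> 1 = 1" using \<Lambda> by (simp add: \<sigma>_def s'_def[abs_def] \<Lambda>_def)
    have \<sigma>ac: "abs_continuous_on 0 1 \<sigma>" unfolding \<sigma>_def by (rule abs_continuous_on_indefinite_integral[OF s'i])
    have \<sigma>c: "continuous_on {0..1} \<sigma>" by (rule abs_continuous_on_continuous[OF \<sigma>ac])
    have \<sigma>im: "\<sigma> ` {0..1} \<subseteq> {0..1}"
    proof (rule image_subsetI)
      fix t :: real assume t: "t \<in> {0..1}"
      have i: "s' integrable_on {0..t}" "s' integrable_on {t..1}"
        using t by (auto intro!: set_lebesgue_integral_eq_integral(1) absolutely_integrable_on_subinterval[OF s'i])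
      have "0 \<le> integral {0..t} s'" "0 \<le> integral {t..1} s'"
        by (intro Henstock_Kurzweil_Integration.integral_nonneg i s'_pos)+
      then show "\<sigma> t \<in> {0..1}"
        using indefinite_integral_diff[OF s'i, of t 1] t \<sigma>1 by (simp add: \<sigma>_def)
    qed
    have \<sigma>d: "AE t in lebesgue. t \<in> {0..1} \<longrightarrow> (\<sigma> has_real_derivative s' t) (at t within {0..1})"
      unfolding \<sigma>_def by (rule AE_indefinite_integral_has_derivative_within[OF s'i])
    have comp_c: "continuous_on {0..1} (\<lambda>t. \<psi> (\<sigma> t))" if "continuous_on {0..1} \<psi>" for \<psi> :: "real \<Rightarrow> real"
      by (rule continuous_on_compose2[OF that \<sigma>c \<sigma>im])
    have brX: "(\<lambda>t. br Z (u t)) absolutely_integrable_on {0..1}" for Z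
      using absolutely_integrable_linear[OF ui linear_conv_bounded_linear[THEN iffD1, OF lie_bracket_linear_right[of Z]]]
      by (simp add: o_def)
    have RuZ: "(\<lambda>t. R (u t) Z) absolutely_integrable_on {0..1}" for Z
      using absolutely_integrable_linear[OF ui R.bounded_linear_left[of Z]] by (simp add: o_def)
    define \<phi>1 where "\<phi>1 j x = sin (2 * pi * real j * x)" for j x
    define \<phi>2 where "\<phi>2 j x = (1 - cos (2 * pi * real j * x)) / (2 * pi * real j)" for j x
    define \<phi>0 where "\<phi>0 j x = 2 * pi * real j * cos (2 * pi * real j * x)" for j x
    have \<phi>c: "continuous_on S (\<phi>0 j)" "continuous_on S (\<phi>1 j)" "continuous_on S (\<phi>2 j)" for S j
      unfolding \<phi>0_def[abs_def] \<phi>1_def[abs_def] \<phi>2_def[abs_def] divide_inverse by (intro continuous_intros)+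
    \<comment> \<open>the values on the single oscillations of the three functionals that are to vanish\<close>
    define W where "W j = (integral {0..1} (\<lambda>t. \<phi>1 j (\<sigma> t) *\<^sub>R br X (u t)),
      integral {0..1} (\<lambda>t. \<phi>2 j (\<sigma> t) *\<^sub>R br Y (u t)),
      integral {0..1} (\<lambda>t. \<phi>0 j (\<sigma> t) *\<^sub>R R (u t) X + \<phi>1 j (\<sigma> t) *\<^sub>R R (u t) Y))" for j
    obtain a where a: "(\<Sum>j\<in>{1..n}. (a j)\<^sup>2) = 2" "(\<Sum>j\<in>{1..n}. a j *\<^sub>R W j) = 0"
      by (rule linear_relation_squares[of n W]) (simp add: n_def)
    define \<kappa> where "\<kappa> = sqrt c"
    have \<kappa>: "\<kappa> * \<kappa> = c" using c by (simp add: \<kappa>_def)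
    define F where "F t = \<kappa> * osc a n (\<sigma> t)" for t
    define G where "G t = \<kappa> * osc_prim a n (\<sigma> t)" for t
    define f where "f t = \<kappa> * (osc_deriv a n (\<sigma> t) * s' t)" for t
    define g where "g t = \<kappa> * (osc a n (\<sigma> t) * s' t)" for t
    have Fac: "abs_continuous_on 0 1 F" unfolding F_def
      by (rule abs_continuous_on_compose_C1[OF \<sigma>ac \<sigma>im, of "\<lambda>x. \<kappa> * osc a n x" "\<lambda>x. \<kappa> * osc_deriv a n x"])
        (auto intro!: DERIV_cmult osc_has_derivative continuous_intros osc_continuous)
    have Gac: "abs_continuous_on 0 1 G" unfolding G_def
      by (rule abs_continuous_on_compose_C1[OF \<sigma>ac \<sigma>im, of "\<lambda>x. \<kappa> * osc_prim a n x" "\<lambda>x. \<kappa> * osc a n x"])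
        (auto intro!: DERIV_cmult osc_prim_has_derivative continuous_intros osc_continuous)
    have Fd: "AE t in lebesgue. t \<in> {0..1} \<longrightarrow> (F has_real_derivative f t) (at t within {0..1})"
      using \<sigma>d
    proof eventually_elim
      case (elim t)
      then show ?case unfolding F_def f_def
        by (intro impI DERIV_cmult DERIV_chain2[OF osc_has_derivative]) auto
    qed
    have Gd: "AE t in lebesgue. t \<in> {0..1} \<longrightarrow> (G has_real_derivative g t) (at t within {0..1})"
      using \<sigma>d
    proof eventually_elim
      case (elim t)
      then show ?case unfolding G_def g_def
        by (intro impI DERIV_cmult DERIV_chain2[OF osc_prim_has_derivative]) auto
    qed
    have Fc: "continuous_on {0..1} F" "continuous_on {0..1} G"
      using abs_continuous_on_continuous[OF Fac] abs_continuous_on_continuous[OF Gac] .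
    define \<theta> where "\<theta> x = osc_prim a n x * osc_deriv a n x" for x
    have \<theta>c: "continuous_on S \<theta>" for S unfolding \<theta>_def by (intro continuous_intros osc_continuous)
    have \<theta>i: "(\<lambda>t. s' t * \<theta> (\<sigma> t)) absolutely_integrable_on {0..1}"
      "integral {0..1} (\<lambda>t. s' t * \<theta> (\<sigma> t)) = - 1"
    proof -
      note sub = integral_substitution_indefinite_integral[OF s'i s'_pos, folded \<sigma>_def, OF \<theta>c]
      show "(\<lambda>t. s' t * \<theta> (\<sigma> t)) absolutely_integrable_on {0..1}" using sub(2) by simp
      show "integral {0..1} (\<lambda>t. s' t * \<theta> (\<sigma> t)) = - 1"
        using sub(1) integral_osc_prim_deriv[of a n] a(1) by (simp add: \<sigma>1 \<theta>_def[abs_def])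
    qed
    have Gf: "G t * f t = c * (s' t * \<theta> (\<sigma> t))" for t
      using \<kappa> by (simp add: G_def f_def \<theta>_def algebra_simps)
    define q where "q = (\<lambda>t. F t *\<^sub>R br X (u t) + G t *\<^sub>R br Y (u t) + (G t * f t) *\<^sub>R br Y X)"
    have qi1: "(\<lambda>t. F t *\<^sub>R br X (u t)) absolutely_integrable_on {0..1}"
      "(\<lambda>t. G t *\<^sub>R br Y (u t)) absolutely_integrable_on {0..1}"
      by (intro absolutely_integrable_continuous_scaleR Fc brX)+
    have qi2: "(\<lambda>t. (G t * f t) *\<^sub>R br Y X) absolutely_integrable_on {0..1}"
      unfolding Gf using absolutely_integrable_linear[OF \<theta>i(1), of "\<lambda>r. (c * r) *\<^sub>R br Y X"]
      by (simp add: o_def bounded_linear_scaleR_const bounded_linear_mult_const bounded_linear_const_mult bounded_linear_ident)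
    have qi: "q absolutely_integrable_on {0..1}" unfolding q_def by (intro set_integral_add qi1 qi2)
    have W1: "(\<Sum>j\<in>{1..n}. a j *\<^sub>R integral {0..1} (\<lambda>t. \<phi>1 j (\<sigma> t) *\<^sub>R br X (u t))) = 0"
      and W2: "(\<Sum>j\<in>{1..n}. a j *\<^sub>R integral {0..1} (\<lambda>t. \<phi>2 j (\<sigma> t) *\<^sub>R br Y (u t))) = 0"
      and W3: "(\<Sum>j\<in>{1..n}. a j *\<^sub>R integral {0..1} (\<lambda>t. \<phi>0 j (\<sigma> t) *\<^sub>R R (u t) X + \<phi>1 j (\<sigma> t) *\<^sub>R R (u t) Y)) = 0"
    proof -
      have "fst (\<Sum>j\<in>{1..n}. a j *\<^sub>R W j) = 0" "fst (snd (\<Sum>j\<in>{1..n}. a j *\<^sub>R W j)) = 0" "snd (snd (\<Sum>j\<in>{1..n}. a j *\<^sub>R W j)) = 0"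
        using a(2) by simp_all
      then show "(\<Sum>j\<in>{1..n}. a j *\<^sub>R integral {0..1} (\<lambda>t. \<phi>1 j (\<sigma> t) *\<^sub>R br X (u t))) = 0"
        "(\<Sum>j\<in>{1..n}. a j *\<^sub>R integral {0..1} (\<lambda>t. \<phi>2 j (\<sigma> t) *\<^sub>R br Y (u t))) = 0"
        "(\<Sum>j\<in>{1..n}. a j *\<^sub>R integral {0..1} (\<lambda>t. \<phi>0 j (\<sigma> t) *\<^sub>R R (u t) X + \<phi>1 j (\<sigma> t) *\<^sub>R R (u t) Y)) = 0"
        by (simp_all add: fst_sum snd_sum W_def)
    qed
    have lincomb: "integral {0..1} (\<lambda>t. \<Sum>j\<in>{1..n}. a j *\<^sub>R h j t) = (\<Sum>j\<in>{1..n}. a j *\<^sub>R integral {0..1} (h j))"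
      if "\<And>j. h j absolutely_integrable_on {0..1}" for h :: "nat \<Rightarrow> real \<Rightarrow> 'b::euclidean_space"
      using set_lebesgue_integral_eq_integral(1)[OF that] by (simp add: integral_sum integrable_cmul)
    have I1: "integral {0..1} (\<lambda>t. F t *\<^sub>R br X (u t)) = 0"
    proof -
      have "F t *\<^sub>R br X (u t) = \<kappa> *\<^sub>R (\<Sum>j\<in>{1..n}. a j *\<^sub>R (\<phi>1 j (\<sigma> t) *\<^sub>R br X (u t)))" for t
        by (simp add: F_def osc_def \<phi>1_def scaleR_sum_left[symmetric])
      then show ?thesis
        using lincomb[of "\<lambda>j t. \<phi>1 j (\<sigma> t) *\<^sub>R br X (u t)", OF absolutely_integrable_continuous_scaleR[OF comp_c[OF \<phi>c(2)] brX]] W1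
        by simp
    qed
    have I2: "integral {0..1} (\<lambda>t. G t *\<^sub>R br Y (u t)) = 0"
    proof -
      have "G t *\<^sub>R br Y (u t) = \<kappa> *\<^sub>R (\<Sum>j\<in>{1..n}. a j *\<^sub>R (\<phi>2 j (\<sigma> t) *\<^sub>R br Y (u t)))" for t
        by (simp add: G_def osc_prim_def \<phi>2_def scaleR_sum_left[symmetric])
      then show ?thesis
        using lincomb[of "\<lambda>j t. \<phi>2 j (\<sigma> t) *\<^sub>R br Y (u t)", OF absolutely_integrable_continuous_scaleR[OF comp_c[OF \<phi>c(3)] brX]] W2
        by simp
    qed
    have I3: "integral {0..1} (\<lambda>t. (G t * f t) *\<^sub>R br Y X) = c *\<^sub>R br X Y"
    proof -
      have "((\<lambda>t. (c * (s' t * \<theta> (\<sigma> t))) *\<^sub>R br Y X) has_integral (c * (- 1)) *\<^sub>R br Y X) {0..1}"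
        using integrable_integral[OF set_lebesgue_integral_eq_integral(1)[OF \<theta>i(1)]] \<theta>i(2)
        by (intro has_integral_scaleR_left has_integral_mult_right) simp
      then have "integral {0..1} (\<lambda>t. (G t * f t) *\<^sub>R br Y X) = (c * (- 1)) *\<^sub>R br Y X"
        unfolding Gf by (rule integral_unique)
      then show ?thesis using lie_bracket_antisym[of Y X] by simp
    qed
    have Iq: "integral {0..1} q = c *\<^sub>R br X Y"
    proof -
      note i = qi1[THEN set_lebesgue_integral_eq_integral(1)] qi2[THEN set_lebesgue_integral_eq_integral(1)]
      have "integral {0..1} q = integral {0..1} (\<lambda>t. F t *\<^sub>R br X (u t)) + integral {0..1} (\<lambda>t. G t *\<^sub>R br Y (u t)) +
          integral {0..1} (\<lambda>t. (G t * f t) *\<^sub>R br Y X)"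
        unfolding q_def using i by (simp add: integral_add integrable_add)
      then show ?thesis by (simp add: I1 I2 I3)
    qed
    define \<eta> where "\<eta> t = \<gamma> t * ep X (F t) * ep Y (G t) * lie_exp A (integral {0..t} q)" for t
    define w where "w t = u t + f t *\<^sub>R X + g t *\<^sub>R Y" for t
    have "controlled \<eta> w"
      unfolding \<eta>_def w_def by (rule controlled_perturbation[OF \<gamma> Fac Fd Gac Gd q_def qi])
    moreover have w\<Delta>: "\<forall>t. w t \<in> \<Delta> 1"
      unfolding w_def using XY u\<Delta> by (intro allI subspace_add[OF subspace_horizontal] subspace_scale[OF subspace_horizontal])
    moreover have "\<eta> 0 = \<gamma> 0" by (simp add: \<eta>_def F_def G_def \<sigma>0)
    moreover have "\<eta> 1 = \<gamma> 1 * lie_exp A (c *\<^sub>R br X Y)" by (simp add: \<eta>_def F_def G_def \<sigma>1 Iq)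
    moreover have "(\<integral>\<^sup>+t\<in>{0..1}. ennreal (sqrt (R (w t) (w t))) \<partial>lebesgue) \<le> ennreal (sqrt (\<Lambda>\<^sup>2 + C * c))"
    proof -
      define k where "k t = (\<kappa> / \<Lambda>) *\<^sub>R (osc_deriv a n (\<sigma> t) *\<^sub>R X + osc a n (\<sigma> t) *\<^sub>R Y)" for t
      have w: "w t = u t + s t *\<^sub>R k t" for t
        by (simp add: w_def f_def g_def k_def s'_def algebra_simps)
      have Rk: "R (k t) (k t) \<le> C * c / \<Lambda>\<^sup>2" for t
      proof -
        define p r where "p = osc_deriv a n (\<sigma> t)" and "r = osc a n (\<sigma> t)"
        have pr: "\<bar>p\<bar> \<le> P" "\<bar>r\<bar> \<le> Q" unfolding p_def r_def P_def Q_def by (rule osc_bounds[OF a(1)])+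
        have "p\<^sup>2 \<le> P\<^sup>2" "r\<^sup>2 \<le> Q\<^sup>2" "\<bar>p * r\<bar> \<le> P * Q"
          using pr PQ by (simp_all add: abs_le_square_iff[symmetric] abs_mult mult_mono)
        then have "p\<^sup>2 * R X X \<le> P\<^sup>2 * R X X" "r\<^sup>2 * R Y Y \<le> Q\<^sup>2 * R Y Y" "\<bar>p * r * R X Y\<bar> \<le> P * Q * \<bar>R X Y\<bar>"
          using R(3) by (simp_all add: mult_right_mono abs_mult[of "p * r"])
        moreover have "R (p *\<^sub>R X + r *\<^sub>R Y) (p *\<^sub>R X + r *\<^sub>R Y) = p\<^sup>2 * R X X + 2 * (p * r * R X Y) + r\<^sup>2 * R Y Y"
          by (simp add: R.add_left R.add_right R.scaleR_left R.scaleR_right R(2)[of Y X] power2_eq_square algebra_simps)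
        ultimately have "R (p *\<^sub>R X + r *\<^sub>R Y) (p *\<^sub>R X + r *\<^sub>R Y) \<le> C" unfolding C_def by (simp add: abs_le_iff)
        then have "(c / \<Lambda>\<^sup>2) * R (p *\<^sub>R X + r *\<^sub>R Y) (p *\<^sub>R X + r *\<^sub>R Y) \<le> (c / \<Lambda>\<^sup>2) * C"
          using c by (intro mult_left_mono) auto
        moreover have "R (k t) (k t) = (c / \<Lambda>\<^sup>2) * R (p *\<^sub>R X + r *\<^sub>R Y) (p *\<^sub>R X + r *\<^sub>R Y)"
          by (simp only: k_def p_def[symmetric] r_def[symmetric] R.scaleR_left R.scaleR_right)
            (simp add: power2_eq_square \<kappa>[symmetric])
        ultimately show ?thesis by (simp add: mult.commute)
      qed
      define M where "M = \<Lambda>\<^sup>2 + C * c"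
      have M: "M > 0" using \<Lambda> C0 c by (simp add: M_def add_pos_nonneg)
      define l where "l = sqrt M / \<Lambda>"
      have l: "l > 0" using M \<Lambda> by (simp add: l_def)
      define E where "E t = s t + 2 * R (u t) (k t) + s t * (C * c / \<Lambda>\<^sup>2)" for t
      define J where "J t = (E t / l + l * s t) / 2" for t
      \<comment> \<open>the inequality of arithmetic and geometric means, with the weight \<open>l\<close> that is optimal after integration\<close>
      have le: "sqrt (R (w t) (w t)) \<le> J t" for t
      proof -
        have "R (u t) (u t) = (sqrt (R (u t) (u t)))\<^sup>2" using R(3) by simp
        also have "\<dots> \<le> (s t)\<^sup>2" using \<epsilon> R(3) by (intro power_mono) (simp_all add: s_def)
        finally have 1: "R (u t) (u t) \<le> s t * s t" by (simp add: power2_eq_square)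
        have 2: "s t * s t * R (k t) (k t) \<le> s t * s t * (C * c / \<Lambda>\<^sup>2)" by (intro mult_left_mono Rk) simp
        have "R (w t) (w t) = R (u t) (u t) + 2 * s t * R (u t) (k t) + s t * s t * R (k t) (k t)"
        proof -
          have "R (k t) (u t) = R (u t) (k t)" by (rule R(2))
          then show ?thesis unfolding w by (simp add: R.add_left R.add_right R.scaleR_left R.scaleR_right algebra_simps)
        qed
        also have "\<dots> \<le> s t * E t" using 1 2 by (simp add: E_def algebra_simps)
        finally have 3: "R (w t) (w t) \<le> s t * E t" .
        then have "0 \<le> s t * E t" using R(3)[of "w t"] by linarith
        then have E0: "E t \<ge> 0" using s_pos[of t] by (simp add: zero_le_mult_iff)
        have "sqrt (R (w t) (w t)) \<le> sqrt ((E t / l) * (l * s t))"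
          using 3 l by (simp add: mult.commute)
        also have "\<dots> \<le> J t" unfolding J_def using E0 l s_pos[of t] by (intro arith_geo_mean_sqrt) auto
        finally show ?thesis .
      qed
      have Ruk: "(\<lambda>t. R (u t) (k t)) absolutely_integrable_on {0..1}" "integral {0..1} (\<lambda>t. R (u t) (k t)) = 0"
      proof -
        have eq: "R (u t) (k t) = (\<kappa> / \<Lambda>) *\<^sub>R (\<Sum>j\<in>{1..n}. a j *\<^sub>R (\<phi>0 j (\<sigma> t) *\<^sub>R R (u t) X + \<phi>1 j (\<sigma> t) *\<^sub>R R (u t) Y))" for t
        proof -
          have "R (u t) (k t) = (\<kappa> / \<Lambda>) * (osc_deriv a n (\<sigma> t) * R (u t) X + osc a n (\<sigma> t) * R (u t) Y)"
            by (simp add: k_def R.scaleR_right R.add_right)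
          also have "osc_deriv a n (\<sigma> t) * R (u t) X + osc a n (\<sigma> t) * R (u t) Y =
              (\<Sum>j\<in>{1..n}. a j * (\<phi>0 j (\<sigma> t) * R (u t) X + \<phi>1 j (\<sigma> t) * R (u t) Y))"
            unfolding osc_def osc_deriv_def \<phi>0_def \<phi>1_def sum_distrib_right sum.distrib[symmetric]
            by (intro sum.cong refl) (simp add: algebra_simps)
          finally show ?thesis by simp
        qed
        have i: "(\<lambda>t. \<phi>0 j (\<sigma> t) *\<^sub>R R (u t) X + \<phi>1 j (\<sigma> t) *\<^sub>R R (u t) Y) absolutely_integrable_on {0..1}" for j
          by (intro set_integral_add absolutely_integrable_continuous_scaleR comp_c \<phi>c RuZ)
        show "integral {0..1} (\<lambda>t. R (u t) (k t)) = 0"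
          unfolding eq using lincomb[OF i] W3 by simp
        show "(\<lambda>t. R (u t) (k t)) absolutely_integrable_on {0..1}"
          unfolding eq by (intro absolutely_integrable_scaleR_left absolutely_integrable_sum i) auto
      qed
      have Ji: "J absolutely_integrable_on {0..1}" and JI: "integral {0..1} J = sqrt M"
      proof -
        define A1 A2 where "A1 = (1 + C * c / \<Lambda>\<^sup>2) / (2 * l) + l / 2" and "A2 = 1 / l"
        have J: "J = (\<lambda>t. A1 *\<^sub>R s t + A2 *\<^sub>R R (u t) (k t))"
          using l by (auto simp: J_def E_def A1_def A2_def field_simps)
        have i: "(\<lambda>t. A1 *\<^sub>R s t) absolutely_integrable_on {0..1}" "(\<lambda>t. A2 *\<^sub>R R (u t) (k t)) absolutely_integrable_on {0..1}"
          by (intro absolutely_integrable_scaleR_left si Ruk(1))+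
        show "J absolutely_integrable_on {0..1}" unfolding J by (intro set_integral_add i)
        have "integral {0..1} J = A1 * \<Lambda> + A2 * 0"
          unfolding J using i[THEN set_lebesgue_integral_eq_integral(1)] Ruk(2)
          by (simp add: integral_add \<Lambda>_def)
        also have "\<dots> = (M / \<Lambda>) / (2 * l) + l * \<Lambda> / 2"
          using \<Lambda> l by (simp add: A1_def M_def field_simps power2_eq_square)
        also have "\<dots> = sqrt M"
        proof -
          have "(M / \<Lambda>) / (2 * l) = sqrt M / 2"
            using M \<Lambda> by (simp add: l_def real_div_sqrt)
          moreover have "l * \<Lambda> / 2 = sqrt M / 2" using \<Lambda> by (simp add: l_def)
          ultimately show ?thesis by simp
        qed
        finally show "integral {0..1} J = sqrt M" .
      qed
      have "(\<integral>\<^sup>+t\<in>{0..1}. ennreal (sqrt (R (w t) (w t))) \<partial>lebesgue) \<le> (\<integral>\<^sup>+t\<in>{0..1}. ennreal (J t) \<partial>lebesgue)"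
        by (intro nn_integral_mono mult_right_mono ennreal_leI le) simp
      also have "\<dots> = ennreal (integral {0..1} J)"
      proof (rule nn_integral_unit_interval[OF Ji])
        show "0 \<le> J t" for t using le[of t] R(3)[of "w t"] by (meson order_trans real_sqrt_ge_zero)
      qed
      finally show ?thesis by (simp add: JI M_def)
    qed
    ultimately show "\<exists>\<eta> w. controlled \<eta> w \<and> (\<forall>t. w t \<in> \<Delta> 1) \<and> \<eta> 0 = \<gamma> 0 \<and> \<eta> 1 = \<gamma> 1 * lie_exp A (c *\<^sub>R br X Y) \<and>
      (\<integral>\<^sup>+t\<in>{0..1}. ennreal (sqrt (R (w t) (w t))) \<partial>lebesgue) \<le>
        ennreal (sqrt ((integral {0..1} (\<lambda>t. sqrt (R (u t) (u t))) + \<epsilon>)\<^sup>2 + C * c))"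
      unfolding \<Lambda>_eq by blast
  qed
qed

end

section \<open>The distance after a central displacement\<close>

lemma le_ennreal_square_limit:
  assumes "\<And>\<epsilon>. \<epsilon> > 0 \<Longrightarrow> x \<le> ennreal ((l + \<epsilon>)\<^sup>2 + K)"
  shows "x \<le> ennreal (l\<^sup>2 + K)"
proof (rule tendsto_lowerbound)
  have "((\<lambda>\<epsilon>. (l + \<epsilon>)\<^sup>2 + K) \<longlongrightarrow> (l + 0)\<^sup>2 + K) (at_right 0)" by (intro tendsto_intros)
  then show "((\<lambda>\<epsilon>. ennreal ((l + \<epsilon>)\<^sup>2 + K)) \<longlongrightarrow> ennreal (l\<^sup>2 + K)) (at_right 0)"
    by (intro tendsto_ennrealI) simp
  show "\<forall>\<^sub>F \<epsilon> in at_right 0. x \<le> ennreal ((l + \<epsilon>)\<^sup>2 + K)"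
    using eventually_at_right_less[of 0] by eventually_elim (rule assms)
qed simp

context two_step_sub_riemannian
begin

lemma sr_dist_le_controlled:
  assumes c: "controlled \<gamma> u" and u: "\<forall>t. u t \<in> \<Delta> 1" and pq: "p \<in> \<gamma> ` {0..1}" "q \<in> \<gamma> ` {0..1}"
  shows "sr_dist A \<Delta> \<rho> p q \<le> (\<integral>\<^sup>+t\<in>{0..1}. ennreal (sqrt (\<rho> 1 (u t) (u t))) \<partial>lebesgue)"
proof -
  have "AE t in lebesgue. t \<in> {0..1} \<longrightarrow> u t \<in> \<Delta> 1" using u by simp
  note h = controlled_imp_horizontal[OF c this]
  show ?thesis unfolding sr_dist_def h(2)[symmetric] using h(1) pq by (intro INF_lower) simp
qed

text \<open>Multiples of either sign: \<open>- [X, Y] = [- X, Y]\<close>.\<close>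

lemma displaceable_multiple:
  assumes R: "bounded_bilinear R" "\<And>u v. R u v = R v u" "\<And>u. R u u \<ge> (0::real)"
    and XY: "X \<in> \<Delta> 1" "Y \<in> \<Delta> 1"
  obtains C where "C \<ge> 0" "\<And>c. displaceable R (c *\<^sub>R br X Y) (C * \<bar>c\<bar>)"
proof -
  have nX: "- X \<in> \<Delta> 1" using XY(1) by (rule subspace_neg[OF subspace_horizontal])
  obtain C1 where C1: "C1 \<ge> 0" "\<And>c. c \<ge> 0 \<Longrightarrow> displaceable R (c *\<^sub>R br X Y) (C1 * c)"
    by (rule displaceable_nonneg_multiple[OF R XY]) blast
  obtain C2 where C2: "C2 \<ge> 0" "\<And>c. c \<ge> 0 \<Longrightarrow> displaceable R (c *\<^sub>R br (- X) Y) (C2 * c)"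
    by (rule displaceable_nonneg_multiple[OF R nX XY(2)]) blast
  show ?thesis
  proof (rule that[of "C1 + C2"])
    show "C1 + C2 \<ge> 0" using C1(1) C2(1) by simp
    fix c :: real
    show "displaceable R (c *\<^sub>R br X Y) ((C1 + C2) * \<bar>c\<bar>)"
    proof (cases "c \<ge> 0")
      case True
      then have "C1 * c \<le> (C1 + C2) * \<bar>c\<bar>" using C2(1) by (simp add: mult_right_mono)
      with C1(2)[OF True] show ?thesis by (rule displaceable_mono)
    next
      case False
      then have "displaceable R (c *\<^sub>R br X Y) (C2 * \<bar>c\<bar>)"
        using C2(2)[of "\<bar>c\<bar>"] by (simp add: linear_neg[OF lie_bracket_linear_left])
      moreover have "C2 * \<bar>c\<bar> \<le> (C1 + C2) * \<bar>c\<bar>" using C1(1) by (simp add: mult_right_mono)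
      ultimately show ?thesis by (rule displaceable_mono)
    qed
  qed
qed

text \<open>A curve whose length is close to the distance of \<open>1\<close> and \<open>q\<close> is perturbed.  It may run from \<open>q\<close> to
  \<open>1\<close>; then its endpoint is displaced by the inverse of \<open>lie_exp A \<zeta>\<close>, and the result is translated on the
  right by \<open>lie_exp A \<zeta>\<close>, which leaves the control unchanged because \<open>Ad (lie_exp A \<zeta>)\<close> is the identity.\<close>

lemma sr_dist_bracket_displacement:
  assumes XY: "X \<in> \<Delta> 1" "Y \<in> \<Delta> 1"
  shows "\<exists>C\<ge>0. \<forall>q c. (sr_dist A \<Delta> \<rho> 1 (q * lie_exp A (c *\<^sub>R br X Y)))\<^sup>2 \<le> (sr_dist A \<Delta> \<rho> 1 q)\<^sup>2 + ennreal (C * \<bar>c\<bar>)"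
proof -
  obtain R where R: "bounded_bilinear R" "\<And>u v. R u v = R v u" "\<And>u. R u u \<ge> (0::real)"
    "\<And>u v. u \<in> \<Delta> 1 \<Longrightarrow> v \<in> \<Delta> 1 \<Longrightarrow> R u v = \<rho> 1 u v"
    by (rule inner_product_extension[OF subspace_horizontal inner_product_horizontal[of 1]]) blast
  interpret R: bounded_bilinear R by (rule R(1))
  have Rc: "continuous_on S (\<lambda>u. sqrt (R u u))" for S by (intro continuous_intros R.continuous_on)
  obtain m where m: "m > 0" "\<And>u. u \<in> \<Delta> 1 \<Longrightarrow> m * norm u \<le> sqrt (R u u)"
  proof (rule homogeneous_lower_bound[OF subspace_horizontal[of 1] Rc])
    show "sqrt (R (c *\<^sub>R u) (c *\<^sub>R u)) = \<bar>c\<bar> * sqrt (R u u)" for u c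
      by (simp add: R.scaleR_left R.scaleR_right real_sqrt_mult mult.assoc[symmetric])
    show "0 < sqrt (R u u)" if "u \<in> \<Delta> 1" "u \<noteq> 0" for u
      using inner_product_horizontal[of 1] that by (simp add: R(4) inner_product_on_def)
  qed blast
  obtain C where C: "C \<ge> 0" "\<And>c. displaceable R (c *\<^sub>R br X Y) (C * \<bar>c\<bar>)"
    by (rule displaceable_multiple[OF R(1-3) XY]) blast
  have curve: "(sr_dist A \<Delta> \<rho> 1 (q * lie_exp A (c *\<^sub>R br X Y)))\<^sup>2 \<le> (curve_length A \<rho> \<gamma>)\<^sup>2 + ennreal (C * \<bar>c\<bar>)"
    if \<gamma>: "horizontal_curve A \<Delta> \<gamma>" "1 \<in> \<gamma> ` {0..1}" "q \<in> \<gamma> ` {0..1}" for \<gamma> q and c :: real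
  proof (cases "curve_length A \<rho> \<gamma> = \<infinity>")
    case True
    then show ?thesis by (simp add: power2_eq_square ennreal_mult_top)
  next
    case False
    define \<zeta> where "\<zeta> = c *\<^sub>R br X Y"
    have \<zeta>: "\<zeta> \<in> derived_algebra A"
      unfolding \<zeta>_def by (intro subspace_scale[OF subspace_derived] bracket_mem_derived)
    obtain u where u: "controlled \<gamma> u" "\<forall>t. u t \<in> \<Delta> 1" using horizontal_imp_controlled[OF \<gamma>(1)] by blast
    obtain t0 t1 where t01: "t0 \<in> {0..1}" "t1 \<in> {0..1}" "\<gamma> t0 = 1" "\<gamma> t1 = q" using \<gamma>(2,3) by auto
    \<comment> \<open>only the part of the curve between \<open>1\<close> and \<open>q\<close> is perturbed\<close>
    define lo hi where "lo = min t0 t1" and "hi = max t0 t1"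
    have lh: "0 \<le> lo" "lo \<le> hi" "hi \<le> 1" using t01 by (auto simp: lo_def hi_def)
    define \<alpha> where "\<alpha> t = \<gamma> (max lo (min hi t))" for t
    define v where "v t = (if lo < t \<and> t < hi then u t else 0)" for t
    have \<alpha>: "controlled \<alpha> v" unfolding \<alpha>_def[abs_def] v_def[abs_def] by (rule controlled_clamp[OF u(1) lh])
    have "max lo (min hi 0) = lo" "max lo (min hi 1) = hi" using lh by (auto simp: min_def max_def)
    then have \<alpha>01: "\<alpha> 0 = \<gamma> lo" "\<alpha> 1 = \<gamma> hi" by (simp_all add: \<alpha>_def)
    have v\<Delta>: "v t \<in> \<Delta> 1" for t using u(2) subspace_0[OF subspace_horizontal] by (simp add: v_def)
    have len: "curve_length A \<rho> \<gamma> = (\<integral>\<^sup>+t\<in>{0..1}. ennreal (sqrt (R (u t) (u t))) \<partial>lebesgue)"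
      using controlled_imp_horizontal(2)[OF u(1)] u(2) R(4) by simp
    have v_le: "(\<integral>\<^sup>+t\<in>{0..1}. ennreal (sqrt (R (v t) (v t))) \<partial>lebesgue) \<le> curve_length A \<rho> \<gamma>"
      unfolding len using R(3) by (intro nn_integral_mono mult_right_mono ennreal_leI real_sqrt_le_mono) (auto simp: v_def R.zero_left)
    have vm: "v \<in> borel_measurable (lebesgue_on {0..1})" by (rule controlled_measurable[OF \<alpha>])
    have Rvm: "(\<lambda>t. sqrt (R (v t) (v t))) \<in> borel_measurable (lebesgue_on {0..1})"
      by (rule measurable_compose[OF vm borel_measurable_continuous_onI[OF Rc]])
    have Rvi: "(\<lambda>t. sqrt (R (v t) (v t))) absolutely_integrable_on {0..1}"
      using v_le False R(3) by (intro absolutely_integrable_if_finite_nn_integral Rvm) (auto simp: less_top[symmetric] top_unique)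
    have vi: "v absolutely_integrable_on {0..1}"
    proof (rule measurable_bounded_by_integrable_imp_absolutely_integrable[OF vm])
      show "(\<lambda>t. (1 / m) * sqrt (R (v t) (v t))) integrable_on {0..1}"
        by (intro integrable_on_mult_right set_lebesgue_integral_eq_integral(1)[OF Rvi])
      show "norm (v t) \<le> (1 / m) * sqrt (R (v t) (v t))" for t
        using m(1) m(2)[OF v\<Delta>[of t]] by (simp add: field_simps)
    qed simp
    define L where "L = integral {0..1} (\<lambda>t. sqrt (R (v t) (v t)))"
    have L: "L \<ge> 0" unfolding L_def
      by (rule Henstock_Kurzweil_Integration.integral_nonneg[OF set_lebesgue_integral_eq_integral(1)[OF Rvi]]) (simp add: R(3))
    have L_le: "ennreal L \<le> curve_length A \<rho> \<gamma>"
      using v_le nn_integral_unit_interval[OF Rvi] R(3) by (simp add: L_def)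
    have "(sr_dist A \<Delta> \<rho> 1 (q * lie_exp A \<zeta>))\<^sup>2 \<le> ennreal ((L + \<epsilon>)\<^sup>2 + C * \<bar>c\<bar>)" if \<epsilon>: "\<epsilon> > 0" for \<epsilon>
    proof -
      define M where "M = (L + \<epsilon>)\<^sup>2 + C * \<bar>c\<bar>"
      have M: "M \<ge> 0" using C(1) by (simp add: M_def)
      have "\<exists>\<eta> w. controlled \<eta> w \<and> (\<forall>t. w t \<in> \<Delta> 1) \<and> 1 \<in> \<eta> ` {0..1} \<and> q * lie_exp A \<zeta> \<in> \<eta> ` {0..1} \<and>
          (\<integral>\<^sup>+t\<in>{0..1}. ennreal (sqrt (R (w t) (w t))) \<partial>lebesgue) \<le> ennreal (sqrt M)"
      proof (cases "t0 \<le> t1")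
        case True
        have "displaceable R \<zeta> (C * \<bar>c\<bar>)" unfolding \<zeta>_def by (rule C(2))
        then obtain \<eta> w where \<eta>: "controlled \<eta> w" "\<And>t. w t \<in> \<Delta> 1" "\<eta> 0 = \<alpha> 0" "\<eta> 1 = \<alpha> 1 * lie_exp A \<zeta>"
          "(\<integral>\<^sup>+t\<in>{0..1}. ennreal (sqrt (R (w t) (w t))) \<partial>lebesgue) \<le> ennreal (sqrt M)"
          unfolding M_def L_def by (rule displaceableD[where R=R and u=v, OF _ \<alpha> v\<Delta> vi Rvi \<epsilon>]) blast
        have e: "\<eta> 0 = 1" "\<eta> 1 = q * lie_exp A \<zeta>"
          using True t01 by (simp_all add: \<eta>(3,4) \<alpha>01 lo_def hi_def min_def max_def)
        have "1 \<in> \<eta> ` {0..1}" by (rule image_eqI[of _ _ 0]) (simp_all add: e)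
        moreover have "q * lie_exp A \<zeta> \<in> \<eta> ` {0..1}" by (rule image_eqI[of _ _ 1]) (simp_all add: e)
        ultimately show ?thesis using \<eta>(1,2,5) by blast
      next
        case False
        have "displaceable R (- \<zeta>) (C * \<bar>c\<bar>)" using C(2)[of "- c"] by (simp add: \<zeta>_def)
        then obtain \<eta> w where \<eta>: "controlled \<eta> w" "\<And>t. w t \<in> \<Delta> 1" "\<eta> 0 = \<alpha> 0" "\<eta> 1 = \<alpha> 1 * lie_exp A (- \<zeta>)"
          "(\<integral>\<^sup>+t\<in>{0..1}. ennreal (sqrt (R (w t) (w t))) \<partial>lebesgue) \<le> ennreal (sqrt M)"
          unfolding M_def L_def by (rule displaceableD[where R=R and u=v, OF _ \<alpha> v\<Delta> vi Rvi \<epsilon>]) blast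
        define \<eta>' where "\<eta>' t = \<eta> t * lie_exp A \<zeta>" for t
        have n\<zeta>: "- \<zeta> \<in> derived_algebra A" by (rule subspace_neg[OF subspace_derived \<zeta>])
        have "Ad (inverse (lie_exp A \<zeta>)) (w t) = w t" for t
          unfolding lie_exp_minus[symmetric] unfolding lie_exp_eq_ep by (rule Ad_ep_derived[OF n\<zeta>])
        then have c': "controlled \<eta>' w"
          using controlled_mult[OF \<eta>(1) controlled_const[of "lie_exp A \<zeta>"]] by (simp add: \<eta>'_def[abs_def])
        have e: "\<eta>' 0 = q * lie_exp A \<zeta>" "\<eta>' 1 = 1"
          using False t01 by (simp_all add: \<eta>'_def \<eta>(3,4) \<alpha>01 lo_def hi_def min_def max_def lie_exp_minus mult_group_left_inverse)
        have "1 \<in> \<eta>' ` {0..1}" by (rule image_eqI[of _ _ 1]) (simp_all add: e)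
        moreover have "q * lie_exp A \<zeta> \<in> \<eta>' ` {0..1}" by (rule image_eqI[of _ _ 0]) (simp_all add: e)
        ultimately show ?thesis using c' \<eta>(2,5) by blast
      qed
      then obtain \<eta> w where \<eta>: "controlled \<eta> w" "\<forall>t. w t \<in> \<Delta> 1" "1 \<in> \<eta> ` {0..1}" "q * lie_exp A \<zeta> \<in> \<eta> ` {0..1}"
          "(\<integral>\<^sup>+t\<in>{0..1}. ennreal (sqrt (R (w t) (w t))) \<partial>lebesgue) \<le> ennreal (sqrt M)" by blast
      have "sr_dist A \<Delta> \<rho> 1 (q * lie_exp A \<zeta>) \<le> (\<integral>\<^sup>+t\<in>{0..1}. ennreal (sqrt (\<rho> 1 (w t) (w t))) \<partial>lebesgue)"
        by (rule sr_dist_le_controlled[OF \<eta>(1-4)])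
      also have "\<dots> \<le> ennreal (sqrt M)" using \<eta>(2,5) by (simp add: R(4))
      finally have "(sr_dist A \<Delta> \<rho> 1 (q * lie_exp A \<zeta>))\<^sup>2 \<le> (ennreal (sqrt M))\<^sup>2" by (intro power_mono) simp_all
      then show ?thesis using M by (simp add: ennreal_power M_def[symmetric])
    qed
    then have "(sr_dist A \<Delta> \<rho> 1 (q * lie_exp A \<zeta>))\<^sup>2 \<le> ennreal (L\<^sup>2 + C * \<bar>c\<bar>)" by (rule le_ennreal_square_limit)
    also have "\<dots> = (ennreal L)\<^sup>2 + ennreal (C * \<bar>c\<bar>)" using L C(1) by (simp add: ennreal_plus ennreal_power)
    also have "\<dots> \<le> (curve_length A \<rho> \<gamma>)\<^sup>2 + ennreal (C * \<bar>c\<bar>)" using L_le by (intro add_right_mono power_mono) simp_all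
    finally show ?thesis unfolding \<zeta>_def .
  qed
  have "(sr_dist A \<Delta> \<rho> 1 (q * lie_exp A (c *\<^sub>R br X Y)))\<^sup>2 \<le> (sr_dist A \<Delta> \<rho> 1 q)\<^sup>2 + ennreal (C * \<bar>c\<bar>)" for q c
  proof (cases "sr_dist A \<Delta> \<rho> 1 q = \<infinity>")
    case True
    then show ?thesis by (simp add: power2_eq_square ennreal_mult_top)
  next
    case False
    then obtain l where l: "l \<ge> 0" "sr_dist A \<Delta> \<rho> 1 q = ennreal l" by (cases "sr_dist A \<Delta> \<rho> 1 q") auto
    have "(sr_dist A \<Delta> \<rho> 1 (q * lie_exp A (c *\<^sub>R br X Y)))\<^sup>2 \<le> ennreal ((l + \<epsilon>)\<^sup>2 + C * \<bar>c\<bar>)" if \<epsilon>: "\<epsilon> > 0" for \<epsilon>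
    proof -
      have "sr_dist A \<Delta> \<rho> 1 q < ennreal (l + \<epsilon>)" using l \<epsilon> by (simp add: ennreal_lessI)
      then obtain \<gamma> where \<gamma>: "horizontal_curve A \<Delta> \<gamma>" "1 \<in> \<gamma> ` {0..1}" "q \<in> \<gamma> ` {0..1}" "curve_length A \<rho> \<gamma> < ennreal (l + \<epsilon>)"
        unfolding sr_dist_def INF_less_iff by blast
      have "(sr_dist A \<Delta> \<rho> 1 (q * lie_exp A (c *\<^sub>R br X Y)))\<^sup>2 \<le> (curve_length A \<rho> \<gamma>)\<^sup>2 + ennreal (C * \<bar>c\<bar>)"
        by (rule curve[OF \<gamma>(1-3)])
      also have "\<dots> \<le> (ennreal (l + \<epsilon>))\<^sup>2 + ennreal (C * \<bar>c\<bar>)" using \<gamma>(4) by (intro add_right_mono power_mono) simp_all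
      also have "\<dots> = ennreal ((l + \<epsilon>)\<^sup>2 + C * \<bar>c\<bar>)"
        using l(1) \<epsilon> C(1) by (subst ennreal_plus[of "(l + \<epsilon>)\<^sup>2"]) (simp_all add: ennreal_power del: ennreal_plus)
      finally show ?thesis .
    qed
    then have "(sr_dist A \<Delta> \<rho> 1 (q * lie_exp A (c *\<^sub>R br X Y)))\<^sup>2 \<le> ennreal (l\<^sup>2 + C * \<bar>c\<bar>)" by (rule le_ennreal_square_limit)
    then show ?thesis using l C(1) by (simp add: ennreal_plus ennreal_power)
  qed
  with C(1) show ?thesis by blast
qed

text \<open>A basis of the derived algebra consisting of brackets of horizontal vectors reduces the general
  displacement to successive displacements along single brackets.\<close>

lemma sr_dist_derived_displacement:
  assumes N: "norm_on (derived_algebra A) N"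
  shows "\<exists>C>0. \<forall>q. \<forall>\<zeta>\<in>derived_algebra A.
    (sr_dist A \<Delta> \<rho> 1 (q * lie_exp A \<zeta>))\<^sup>2 \<le> (sr_dist A \<Delta> \<rho> 1 q)\<^sup>2 + ennreal (C * N \<zeta>)"
proof -
  define S where "S = {br v w | v w. v \<in> \<Delta> 1 \<and> w \<in> \<Delta> 1}"
  obtain B where B: "B \<subseteq> S" "independent B" "S \<subseteq> span B" by (rule maximal_independent_subset[of S]) blast
  have finB: "finite B" by (rule finiteI_independent[OF B(2)])
  have spanB: "derived_algebra A = span B"
    unfolding derived_algebra_horizontal S_def[symmetric]
    by (intro subset_antisym span_minimal[OF B(3)] span_mono B(1)) simp
  have "\<forall>b\<in>B. \<exists>C\<ge>0. \<forall>q c. (sr_dist A \<Delta> \<rho> 1 (q * lie_exp A (c *\<^sub>R b)))\<^sup>2 \<le> (sr_dist A \<Delta> \<rho> 1 q)\<^sup>2 + ennreal (C * \<bar>c\<bar>)"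
    using B(1) sr_dist_bracket_displacement unfolding S_def by blast
  then obtain C where C: "\<forall>b\<in>B. C b \<ge> 0 \<and>
      (\<forall>q c. (sr_dist A \<Delta> \<rho> 1 (q * lie_exp A (c *\<^sub>R b)))\<^sup>2 \<le> (sr_dist A \<Delta> \<rho> 1 q)\<^sup>2 + ennreal (C b * \<bar>c\<bar>))"
    unfolding bchoice_iff by blast
  have BZ: "c *\<^sub>R b \<in> derived_algebra A" if "b \<in> B" for b c
    unfolding spanB using that by (intro span_scale span_base)
  have sum: "(sr_dist A \<Delta> \<rho> 1 (q * lie_exp A (\<Sum>b\<in>B'. r b *\<^sub>R b)))\<^sup>2 \<le>
      (sr_dist A \<Delta> \<rho> 1 q)\<^sup>2 + ennreal (\<Sum>b\<in>B'. C b * \<bar>r b\<bar>)" if "B' \<subseteq> B" for q r B'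
    using finite_subset[OF that finB] that
  proof (induction B' arbitrary: q)
    case empty
    then show ?case by (simp add: lie_exp_zero)
  next
    case (insert b B')
    have b: "b \<in> B" and B': "B' \<subseteq> B" using insert.prems by auto
    have nn: "C b * \<bar>r b\<bar> \<ge> 0" "(\<Sum>b\<in>B'. C b * \<bar>r b\<bar>) \<ge> 0" using C b B' by (auto intro!: sum_nonneg)
    have "q * lie_exp A (\<Sum>b\<in>insert b B'. r b *\<^sub>R b) = q * lie_exp A (r b *\<^sub>R b) * lie_exp A (\<Sum>b\<in>B'. r b *\<^sub>R b)"
      using insert.hyps by (simp add: lie_exp_add_derived[OF BZ[OF b]] mult.assoc)
    then have "(sr_dist A \<Delta> \<rho> 1 (q * lie_exp A (\<Sum>b\<in>insert b B'. r b *\<^sub>R b)))\<^sup>2 \<le>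
        (sr_dist A \<Delta> \<rho> 1 (q * lie_exp A (r b *\<^sub>R b)))\<^sup>2 + ennreal (\<Sum>b\<in>B'. C b * \<bar>r b\<bar>)"
      using insert.IH[OF B', of "q * lie_exp A (r b *\<^sub>R b)"] by simp
    also have "\<dots> \<le> (sr_dist A \<Delta> \<rho> 1 q)\<^sup>2 + ennreal (C b * \<bar>r b\<bar>) + ennreal (\<Sum>b\<in>B'. C b * \<bar>r b\<bar>)"
      using C b by (intro add_right_mono) blast
    also have "\<dots> = (sr_dist A \<Delta> \<rho> 1 q)\<^sup>2 + ennreal (\<Sum>b\<in>insert b B'. C b * \<bar>r b\<bar>)"
      using insert.hyps nn by (simp add: ennreal_plus add.assoc)
    finally show ?case .
  qed
  have "\<forall>b\<in>B. \<exists>f::'e \<Rightarrow> real. linear f \<and> (\<forall>b'\<in>B. f b' = (if b' = b then 1 else 0))"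
    by (intro ballI linear_independent_extend[OF B(2)])
  then obtain f :: "'e \<Rightarrow> 'e \<Rightarrow> real" where f: "\<forall>b\<in>B. linear (f b) \<and> (\<forall>b'\<in>B. f b b' = (if b' = b then 1 else 0))"
    unfolding bchoice_iff by blast
  have coord: "(\<Sum>b\<in>B. f b \<zeta> *\<^sub>R b) = \<zeta>" if "\<zeta> \<in> span B" for \<zeta>
  proof (rule linear_eq_on[OF _ linear_ident that])
    have "linear (\<lambda>\<zeta>. f b \<zeta> *\<^sub>R b)" if "b \<in> B" for b
      using f that by (intro linearI) (auto simp: linear_add linear_cmul scaleR_left_distrib)
    then show "linear (\<lambda>\<zeta>. \<Sum>b\<in>B. f b \<zeta> *\<^sub>R b)" by (intro linear_compose_sum ballI)
    show "(\<Sum>b\<in>B. f b b' *\<^sub>R b) = b'" if "b' \<in> B" for b'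
      using f that finB by (simp add: if_distrib[of "\<lambda>x. x *\<^sub>R _"] sum.delta cong: if_cong)
  qed
  have "\<forall>b\<in>B. \<exists>K. \<forall>\<zeta>. \<bar>f b \<zeta>\<bar> \<le> K * norm \<zeta>" using f linear_bounded by force
  then obtain K where K: "\<forall>b\<in>B. \<forall>\<zeta>. \<bar>f b \<zeta>\<bar> \<le> K b * norm \<zeta>" unfolding bchoice_iff by blast
  obtain m where m: "m > 0" "\<And>u. u \<in> derived_algebra A \<Longrightarrow> m * norm u \<le> N u"
    by (rule norm_on_subspace_lower_bound[OF subspace_derived N]) blast
  define D where "D = (\<Sum>b\<in>B. C b * \<bar>K b\<bar>) / m"
  have D: "D \<ge> 0" unfolding D_def using C m(1) by (intro divide_nonneg_pos sum_nonneg) auto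
  have "(sr_dist A \<Delta> \<rho> 1 (q * lie_exp A \<zeta>))\<^sup>2 \<le> (sr_dist A \<Delta> \<rho> 1 q)\<^sup>2 + ennreal ((D + 1) * N \<zeta>)"
    if \<zeta>: "\<zeta> \<in> derived_algebra A" for q \<zeta>
  proof -
    have N0: "N \<zeta> \<ge> 0" using N \<zeta> by (simp add: norm_on_def)
    have "(\<Sum>b\<in>B. C b * \<bar>f b \<zeta>\<bar>) \<le> (\<Sum>b\<in>B. C b * (\<bar>K b\<bar> * norm \<zeta>))"
    proof (intro sum_mono mult_left_mono)
      fix b assume b: "b \<in> B"
      have "\<bar>f b \<zeta>\<bar> \<le> K b * norm \<zeta>" using K b by blast
      also have "\<dots> \<le> \<bar>K b\<bar> * norm \<zeta>" by (intro mult_right_mono) auto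
      finally show "\<bar>f b \<zeta>\<bar> \<le> \<bar>K b\<bar> * norm \<zeta>" .
    qed (use C in auto)
    also have "\<dots> = (\<Sum>b\<in>B. C b * \<bar>K b\<bar>) * norm \<zeta>" by (simp add: sum_distrib_right mult.assoc)
    also have "\<dots> = D * (m * norm \<zeta>)" using m(1) by (simp add: D_def)
    also have "\<dots> \<le> D * N \<zeta>" using D m(2)[OF \<zeta>] by (intro mult_left_mono)
    also have "\<dots> \<le> (D + 1) * N \<zeta>" using N0 by (simp add: algebra_simps)
    finally have le: "(\<Sum>b\<in>B. C b * \<bar>f b \<zeta>\<bar>) \<le> (D + 1) * N \<zeta>" .
    have "(sr_dist A \<Delta> \<rho> 1 (q * lie_exp A \<zeta>))\<^sup>2 \<le> (sr_dist A \<Delta> \<rho> 1 q)\<^sup>2 + ennreal (\<Sum>b\<in>B. C b * \<bar>f b \<zeta>\<bar>)"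
      using sum[OF subset_refl, of q "\<lambda>b. f b \<zeta>"] coord \<zeta> by (simp add: spanB)
    also have "\<dots> \<le> (sr_dist A \<Delta> \<rho> 1 q)\<^sup>2 + ennreal ((D + 1) * N \<zeta>)"
      by (intro add_left_mono ennreal_leI le)
    finally show ?thesis .
  qed
  then show ?thesis using D by (intro exI[of _ "D + 1"]) auto
qed

end

theorem corollary3p2:
  fixes A :: "('g::{mult_group, t2_space, second_countable_topology}, 'e::euclidean_space) chart set"
    and \<Delta> :: "'g \<Rightarrow> 'e set"
    and \<rho> :: "'g \<Rightarrow> 'e \<Rightarrow> 'e \<Rightarrow> real"
    and N :: "'e \<Rightarrow> real"
  assumes "lie_group A"
    and "simply_connected (UNIV :: 'g set)"
    and "two_step_nilpotent A"
    and "sub_riemannian A \<Delta> \<rho>"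
    and "norm_on (derived_algebra A) N"
  shows "\<exists>C>0. \<forall>q. \<forall>\<zeta>\<in>derived_algebra A.
    (sr_dist A \<Delta> \<rho> 1 (q * lie_exp A \<zeta>))\<^sup>2 \<le> (sr_dist A \<Delta> \<rho> 1 q)\<^sup>2 + ennreal (C * N \<zeta>)"
proof -
  interpret two_step_sub_riemannian A \<Delta> \<rho>
    using assms(1,3,4) by (intro two_step_sub_riemannian.intro lie_group_atlas.intro two_step_sub_riemannian_axioms.intro)
  show ?thesis by (rule sr_dist_derived_displacement[OF assms(5)])
qed

end
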